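(* Let $(\mathcal{E},d,\preceq)$ be an ordered Polish space and let $P$ be a stochastically monotone Markov kernel on $\mathcal{E}$. Assume that there exists a Borel set $C\subseteq\mathcal{E}$ such that the set $C\times C$ is achievable, and that there exist two measurable sets $A\preceq B$ in $\mathcal{E}$ and numbers $\varepsilon>0$ and $N\ge1$ (an integer) such that $$P^{(N)}(x,A)\ge\varepsilon\quad\text{and}\quad P^{(N)}(x,B)\ge\varepsilon,\qquad\text{for any }x\in C.$$ Then the set $M=\{(x,y)\in\mathcal{E}\times\mathcal{E}: x\preceq y\}$ is achievable.
   Context: An ordered Polish space is a Polish (complete separable metric) space $(\mathcal{E},d)$ with its Borel $\sigma$-algebra and a partial order $\preceq$ such that $M=\{(x,y): x\preceq y\}$ is closed in $\mathcal{E}\times\mathcal{E}$. For subsets $A,B\subseteq\mathcal{E}$, $A\preceq B$ means $x\preceq y$ for every $x\in A$ and $y\in B$. A Markov kernel $P(x,A)$ on $\mathcal{E}$ is a probability measure in $A$ for each $x$ and measurable in $x$ for each Borel $A$; no Feller property is assumed. $P^{(n)}$ is the $n$-step transition kernel. $P$ is stochastically monotone if, for every measurable increasing $g:\mathcal{E}\to[0,1]$ ($x\preceq y\Rightarrow g(x)\le g(y)$), the function $Pg(x)=\int g(y)P(x,dy)$ is also increasing. For $x,y\in\mathcal{E}$, a marginally Markovian $(x,y)$-coupling is a sequence of pairs $(X_n^x,X_n^y)_{n\in\mathbb{N}_0}$ of $\mathcal{E}$-valued random variables on a common probability space with $X_0^x=x$, $X_0^y=y$, such that for every $n\in\mathbb{N}_0$,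 almost surely, $$\mathbf{P}\big(X^x_{n+1}\in\cdot\,|\,\sigma(X^x_k,X^y_k)_{k\le n}\big)=P(X_n^x,\cdot),\qquad \mathbf{P}\big(X^y_{n+1}\in\cdot\,|\,\sigma(X^x_k,X^y_k)_{k\le n}\big)=P(X_n^y,\cdot).$$ A measurable set $H\subseteq\mathcal{E}\times\mathcal{E}$ is achievable if for every pair $(x,y)\in\mathcal{E}\times\mathcal{E}$ there is a marginally Markovian $(x,y)$-coupling such that $\tau_{x,y}(H)=\min\{n\ge 0: (X_n^x,X_n^y)\in H\}$ is almost surely finite. *)

theory Defs
  imports "HOL-Probability.Probability"
begin

definition ordered_polish :: "('a::polish_space \<Rightarrow> 'a \<Rightarrow> bool) \<Rightarrow> bool" where
  "ordered_polish le \<longleftrightarrow>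
     partial_order_on UNIV {(x, y). le x y} \<and> closed {(x, y). le x y}"

definition set_below :: "('a \<Rightarrow> 'a \<Rightarrow> bool) \<Rightarrow> 'a set \<Rightarrow> 'a set \<Rightarrow> bool" where
  "set_below le A B \<longleftrightarrow> (\<forall>x\<in>A. \<forall>y\<in>B. le x y)"

text \<open>Markov kernels are elements of \<open>borel \<rightarrow>\<^sub>M prob_algebra borel\<close>.\<close>

primrec kernel_power :: "('a::topological_space \<Rightarrow> 'a measure) \<Rightarrow> nat \<Rightarrow> 'a \<Rightarrow> 'a measure" where
  "kernel_power P 0 x = return borel x"
| "kernel_power P (Suc n) x = kernel_power P n x \<bind> P"

definition stochastically_monotone ::
  "('a::topological_space \<Rightarrow> 'a \<Rightarrow> bool) \<Rightarrow> ('a \<Rightarrow> 'a measure) \<Rightarrow> bool" where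
  "stochastically_monotone le P \<longleftrightarrow>
     (\<forall>g \<in> borel_measurable borel. (\<forall>x. g x \<in> {0..1::real}) \<longrightarrow> monotone le (\<le>) g \<longrightarrow>
        monotone le (\<le>) (\<lambda>x. \<integral>y. g y \<partial>P x))"

definition pair_history ::
  "'w measure \<Rightarrow> (nat \<Rightarrow> 'w \<Rightarrow> 'a::topological_space) \<Rightarrow> (nat \<Rightarrow> 'w \<Rightarrow> 'a) \<Rightarrow> nat \<Rightarrow> 'w measure" where
  "pair_history \<Omega> X Y n =
     sigma (space \<Omega>) {(\<lambda>\<omega>. (X k \<omega>, Y k \<omega>)) -` S \<inter> space \<Omega> | k S. k \<le> n \<and> S \<in> sets borel}"

text \<open>The identity of conditional laws is expressed set by set: for every Borel set \<open>S\<close>, the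
  conditional probability of \<open>X (Suc n) \<in> S\<close> agrees almost surely with \<open>P (X n) S\<close>. Since
  \<open>real_cond_exp\<close> picks a version for each \<open>S\<close> separately, the quantifier over \<open>S\<close> has to stay
  outside \<open>AE\<close>.\<close>

definition marginally_markovian_coupling ::
  "('a::polish_space \<Rightarrow> 'a measure) \<Rightarrow> 'a \<Rightarrow> 'a \<Rightarrow> 'w measure \<Rightarrow>
     (nat \<Rightarrow> 'w \<Rightarrow> 'a) \<Rightarrow> (nat \<Rightarrow> 'w \<Rightarrow> 'a) \<Rightarrow> bool" where
  "marginally_markovian_coupling P x y \<Omega> X Y \<longleftrightarrow>
     prob_space \<Omega> \<and>
     (\<forall>n. X n \<in> borel_measurable \<Omega> \<and> Y n \<in> borel_measurable \<Omega>) \<and>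
     (\<forall>\<omega>\<in>space \<Omega>. X 0 \<omega> = x \<and> Y 0 \<omega> = y) \<and>
     (\<forall>n. \<forall>S\<in>sets borel.
        (AE \<omega> in \<Omega>. real_cond_exp \<Omega> (pair_history \<Omega> X Y n)
             (indicator (X (Suc n) -` S \<inter> space \<Omega>)) \<omega> = measure (P (X n \<omega>)) S) \<and>
        (AE \<omega> in \<Omega>. real_cond_exp \<Omega> (pair_history \<Omega> X Y n)
             (indicator (Y (Suc n) -` S \<inter> space \<Omega>)) \<omega> = measure (P (Y n \<omega>)) S))"

definition hitting_time ::
  "('a \<times> 'a) set \<Rightarrow> (nat \<Rightarrow> 'w \<Rightarrow> 'a) \<Rightarrow> (nat \<Rightarrow> 'w \<Rightarrow> 'a) \<Rightarrow> 'w \<Rightarrow> enat" where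
  "hitting_time H X Y \<omega> = (INF n \<in> {n. (X n \<omega>, Y n \<omega>) \<in> H}. enat n)"

text \<open>HOL cannot quantify over the type of sample points inside a formula. Sample points are
  therefore taken from the type of paths of the pair process, with an arbitrary probability space
  on that type and arbitrary random variables on it. This is no restriction: by
  \<open>achievableI\<close> below, couplings on sample spaces of any type may be used.\<close>

definition achievable ::
  "('a::polish_space \<Rightarrow> 'a measure) \<Rightarrow> ('a \<times> 'a) set \<Rightarrow> bool" where
  "achievable P H \<longleftrightarrow> H \<in> sets borel \<and>
     (\<forall>x y. \<exists>(\<Omega> :: (nat \<Rightarrow> 'a \<times> 'a) measure) X Y.
        marginally_markovian_coupling P x y \<Omega> X Y \<and> (AE \<omega> in \<Omega>. hitting_time H X Y \<omega> < \<infinity>))"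

lemma hitting_time_finite_iff:
  "hitting_time H X Y \<omega> < \<infinity> \<longleftrightarrow> (\<exists>n. (X n \<omega>, Y n \<omega>) \<in> H)"
  unfolding hitting_time_def Inf_less_iff by (auto intro: exI[of _ "enat _"])

lemma space_pair_history [simp]: "space (pair_history \<Omega> X Y n) = space \<Omega>"
  unfolding pair_history_def by (rule space_measure_of) auto

lemma sets_pair_history:
  "sets (pair_history \<Omega> X Y n) = sigma_sets (space \<Omega>)
     {(\<lambda>\<omega>. (X k \<omega>, Y k \<omega>)) -` S \<inter> space \<Omega> | k S. k \<le> n \<and> S \<in> sets borel}"
  unfolding pair_history_def by (rule sets_measure_of) auto

lemma subalgebra_pair_history:
  fixes X Y :: "nat \<Rightarrow> 'w \<Rightarrow> 'a::polish_space"
  assumes "\<And>n. X n \<in> borel_measurable \<Omega>" "\<And>n. Y n \<in> borel_measurable \<Omega>"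
  shows "subalgebra \<Omega> (pair_history \<Omega> X Y n)"
proof -
  have "(\<lambda>\<omega>. (X k \<omega>, Y k \<omega>)) \<in> borel_measurable \<Omega>" for k
    using assms by (rule borel_measurable_Pair)
  then show ?thesis
    unfolding subalgebra_def sets_pair_history
    by (auto intro!: sets.sigma_sets_subset intro: measurable_sets)
qed

lemma measurable_pair_history:
  fixes X Y :: "nat \<Rightarrow> 'w \<Rightarrow> 'a::polish_space"
  assumes "k \<le> n"
  shows "(\<lambda>\<omega>. (X k \<omega>, Y k \<omega>)) \<in> borel_measurable (pair_history \<Omega> X Y n)"
  using assms by (intro measurableI) (auto simp: sets_pair_history)

lemma cond_law_transfer:
  fixes X Y :: "nat \<Rightarrow> 'w \<Rightarrow> 'a::polish_space" and X' Y' :: "nat \<Rightarrow> 'v \<Rightarrow> 'a"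
  assumes ps: "prob_space \<Omega>" and Z: "Z \<in> measurable \<Omega> N"
    and X': "\<And>k. X' k \<in> borel_measurable N" and Y': "\<And>k. Y' k \<in> borel_measurable N"
    and XZ: "\<And>k \<omega>. X k \<omega> = X' k (Z \<omega>)" and YZ: "\<And>k \<omega>. Y k \<omega> = Y' k (Z \<omega>)"
    and W': "W' \<in> borel_measurable N" and V': "V' \<in> borel_measurable (pair_history N X' Y' n)"
    and P: "P \<in> borel \<rightarrow>\<^sub>M prob_algebra borel" and S: "S \<in> sets borel"
    and eq: "AE \<omega> in \<Omega>. real_cond_exp \<Omega> (pair_history \<Omega> X Y n)
               (indicator ((\<lambda>\<omega>. W' (Z \<omega>)) -` S \<inter> space \<Omega>)) \<omega> = measure (P (V' (Z \<omega>))) S"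
  shows "AE \<omega> in distr \<Omega> N Z. real_cond_exp (distr \<Omega> N Z) (pair_history (distr \<Omega> N Z) X' Y' n)
               (indicator (W' -` S \<inter> space (distr \<Omega> N Z))) \<omega> = measure (P (V' \<omega>)) S"
proof -
  interpret O: prob_space \<Omega> by (rule ps)
  let ?D = "distr \<Omega> N Z"
  interpret D: prob_space ?D using Z by (rule O.prob_space_distr)
  let ?F = "pair_history \<Omega> X Y n" and ?G = "pair_history ?D X' Y' n"
  have Xeq: "X k = (\<lambda>\<omega>. X' k (Z \<omega>))" and Yeq: "Y k = (\<lambda>\<omega>. Y' k (Z \<omega>))" for k
    using XZ YZ by auto
  have XO: "X k \<in> borel_measurable \<Omega>" for k
    unfolding Xeq by (rule measurable_compose[OF Z X'])
  have YO: "Y k \<in> borel_measurable \<Omega>" for k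
    unfolding Yeq by (rule measurable_compose[OF Z Y'])
  have sF: "subalgebra \<Omega> ?F" by (rule subalgebra_pair_history[OF XO YO])
  have sG: "subalgebra ?D ?G" by (rule subalgebra_pair_history) (use X' Y' in auto)
  interpret F: finite_measure_subalgebra \<Omega> ?F by unfold_locales (rule sF)
  interpret G: finite_measure_subalgebra ?D ?G by unfold_locales (rule sG)
  have GN: "?G = pair_history N X' Y' n" by (simp add: pair_history_def)
  have ZFG: "Z \<in> measurable ?F ?G"
  proof (rule measurable_sigma_sets[OF sets_pair_history])
    show "Z \<in> space ?F \<rightarrow> space ?D" using measurable_space[OF Z] by auto
  next
    fix B assume "B \<in> {(\<lambda>\<omega>. (X' k \<omega>, Y' k \<omega>)) -` S \<inter> space ?D | k S. k \<le> n \<and> S \<in> sets borel}"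
    then obtain k T where B: "B = (\<lambda>\<omega>. (X' k \<omega>, Y' k \<omega>)) -` T \<inter> space ?D" "k \<le> n" "T \<in> sets borel"
      by auto
    have "Z -` B \<inter> space \<Omega> = (\<lambda>\<omega>. (X k \<omega>, Y k \<omega>)) -` T \<inter> space \<Omega>"
      using measurable_space[OF Z] by (auto simp: B XZ YZ)
    then show "Z -` B \<inter> space ?F \<in> sets ?F" using B by (auto simp: sets_pair_history)
  qed auto
  have PS: "(\<lambda>v. measure (P v) S) \<in> borel_measurable borel"
    using P measurable_measure_prob_algebra[OF S] by (rule measurable_compose)
  have PG: "(\<lambda>\<omega>. measure (P (V' \<omega>)) S) \<in> borel_measurable ?G"
    using measurable_compose[OF V' PS] unfolding GN .
  have PN: "(\<lambda>\<omega>. measure (P (V' \<omega>)) S) \<in> borel_measurable N"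
    using measurable_from_subalg[OF sG PG] by simp
  have PO: "(\<lambda>\<omega>. measure (P (V' (Z \<omega>))) S) \<in> borel_measurable \<Omega>"
    using Z PN by (rule measurable_compose)
  have prP: "prob_space (P v)" for v
    using measurable_space[OF P, of v] by (simp add: space_prob_algebra)
  have bd: "\<bar>measure (P v) S\<bar> \<le> 1" for v
    using prob_space.prob_le_1[OF prP] by simp
  let ?I' = "indicator (W' -` S \<inter> space ?D) :: 'v \<Rightarrow> real"
  let ?I = "indicator ((\<lambda>\<omega>. W' (Z \<omega>)) -` S \<inter> space \<Omega>) :: 'w \<Rightarrow> real"
  have WN: "W' -` S \<inter> space N \<in> sets N" using W' S by (rule measurable_sets)
  have WO: "(\<lambda>\<omega>. W' (Z \<omega>)) -` S \<inter> space \<Omega> \<in> sets \<Omega>"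
    using measurable_compose[OF Z W'] S by (rule measurable_sets)
  have IO: "integrable \<Omega> ?I" using WO by (simp add: O.emeasure_eq_measure)
  show ?thesis
  proof (rule G.real_cond_exp_charact)
    show "integrable ?D ?I'" using WN by (simp add: D.emeasure_eq_measure)
    show "integrable ?D (\<lambda>\<omega>. measure (P (V' \<omega>)) S)"
      using bd PN by (intro D.integrable_const_bound[of _ 1]) auto
    show "(\<lambda>\<omega>. measure (P (V' \<omega>)) S) \<in> borel_measurable ?G" by (rule PG)
  next
    fix B assume B: "B \<in> sets ?G"
    then have BN: "B \<in> sets N" using sG by (auto simp: subalgebra_def)
    let ?B = "Z -` B \<inter> space \<Omega>"
    have BF: "?B \<in> sets ?F" using measurable_sets[OF ZFG B] by simp
    have BO: "?B \<in> sets \<Omega>" using BF sF by (auto simp: subalgebra_def)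
    have "(\<integral>\<omega>\<in>B. ?I' \<omega> \<partial>?D) = (\<integral>\<omega>. indicator B (Z \<omega>) *\<^sub>R ?I' (Z \<omega>) \<partial>\<Omega>)"
      unfolding set_lebesgue_integral_def using Z BN WN by (intro integral_distr) simp_all
    also have "\<dots> = (\<integral>\<omega>\<in>?B. ?I \<omega> \<partial>\<Omega>)"
      unfolding set_lebesgue_integral_def
      using measurable_space[OF Z] by (intro Bochner_Integration.integral_cong refl) (auto simp: indicator_def)
    also have "\<dots> = (\<integral>\<omega>\<in>?B. real_cond_exp \<Omega> ?F ?I \<omega> \<partial>\<Omega>)"
      using IO BF by (rule F.real_cond_exp_intA)
    also have "\<dots> = (\<integral>\<omega>\<in>?B. measure (P (V' (Z \<omega>))) S \<partial>\<Omega>)"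
      unfolding set_lebesgue_integral_def
    proof (rule integral_cong_AE)
      show "AE \<omega> in \<Omega>. indicat_real ?B \<omega> *\<^sub>R real_cond_exp \<Omega> ?F ?I \<omega> =
          indicat_real ?B \<omega> *\<^sub>R measure (P (V' (Z \<omega>))) S"
        using eq by eventually_elim simp
    qed (use BO PO in simp_all)
    also have "\<dots> = (\<integral>\<omega>. indicator B (Z \<omega>) *\<^sub>R measure (P (V' (Z \<omega>))) S \<partial>\<Omega>)"
      unfolding set_lebesgue_integral_def
      by (intro Bochner_Integration.integral_cong refl) (auto simp: indicator_def)
    also have "\<dots> = (\<integral>\<omega>\<in>B. measure (P (V' \<omega>)) S \<partial>?D)"
      unfolding set_lebesgue_integral_def using Z BN PN by (intro integral_distr[symmetric]) simp_all
    finally show "(\<integral>\<omega>\<in>B. ?I' \<omega> \<partial>?D) = (\<integral>\<omega>\<in>B. measure (P (V' \<omega>)) S \<partial>?D)" .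
  qed
qed

lemma achievableI:
  fixes H :: "('a::polish_space \<times> 'a) set"
  assumes P: "P \<in> borel \<rightarrow>\<^sub>M prob_algebra borel" and H: "H \<in> sets borel"
    and ex: "\<And>x y. \<exists>(\<Omega> :: 'w measure) X Y.
      marginally_markovian_coupling P x y \<Omega> X Y \<and> (AE \<omega> in \<Omega>. hitting_time H X Y \<omega> < \<infinity>)"
  shows "achievable P H"
  unfolding achievable_def
proof (intro conjI allI)
  show "H \<in> sets borel" by (rule H)
next
  fix x y :: 'a
  obtain \<Omega> :: "'w measure" and X Y where c: "marginally_markovian_coupling P x y \<Omega> X Y"
    and t: "AE \<omega> in \<Omega>. hitting_time H X Y \<omega> < \<infinity>" using ex by blast
  have ps: "prob_space \<Omega>" and X: "\<And>n. X n \<in> borel_measurable \<Omega>" and Y: "\<And>n. Y n \<in> borel_measurable \<Omega>"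
    and X0: "\<And>\<omega>. \<omega> \<in> space \<Omega> \<Longrightarrow> X 0 \<omega> = x" and Y0: "\<And>\<omega>. \<omega> \<in> space \<Omega> \<Longrightarrow> Y 0 \<omega> = y"
    using c by (auto simp: marginally_markovian_coupling_def)
  define K :: "(nat \<Rightarrow> 'a \<times> 'a) measure" where "K = (\<Pi>\<^sub>M k\<in>UNIV. borel)"
  define N where "N = restrict_space K {f. f 0 = (x, y)}"
  define Z where "Z \<omega> = (\<lambda>k. (X k \<omega>, Y k \<omega>))" for \<omega>
  define X' where "X' k f = fst (f k)" for k and f :: "nat \<Rightarrow> 'a \<times> 'a"
  define Y' where "Y' k f = snd (f k)" for k and f :: "nat \<Rightarrow> 'a \<times> 'a"
  have "(\<lambda>\<omega>. (X k \<omega>, Y k \<omega>)) \<in> borel_measurable \<Omega>" for k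
    using X Y by (rule borel_measurable_Pair)
  then have "Z \<in> measurable \<Omega> K"
    unfolding Z_def K_def by (intro measurable_PiM_single') auto
  then have Z: "Z \<in> measurable \<Omega> N"
    unfolding N_def by (rule measurable_restrict_space2[rotated]) (auto simp: Z_def X0 Y0)
  have ev: "(\<lambda>f. f k) \<in> borel_measurable N" for k
    unfolding N_def K_def by (intro measurable_restrict_space1 measurable_component_singleton) simp
  have evp: "(\<lambda>f. f k) \<in> N \<rightarrow>\<^sub>M (borel \<Otimes>\<^sub>M borel)" for k
    using ev unfolding borel_prod .
  have X': "X' k \<in> borel_measurable N" for k
    unfolding X'_def by (rule measurable_compose[OF evp measurable_fst])
  have Y': "Y' k \<in> borel_measurable N" for k
    unfolding Y'_def by (rule measurable_compose[OF evp measurable_snd])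
  have pairh: "(\<lambda>\<omega>. (X' n \<omega>, Y' n \<omega>)) \<in> pair_history N X' Y' n \<rightarrow>\<^sub>M (borel \<Otimes>\<^sub>M borel)" for n
    using measurable_pair_history[of n n X' Y' N] unfolding borel_prod by simp
  have VX: "X' n \<in> borel_measurable (pair_history N X' Y' n)" for n
    using measurable_compose[OF pairh measurable_fst] by simp
  have VY: "Y' n \<in> borel_measurable (pair_history N X' Y' n)" for n
    using measurable_compose[OF pairh measurable_snd] by simp
  have XZ: "\<And>k \<omega>. X k \<omega> = X' k (Z \<omega>)" and YZ: "\<And>k \<omega>. Y k \<omega> = Y' k (Z \<omega>)"
    by (simp_all add: X'_def Y'_def Z_def)
  have Xeq: "X k = (\<lambda>\<omega>. X' k (Z \<omega>))" and Yeq: "Y k = (\<lambda>\<omega>. Y' k (Z \<omega>))" for k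
    using XZ YZ by auto
  let ?D = "distr \<Omega> N Z"
  note tr = cond_law_transfer[where X = X and Y = Y and Z = Z and X' = X' and Y' = Y', OF ps Z X' Y' XZ YZ _ _ P]
  have "marginally_markovian_coupling P x y ?D X' Y'"
    unfolding marginally_markovian_coupling_def
  proof (intro conjI allI ballI)
    show "prob_space ?D" using ps Z by (rule prob_space.prob_space_distr)
    show "X' n \<in> borel_measurable ?D" "Y' n \<in> borel_measurable ?D" for n
      using X' Y' by simp_all
    show "X' 0 \<omega> = x" "Y' 0 \<omega> = y" if "\<omega> \<in> space ?D" for \<omega>
      using that by (simp_all add: N_def space_restrict_space X'_def Y'_def)
  next
    fix n and S :: "'a set" assume S: "S \<in> sets borel"
    show "AE \<omega> in ?D. real_cond_exp ?D (pair_history ?D X' Y' n)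
        (indicator (X' (Suc n) -` S \<inter> space ?D)) \<omega> = measure (P (X' n \<omega>)) S"
      using c S by (intro tr X' VX S) (simp add: marginally_markovian_coupling_def flip: XZ)
    show "AE \<omega> in ?D. real_cond_exp ?D (pair_history ?D X' Y' n)
        (indicator (Y' (Suc n) -` S \<inter> space ?D)) \<omega> = measure (P (Y' n \<omega>)) S"
      using c S by (intro tr Y' VY S) (simp add: marginally_markovian_coupling_def flip: YZ)
  qed
  moreover have "AE f in ?D. hitting_time H X' Y' f < \<infinity>"
  proof -
    have HN: "(\<lambda>f. f k) -` H \<inter> space N \<in> sets N" for k using ev H by (rule measurable_sets)
    have "{f \<in> space N. hitting_time H X' Y' f < \<infinity>} = (\<Union>k. (\<lambda>f. f k) -` H \<inter> space N)"
      unfolding hitting_time_finite_iff X'_def Y'_def prod.collapse by blast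
    moreover have "(\<Union>k. (\<lambda>f. f k) -` H \<inter> space N) \<in> sets N"
      using HN by (intro sets.countable_UN) blast
    ultimately have "{f \<in> space N. hitting_time H X' Y' f < \<infinity>} \<in> sets N"
      by (simp only:)
    moreover have "AE \<omega> in \<Omega>. hitting_time H X' Y' (Z \<omega>) < \<infinity>"
      using t unfolding hitting_time_finite_iff by (simp add: XZ YZ)
    ultimately show ?thesis by (simp only: AE_distr_iff[OF Z])
  qed
  ultimately show "\<exists>(\<Omega> :: (nat \<Rightarrow> 'a \<times> 'a) measure) X Y.
      marginally_markovian_coupling P x y \<Omega> X Y \<and> (AE \<omega> in \<Omega>. hitting_time H X Y \<omega> < \<infinity>)"
    by blast
qed

end

theory Submission
  imports Defs
begin

text \<open>
  Start the two chains at \<open>x\<close> and \<open>y\<close>, couple them until both are in \<open>C\<close>, and from then on let them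
  run independently. After \<open>N\<close> further steps the first is in \<open>A\<close> and the second in \<open>B\<close> with
  probability at least \<open>\<epsilon>\<^sup>2\<close>, and then they are ordered because \<open>A\<close> lies below \<open>B\<close>. If this attempt
  fails, a new one starts from the pair of points reached. Each attempt, given that all earlier ones
  have failed, succeeds with probability bounded below, so one of them succeeds almost surely. The
  argument in fact shows that the rectangle \<open>A \<times> B\<close> is hit.

  The difficulty is in restarting from a random point. Achievability provides one coupling for each
  pair of starting points, without any measurable dependence on that pair, so a choice of couplings
  is not a kernel and cannot simply be integrated against the law of the pair reached. Instead of
  selecting couplings measurably, the proof passes to limits of set functions.

  The law of a coupling is described (\<open>coupling_law\<close>) by inequalities
  \<open>\<mu> (F \<inter> {X (n+1) \<in> S}) \<le> a * \<mu> F\<close>, one for each event \<open>F\<close> of the history up to time \<open>n\<close> on which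
  \<open>P (X n) S \<le> a\<close>, and the same for \<open>Y\<close>. Each of them involves only two values of \<open>\<mu>\<close>, so they survive
  pointwise limits of set functions along arbitrary filters, and such limits exist by Tychonoff's
  theorem. A limit is a priori only finitely additive. Its marginal at each single coordinate,
  however, is forced by the inequalities to be the measure \<open>P\<^sup>n(x, \<cdot>)\<close> or \<open>P\<^sup>n(y, \<cdot>)\<close>. A finitely additive set
  function on a product of Polish spaces all of whose marginals are measures is approximated from
  inside by compact sets and hence countably additive on cylinders; it extends to a measure
  (\<open>product_content.extension\<close>). Thus limits of coupling laws are coupling laws
  (\<open>coupling_law_limit\<close>).

  A law \<open>\<mu>\<close> is now continued after a stopping time by an arbitrary choice of couplings
  (\<open>coupling_law_continue\<close>): replace every path by a representative of its cell in a finite Borel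
  partition of path space, which makes the choice a simple function, and take a limit as the
  partition is refined. The number of steps that the new coupling needs to succeed with the required probability
  is again a non-measurable function of the path. Representatives are therefore taken in a given set
  \<open>D\<close> whenever the cell meets \<open>D\<close>, so that \<open>D\<close> contributes its outer measure to the limit. Outer
  measure is continuous along increasing sequences of arbitrary sets
  (\<open>outer_measure_continuity\<close>), and so a single deterministic number of steps serves half of the mass
  of the paths that have not yet succeeded. Each round then multiplies the probability of failure by
  a fixed number below 1 (\<open>hit_by_improve\<close>), and one more limit joins the countably many rounds
  (\<open>hit_by_almost_surely\<close>).
\<close>

section \<open>Finitely additive set functions with countably additive marginals\<close>

locale borel_content =
  fixes m :: "'w::topological_space set \<Rightarrow> real"
  assumes nonneg: "A \<in> sets borel \<Longrightarrow> 0 \<le> m A"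
    and total: "m UNIV = 1"
    and additive: "A \<in> sets borel \<Longrightarrow> B \<in> sets borel \<Longrightarrow> A \<inter> B = {} \<Longrightarrow> m (A \<union> B) = m A + m B"
begin

lemma empty: "m {} = 0"
  using additive[of "{}" "{}"] by simp

lemma diff:
  assumes "A \<in> sets borel" "B \<in> sets borel" "A \<subseteq> B"
  shows "m (B - A) = m B - m A"
proof -
  have "A \<union> (B - A) = B" using assms by blast
  with additive[of A "B - A"] assms show ?thesis by auto
qed

lemma mono:
  assumes "A \<in> sets borel" "B \<in> sets borel" "A \<subseteq> B"
  shows "m A \<le> m B"
  using diff[OF assms] nonneg[of "B - A"] assms by auto

lemma subadditive:
  assumes "A \<in> sets borel" "B \<in> sets borel"
  shows "m (A \<union> B) \<le> m A + m B"
proof -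
  have "A \<union> B = A \<union> (B - A)" by blast
  then have "m (A \<union> B) = m A + m (B - A)"
    using additive[of A "B - A"] assms by auto
  also have "m (B - A) \<le> m B" using assms by (intro mono) auto
  finally show ?thesis by simp
qed

lemma subadditive_UN:
  assumes "finite I" "\<And>i. i \<in> I \<Longrightarrow> A i \<in> sets borel"
  shows "m (\<Union>i\<in>I. A i) \<le> (\<Sum>i\<in>I. m (A i))"
  using assms
proof (induction I)
  case (insert i I)
  have "m (\<Union>j\<in>insert i I. A j) \<le> m (A i) + m (\<Union>j\<in>I. A j)"
    using insert by (auto intro!: subadditive)
  with insert show ?case by force
qed (simp add: empty)

text \<open>The algebra on which countable additivity can be checked by compactness: sets that are squeezed
  between a closed and an open set with little content in between.\<close>

definition regular_sets :: "'w set set" where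
  "regular_sets = {A \<in> sets borel. \<forall>e>0. \<exists>F G. closed F \<and> open G \<and> F \<subseteq> A \<and> A \<subseteq> G \<and> m (G - F) < e}"

lemma regular_sets_borel: "A \<in> regular_sets \<Longrightarrow> A \<in> sets borel"
  by (simp add: regular_sets_def)

lemma algebra_regular_sets: "algebra UNIV regular_sets"
  unfolding algebra_iff_Un
proof (intro conjI ballI)
  show "{} \<in> regular_sets"
    unfolding regular_sets_def by (auto intro!: exI[of _ "{}"] simp: empty)
next
  fix A assume A: "A \<in> regular_sets"
  show "UNIV - A \<in> regular_sets"
    unfolding regular_sets_def
  proof (intro CollectI conjI allI impI)
    fix e :: real assume "e > 0"
    with A obtain F G where "closed F" "open G" "F \<subseteq> A" "A \<subseteq> G" "m (G - F) < e"
      unfolding regular_sets_def by blast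
    moreover have "- F - - G = G - F" by blast
    ultimately show "\<exists>F G. closed F \<and> open G \<and> F \<subseteq> UNIV - A \<and> UNIV - A \<subseteq> G \<and> m (G - F) < e"
      by (intro exI[of _ "- G"] exI[of _ "- F"]) auto
  qed (use regular_sets_borel[OF A] in auto)
next
  fix A B assume A: "A \<in> regular_sets" and B: "B \<in> regular_sets"
  show "A \<union> B \<in> regular_sets"
    unfolding regular_sets_def
  proof (intro CollectI conjI allI impI)
    fix e :: real assume "e > 0"
    then have e: "e/2 > 0" by simp
    obtain F G where FG: "closed F" "open G" "F \<subseteq> A" "A \<subseteq> G" "m (G - F) < e/2"
      using A e unfolding regular_sets_def by blast
    obtain F' G' where FG': "closed F'" "open G'" "F' \<subseteq> B" "B \<subseteq> G'" "m (G' - F') < e/2"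
      using B e unfolding regular_sets_def by blast
    have "m ((G \<union> G') - (F \<union> F')) \<le> m ((G - F) \<union> (G' - F'))"
      using FG FG' by (intro mono) auto
    also have "\<dots> \<le> m (G - F) + m (G' - F')"
      using FG FG' by (intro subadditive) auto
    finally have "m ((G \<union> G') - (F \<union> F')) < e" using FG FG' by simp
    then show "\<exists>F G. closed F \<and> open G \<and> F \<subseteq> A \<union> B \<and> A \<union> B \<subseteq> G \<and> m (G - F) < e"
      using FG FG' by (intro exI[of _ "F \<union> F'"] exI[of _ "G \<union> G'"]) auto
  qed (use regular_sets_borel[OF A] regular_sets_borel[OF B] in auto)
qed auto

end

lemma measurable_coordinate:
  "(\<lambda>\<omega>. \<omega> i) \<in> borel_measurable (borel :: ('i \<Rightarrow> 'a::topological_space) measure)"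
  by (intro borel_measurable_continuous_onI continuous_on_product_coordinates)

lemma coordinate_sets:
  "S \<in> sets borel \<Longrightarrow> {\<omega>. \<omega> i \<in> S} \<in> sets (borel :: ('i \<Rightarrow> 'a::topological_space) measure)"
  using measurable_sets[OF measurable_coordinate, of S i] by (simp add: vimage_def)

text \<open>Finitely additive set functions on a countable product of Polish spaces whose one-dimensional
  marginals are genuine probability measures, while joint marginals may be only finitely additive.\<close>

locale product_content = borel_content m
  for m :: "('i::countable \<Rightarrow> 'b::polish_space) set \<Rightarrow> real" +
  fixes \<nu> :: "'i \<Rightarrow> 'b measure"
  assumes prob_marginal: "prob_space (\<nu> i)"
    and sets_marginal: "sets (\<nu> i) = sets borel"
    and marginal: "S \<in> sets borel \<Longrightarrow> m {\<omega>. \<omega> i \<in> S} = measure (\<nu> i) S"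
begin

lemma inner_compact:
  assumes "S \<in> sets borel" "e > 0"
  obtains K where "compact K" "K \<subseteq> S" "measure (\<nu> i) (S - K) < e"
proof -
  interpret prob_space "\<nu> i" by (rule prob_marginal)
  have "\<exists>K. K \<subseteq> S \<and> compact K \<and> measure (\<nu> i) S - e < measure (\<nu> i) K"
  proof (cases "measure (\<nu> i) S < e")
    case True
    then show ?thesis by (intro exI[of _ "{}"]) auto
  next
    case False
    have "ennreal (measure (\<nu> i) S - e) < emeasure (\<nu> i) S"
      using assms False by (simp add: emeasure_eq_measure ennreal_less_iff)
    also have "emeasure (\<nu> i) S = (SUP K \<in> {K. K \<subseteq> S \<and> compact K}. emeasure (\<nu> i) K)"
      by (rule inner_regular) (use assms sets_marginal in auto)
    finally show ?thesis
      using False by (auto simp: less_SUP_iff emeasure_eq_measure ennreal_less_iff)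
  qed
  then obtain K where K: "K \<subseteq> S" "compact K" "measure (\<nu> i) S - e < measure (\<nu> i) K"
    by blast
  have "measure (\<nu> i) (S - K) = measure (\<nu> i) S - measure (\<nu> i) K"
    using K(1) assms sets_marginal borel_compact[OF K(2)] K(1) by (intro finite_measure_Diff) auto
  with K show thesis by (intro that) auto
qed

lemma coordinate_regular:
  assumes S: "S \<in> sets borel"
  shows "{\<omega>. \<omega> i \<in> S} \<in> regular_sets"
  unfolding regular_sets_def
proof (intro CollectI conjI allI impI coordinate_sets S)
  fix e :: real assume "e > 0"
  then have e: "e/2 > 0" by simp
  interpret prob_space "\<nu> i" by (rule prob_marginal)
  obtain K where K: "compact K" "K \<subseteq> S" "measure (\<nu> i) (S - K) < e/2"
    using inner_compact[OF S e] .
  have "- S \<in> sets borel" using S by auto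
  then obtain L where L: "compact L" "L \<subseteq> - S" "measure (\<nu> i) (- S - L) < e/2"
    using inner_compact[OF _ e] by metis
  let ?F = "{\<omega>::'i \<Rightarrow> 'b. \<omega> i \<in> K}" and ?G = "{\<omega>::'i \<Rightarrow> 'b. \<omega> i \<in> - L}"
  have "closed ?F"
    using closed_vimage[OF compact_imp_closed[OF K(1)] continuous_on_product_coordinates[of i]]
    by (simp add: vimage_def)
  moreover have "open ?G"
    using open_vimage[of "- L", OF _ continuous_on_product_coordinates[of i]] compact_imp_closed[OF L(1)]
    by (simp add: vimage_def open_Compl)
  moreover have "m (?G - ?F) < e"
  proof -
    have "?G - ?F = {\<omega>. \<omega> i \<in> (S - K) \<union> (- S - L)}" using K L by auto
    also have "m \<dots> = measure (\<nu> i) ((S - K) \<union> (- S - L))"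
      using S borel_compact[OF K(1)] borel_compact[OF L(1)] by (intro marginal) auto
    also have "\<dots> \<le> measure (\<nu> i) (S - K) + measure (\<nu> i) (- S - L)"
      using S borel_compact[OF K(1)] borel_compact[OF L(1)] sets_marginal
      by (intro measure_Un_le) auto
    finally show ?thesis using K L by simp
  qed
  ultimately show "\<exists>F G. closed F \<and> open G \<and> F \<subseteq> {\<omega>. \<omega> i \<in> S} \<and> {\<omega>. \<omega> i \<in> S} \<subseteq> G \<and> m (G - F) < e"
    using K L by (intro exI[of _ ?F] exI[of _ ?G]) auto
qed

lemma sum_geometric_bound: "(\<Sum>l<n::nat. d * (1/2)^l) \<le> 2 * d" if "d \<ge> 0" for d :: real
proof -
  have "(\<Sum>l<n. (1/2::real)^l) \<le> 2" by (simp add: geometric_sum)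
  then show ?thesis
    using that mult_left_mono[of "\<Sum>l<n. (1/2::real)^l" 2 d] by (simp add: sum_distrib_left mult.commute)
qed

text \<open>Ulam tightness of the marginals confines all but little content to a product of compact sets.
  If the sets \<open>A k\<close> kept content at least \<open>l\<close>, closed subsets \<open>F k\<close> losing at most \<open>l/2\<close> in total, also
  after the confinement of the first \<open>k\<close> coordinates, would have the finite intersection property in
  a compact product.\<close>

lemma continuous_at_empty:
  assumes A: "range A \<subseteq> regular_sets" "decseq A" "(\<Inter>k. A k) = {}"
  shows "(\<lambda>k::nat. m (A k)) \<longlonglongrightarrow> 0"
proof (rule ccontr)
  assume not0: "\<not> (\<lambda>k. m (A k)) \<longlonglongrightarrow> 0"
  have Ab: "A k \<in> sets borel" for k using A regular_sets_borel by blast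
  have dec: "decseq (\<lambda>k. m (A k))"
    using A(2) Ab by (auto simp: decseq_def intro!: mono)
  have "bounded (range (\<lambda>k. m (A k)))"
    using nonneg[OF Ab] mono[OF Ab, of UNIV] total by (intro boundedI[of _ 1]) force
  then obtain l where l: "(\<lambda>k. m (A k)) \<longlonglongrightarrow> l"
    using dec decseq_convergent[of "\<lambda>k. m (A k)" 0] nonneg Ab by metis
  have "0 \<le> l" using l nonneg[OF Ab] by (intro LIMSEQ_le_const) auto
  with not0 l have l0: "l > 0" by (cases "l = 0") auto
  have lA: "l \<le> m (A k)" for k using decseq_ge[OF dec l] .
  \<comment> \<open>Each of the two error series below sums to at most \<open>2 * d\<close>, so together they lose \<open>l / 2\<close>.\<close>
  define d where "d = l / 8"
  have d: "d > 0" using l0 by (simp add: d_def)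
  have "\<exists>F. closed F \<and> F \<subseteq> A k \<and> m (A k - F) < d * (1/2)^k" for k
  proof -
    have "A k \<in> regular_sets" "d * (1/2)^k > 0" using A d by auto
    then obtain F G where FG: "closed F" "open G" "F \<subseteq> A k" "A k \<subseteq> G" "m (G - F) < d * (1/2)^k"
      unfolding regular_sets_def by blast
    have "m (A k - F) \<le> m (G - F)" using FG Ab by (intro mono) auto
    with FG show ?thesis by auto
  qed
  then obtain F where F: "\<And>k. closed (F k)" "\<And>k. F k \<subseteq> A k" "\<And>k. m (A k - F k) < d * (1/2)^k"
    by metis
  have "\<exists>K. compact K \<and> measure (\<nu> (from_nat j)) (- K) < d * (1/2)^j" for j
    using inner_compact[of UNIV "d * (1/2)^j" "from_nat j"] d by (auto simp: Compl_eq_Diff_UNIV)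
  then obtain K where K: "\<And>j. compact (K j)" "\<And>j. measure (\<nu> (from_nat j)) (- K j) < d * (1/2)^j"
    by metis
  have Fb: "F k \<in> sets borel" for k using F by auto
  have Kb: "- K k \<in> sets borel" for k using borel_compact[OF K(1)] by (simp add: borel_comp)
  define E where "E k = (\<Inter>j\<in>{..<Suc k}. F j) \<inter> {\<omega>. \<forall>j<k. \<omega> (from_nat j) \<in> K j}" for k
  have "E k \<noteq> {}" for k
  proof
    assume E: "E k = {}"
    let ?U = "\<Union>j\<in>{..<Suc k}. A j - F j" and ?V = "\<Union>j\<in>{..<k}. {\<omega>::'i \<Rightarrow> 'b. \<omega> (from_nat j) \<in> - K j}"
    have Ub: "?U \<in> sets borel" using Ab Fb by auto
    have Vj: "{\<omega>::'i \<Rightarrow> 'b. \<omega> (from_nat j) \<in> - K j} \<in> sets borel" for j by (rule coordinate_sets[OF Kb])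
    have Vb: "?V \<in> sets borel" by (rule sets.finite_UN) (use Vj in blast)+
    have "A k \<subseteq> ?U \<union> ?V"
    proof
      fix \<omega> assume w: "\<omega> \<in> A k"
      then have "\<omega> \<in> A j" if "j < Suc k" for j
        using decseqD[OF A(2), of j k] that by auto
      moreover have "\<omega> \<notin> E k" using E by simp
      ultimately show "\<omega> \<in> ?U \<union> ?V" unfolding E_def by auto
    qed
    then have "m (A k) \<le> m (?U \<union> ?V)" using Ab Ub Vb by (intro mono) auto
    also have "\<dots> \<le> m ?U + m ?V" by (intro subadditive Ub Vb)
    also have "m ?U \<le> (\<Sum>j<Suc k. m (A j - F j))" using Ab Fb by (intro subadditive_UN) auto
    also have "\<dots> \<le> (\<Sum>j<Suc k. d * (1/2)^j)" using F by (intro sum_mono) (auto intro: less_imp_le)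
    also have "\<dots> \<le> 2 * d" using d by (intro sum_geometric_bound) simp
    also have "m ?V \<le> (\<Sum>j<k. m {\<omega>. \<omega> (from_nat j) \<in> - K j})"
      by (rule subadditive_UN) (use Vj in blast)+
    also have "\<dots> \<le> (\<Sum>j<k. d * (1/2)^j)"
      using K marginal[OF Kb] by (intro sum_mono) (auto intro: less_imp_le)
    also have "\<dots> \<le> 2 * d" using d by (intro sum_geometric_bound) simp
    finally have "m (A k) \<le> 2 * d + 2 * d" by simp
    with lA[of k] l0 show False by (simp add: d_def)
  qed
  then have "\<forall>k. \<exists>x. x \<in> E k" by blast
  then obtain p where p: "\<And>k. p k \<in> E k" by metis
  \<comment> \<open>The point \<open>p k\<close> is confined only in its first \<open>k\<close> coordinates. Adding the finitely many exceptional
    values to each factor keeps it compact and puts the whole sequence into one compact product.\<close>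
  define Q where "Q i = K (to_nat i) \<union> (\<lambda>k. p k i) ` {..to_nat i}" for i
  have "compact (Q i)" for i
    unfolding Q_def by (rule compact_Un[OF K(1) finite_imp_compact]) simp
  then have Q: "compact (PiE UNIV Q)"
    using compactin_PiE[of "\<lambda>_. euclidean" UNIV Q] by (simp add: euclidean_product_topology)
  have pQ: "p k \<in> PiE UNIV Q" for k
  proof -
    have "p k i \<in> Q i" for i
    proof (cases "to_nat i < k")
      case True
      then have "p k (from_nat (to_nat i)) \<in> K (to_nat i)" using p[of k] unfolding E_def by blast
      then show ?thesis by (simp add: Q_def)
    qed (auto simp: Q_def)
    then show ?thesis by auto
  qed
  have "PiE UNIV Q \<inter> (\<Inter>k. F k) \<noteq> {}"
  proof (rule compact_imp_fip_image[OF Q])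
    fix I' :: "nat set" assume "finite I'"
    then obtain k where k: "\<And>j. j \<in> I' \<Longrightarrow> j < k"
      unfolding finite_nat_set_iff_bounded by blast
    have "p k \<in> F j" if "j \<in> I'" for j using p[of k] k[OF that] unfolding E_def by auto
    with pQ[of k] show "PiE UNIV Q \<inter> (\<Inter>k\<in>I'. F k) \<noteq> {}" by blast
  qed (use F in auto)
  then obtain \<omega> where "\<And>k. \<omega> \<in> F k" by auto
  then have "\<omega> \<in> (\<Inter>k. A k)" using F(2) by auto
  with A(3) show False by simp
qed

text \<open>Caratheodory's theorem on the algebra of regular sets, which contains the one-coordinate cylinders
  and hence generates the Borel sets of the product.\<close>

theorem extension:
  obtains \<mu> where "prob_space \<mu>" "sets \<mu> = sets borel" "\<And>A. A \<in> regular_sets \<Longrightarrow> measure \<mu> A = m A"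
proof -
  interpret algebra UNIV regular_sets by (rule algebra_regular_sets)
  have "\<exists>\<mu>. (\<forall>s\<in>regular_sets. \<mu> s = ennreal (m s)) \<and> measure_space UNIV (sigma_sets UNIV regular_sets) \<mu>"
  proof (rule caratheodory_empty_continuous)
    show "positive regular_sets (\<lambda>s. ennreal (m s))" by (simp add: positive_def empty)
    show "additive regular_sets (\<lambda>s. ennreal (m s))"
      unfolding additive_def
    proof (intro ballI impI)
      fix A B assume "A \<in> regular_sets" "B \<in> regular_sets" "A \<inter> B = {}"
      then show "ennreal (m (A \<union> B)) = ennreal (m A) + ennreal (m B)"
        using additive[of A B] nonneg[of A] nonneg[of B] regular_sets_borel[of A] regular_sets_borel[of B]
        by (simp add: ennreal_plus)
    qed
    show "(\<lambda>i. ennreal (m (A i))) \<longlonglongrightarrow> 0"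
      if "range A \<subseteq> regular_sets" "decseq A" "\<Inter> (range A) = {}" for A
      using tendsto_ennrealI[OF continuous_at_empty[OF that]] by simp
  qed simp
  then obtain \<mu>0 where mu0: "\<And>s. s \<in> regular_sets \<Longrightarrow> \<mu>0 s = ennreal (m s)"
    "measure_space UNIV (sigma_sets UNIV regular_sets) \<mu>0" by blast
  have sb: "sigma_sets UNIV regular_sets = sets borel"
  proof
    show "sigma_sets UNIV regular_sets \<subseteq> sets borel"
      using regular_sets_borel sets.sigma_sets_subset[of regular_sets borel] by auto
    have "sets borel = sets (PiM UNIV (\<lambda>i::'i. borel::'b measure))"
      by (simp add: sets_PiM_equal_borel)
    also have "\<dots> = sigma_sets UNIV {{f. f i \<in> A} | i A. i \<in> UNIV \<and> A \<in> sets borel}"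
      by (simp add: sets_PiM_single PiE_UNIV_domain)
    also have "\<dots> \<subseteq> sigma_sets UNIV regular_sets"
      using coordinate_regular by (intro sigma_sets_mono) auto
    finally show "sets borel \<subseteq> sigma_sets UNIV regular_sets" .
  qed
  define \<mu> where "\<mu> = measure_of UNIV (sigma_sets UNIV regular_sets) \<mu>0"
  have sets: "sets \<mu> = sets borel" unfolding \<mu>_def sb using sets.sigma_sets_eq[of borel] by simp
  have em: "emeasure \<mu> A = ennreal (m A)" if "A \<in> regular_sets" for A
    unfolding \<mu>_def using mu0 that emeasure_measure_of_sigma[of UNIV "sigma_sets UNIV regular_sets" \<mu>0 A]
    by (auto simp: measure_space_def)
  have "prob_space \<mu>"
    using em[OF top] sets_eq_imp_space_eq[OF sets] by (intro prob_spaceI) (simp add: total)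
  moreover have "measure \<mu> A = m A" if "A \<in> regular_sets" for A
    using em[OF that] nonneg[OF regular_sets_borel[OF that]] by (simp add: measure_def)
  ultimately show thesis using sets that by blast
qed

end

section \<open>Laws of couplings on path space\<close>

text \<open>The index \<open>(n, True)\<close> stands for the first chain at time \<open>n\<close> and \<open>(n, False)\<close> for the second. Treating
  both chains as coordinates of one product lets every statement cover them by a variable of type
  \<^typ>\<open>bool\<close>.\<close>

type_synonym 'a path = "nat \<times> bool \<Rightarrow> 'a"

definition history :: "nat \<Rightarrow> 'a::topological_space path measure" where
  "history n = sigma UNIV {{\<omega>. \<omega> (k, b) \<in> S} | k b S. k \<le> n \<and> S \<in> sets borel}"

lemma space_history [simp]: "space (history n) = UNIV"
  unfolding history_def by (rule space_measure_of) auto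

lemma sets_history:
  "sets (history n) = sigma_sets UNIV {{\<omega>. \<omega> (k, b) \<in> S} | k b S. k \<le> n \<and> S \<in> sets borel}"
  unfolding history_def by (rule sets_measure_of) auto

lemma coordinate_history:
  "k \<le> n \<Longrightarrow> S \<in> sets borel \<Longrightarrow> {\<omega>. \<omega> (k, b) \<in> S} \<in> sets (history n)"
  unfolding sets_history by auto

lemma measurable_coordinate_history:
  "k \<le> n \<Longrightarrow> (\<lambda>\<omega>. \<omega> (k, b)) \<in> borel_measurable (history n)"
  using coordinate_history by (intro measurableI) (auto simp: vimage_def)

lemma history_borel: "A \<in> sets (history n) \<Longrightarrow> A \<in> sets borel"
proof -
  have "sigma_sets (space borel) {{\<omega>. \<omega> (k, b) \<in> S} | k b S. k \<le> n \<and> S \<in> sets borel} \<subseteq> sets borel"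
    by (rule sets.sigma_sets_subset) (auto intro: coordinate_sets)
  then show "A \<in> sets (history n) \<Longrightarrow> A \<in> sets borel" unfolding sets_history by auto
qed

lemma history_mono: "m \<le> n \<Longrightarrow> A \<in> sets (history m) \<Longrightarrow> A \<in> sets (history n)"
  unfolding sets_history by (erule sigma_sets_mono'[THEN subsetD, rotated]) force

lemma history_cong:
  assumes "A \<in> sets (history n)" "\<And>k b. k \<le> n \<Longrightarrow> \<omega> (k, b) = \<omega>' (k, b)"
  shows "\<omega> \<in> A \<longleftrightarrow> \<omega>' \<in> A"
  using assms(1) unfolding sets_history
proof (induction rule: sigma_sets.induct)
  case (Basic a)
  then show ?case using assms(2) by auto
qed auto

text \<open>The algebra generated by the one-coordinate events. These are the events whose probabilities are
  controlled when coupling laws converge as set functions.\<close>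

inductive_set cylinder_sets :: "'a::topological_space path set set" where
  coordinate: "S \<in> sets borel \<Longrightarrow> {\<omega>. \<omega> (k, b) \<in> S} \<in> cylinder_sets"
| complement: "A \<in> cylinder_sets \<Longrightarrow> - A \<in> cylinder_sets"
| union: "A \<in> cylinder_sets \<Longrightarrow> B \<in> cylinder_sets \<Longrightarrow> A \<union> B \<in> cylinder_sets"

lemma cylinder_sets_Int:
  "A \<in> cylinder_sets \<Longrightarrow> B \<in> cylinder_sets \<Longrightarrow> A \<inter> B \<in> cylinder_sets"
  using cylinder_sets.complement[OF cylinder_sets.union[OF cylinder_sets.complement cylinder_sets.complement], of A B]
  by (simp add: Compl_Un)

lemma cylinder_sets_borel: "A \<in> cylinder_sets \<Longrightarrow> A \<in> sets borel"
  by (induction rule: cylinder_sets.induct) (auto intro: coordinate_sets simp: borel_comp)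

text \<open>The law of a marginally Markovian coupling started at the pair \<open>z\<close>. The conditional laws are encoded
  by upper bounds on history events where \<open>P\<close> is bounded; lower bounds follow by applying them to the
  complement of \<open>S\<close>. In this form the condition compares just two values of \<open>\<mu>\<close> at a time and mentions no
  integral, so that it makes sense for finitely additive \<open>\<mu>\<close> and is closed under pointwise limits.\<close>

definition coupling_law ::
  "('a::polish_space \<Rightarrow> 'a measure) \<Rightarrow> (bool \<Rightarrow> 'a) \<Rightarrow> 'a path measure \<Rightarrow> bool" where
  "coupling_law P z \<mu> \<longleftrightarrow> prob_space \<mu> \<and> sets \<mu> = sets borel \<and>
     (\<forall>b. measure \<mu> {\<omega>. \<omega> (0, b) = z b} = 1) \<and>
     (\<forall>n b F S a. F \<in> sets (history n) \<longrightarrow> S \<in> sets borel \<longrightarrow>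
        (\<forall>\<omega>\<in>F. measure (P (\<omega> (n, b))) S \<le> a) \<longrightarrow>
        measure \<mu> (F \<inter> {\<omega>. \<omega> (Suc n, b) \<in> S}) \<le> a * measure \<mu> F)"

lemma coupling_lawD:
  assumes "coupling_law P z \<mu>"
  shows "prob_space \<mu>" "sets \<mu> = sets borel" "space \<mu> = UNIV" "measure \<mu> {\<omega>. \<omega> (0, b) = z b} = 1"
    "F \<in> sets (history n) \<Longrightarrow> S \<in> sets borel \<Longrightarrow> (\<And>\<omega>. \<omega> \<in> F \<Longrightarrow> measure (P (\<omega> (n, b))) S \<le> a) \<Longrightarrow>
      measure \<mu> (F \<inter> {\<omega>. \<omega> (Suc n, b) \<in> S}) \<le> a * measure \<mu> F"
  using assms sets_eq_imp_space_eq[of \<mu> borel] unfolding coupling_law_def by auto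

text \<open>Cutting the range of \<open>f\<close> into steps of height \<open>1/(N+1)\<close> turns the bounds on level sets into an upper
  sum of the integral. This is the way back from the inequalities that define \<open>coupling_law\<close> to
  integrals against \<open>P\<close>.\<close>

lemma content_le_integral:
  fixes f :: "'b \<Rightarrow> real" and \<alpha> :: "'b set \<Rightarrow> real"
  assumes fin: "finite_measure M" and f[measurable]: "f \<in> borel_measurable M"
    and f01: "\<And>x. x \<in> space M \<Longrightarrow> 0 \<le> f x" "\<And>x. x \<in> space M \<Longrightarrow> f x \<le> 1"
    and sub: "\<And>(I::nat set) T. finite I \<Longrightarrow> (\<And>i. i \<in> I \<Longrightarrow> T i \<in> sets M) \<Longrightarrow>
                \<alpha> (\<Union>i\<in>I. T i) \<le> (\<Sum>i\<in>I. \<alpha> (T i))"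
    and bound: "\<And>J a. J \<in> sets borel \<Longrightarrow> (\<And>y. y \<in> J \<Longrightarrow> y \<le> a) \<Longrightarrow>
                \<alpha> {x \<in> space M. f x \<in> J} \<le> a * measure M {x \<in> space M. f x \<in> J}"
  shows "\<alpha> (space M) \<le> (\<integral>x. f x \<partial>M)"
proof -
  interpret finite_measure M by fact
  have intf: "integrable M f"
  proof (rule integrable_const_bound[of _ 1])
    show "AE x in M. norm (f x) \<le> 1" by (rule AE_I2) (simp add: f01)
  qed (rule f)
  have le: "\<alpha> (space M) \<le> (\<integral>x. f x \<partial>M) + measure M (space M) / real (Suc N)" for N
  proof -
    define K where "K = real (Suc N)"
    have K: "K > 0" by (simp add: K_def)
    define J where "J j = {y::real. \<lfloor>K * y\<rfloor> = int j}" for j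
    have J: "J j \<in> sets borel" for j unfolding J_def by measurable
    define T where "T j = {x \<in> space M. f x \<in> J j}" for j
    have T[measurable]: "T j \<in> sets M" for j
      using measurable_sets[OF f J] unfolding T_def vimage_def by (simp add: Int_def conj_commute)
    have cell: "nat \<lfloor>K * f x\<rfloor> \<le> Suc N" "int (nat \<lfloor>K * f x\<rfloor>) = \<lfloor>K * f x\<rfloor>" if "x \<in> space M" for x
    proof -
      have "0 \<le> K * f x" "K * f x \<le> K" using f01[OF that] K by auto
      then have "0 \<le> \<lfloor>K * f x\<rfloor>" "\<lfloor>K * f x\<rfloor> \<le> \<lfloor>K\<rfloor>" by (auto intro: floor_mono)
      then show "nat \<lfloor>K * f x\<rfloor> \<le> Suc N" "int (nat \<lfloor>K * f x\<rfloor>) = \<lfloor>K * f x\<rfloor>"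
        unfolding K_def by (auto simp: nat_le_iff)
    qed
    have "x \<in> T (nat \<lfloor>K * f x\<rfloor>)" if "x \<in> space M" for x
      unfolding T_def J_def using that cell(2)[OF that] by (simp del: int_nat_eq)
    then have "space M \<subseteq> (\<Union>j\<in>{..Suc N}. T j)"
      using cell(1) by blast
    then have "space M = (\<Union>j\<in>{..Suc N}. T j)"
      unfolding T_def by blast
    then have "\<alpha> (space M) \<le> (\<Sum>j\<le>Suc N. \<alpha> (T j))"
      using sub[of "{..Suc N}" T] T by simp
    also have "\<dots> \<le> (\<Sum>j\<le>Suc N. (real j + 1) / K * measure M (T j))"
    proof (rule sum_mono)
      fix j
      show "\<alpha> (T j) \<le> (real j + 1) / K * measure M (T j)"
        unfolding T_def
      proof (rule bound[OF J])
        fix y assume "y \<in> J j"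
        then have "K * y < real j + 1" unfolding J_def by (auto simp: floor_eq_iff)
        then show "y \<le> (real j + 1) / K" using K by (simp add: field_simps)
      qed
    qed
    also have "\<dots> = (\<integral>x. (\<Sum>j\<le>Suc N. (real j + 1) / K * indicator (T j) x) \<partial>M)"
      by (simp add: emeasure_eq_measure)
    also have "\<dots> \<le> (\<integral>x. f x + 1 / K \<partial>M)"
    proof (rule integral_mono)
      fix x assume x: "x \<in> space M"
      have "(\<Sum>j\<le>Suc N. (real j + 1) / K * indicator (T j) x)
          = (\<Sum>j\<le>Suc N. if j = nat \<lfloor>K * f x\<rfloor> then (real j + 1) / K else 0)"
        using x cell[OF x] by (intro sum.cong) (auto simp: T_def J_def indicator_def)
      also have "\<dots> = (real (nat \<lfloor>K * f x\<rfloor>) + 1) / K" using cell[OF x] by simp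
      also have "real (nat \<lfloor>K * f x\<rfloor>) \<le> K * f x"
        using cell(2)[OF x] by linarith
      finally show "(\<Sum>j\<le>Suc N. (real j + 1) / K * indicator (T j) x) \<le> f x + 1 / K"
        using K by (simp add: field_simps)
    qed (use intf in \<open>auto simp: emeasure_eq_measure\<close>)
    also have "\<dots> = (\<integral>x. f x \<partial>M) + measure M (space M) / K"
      using intf by simp
    finally show ?thesis by (simp add: K_def)
  qed
  have "(\<lambda>N. measure M (space M) / real (Suc N)) \<longlonglongrightarrow> 0"
    using LIMSEQ_Suc[OF lim_const_over_n[of "measure M (space M)"]] by simp
  then have "(\<lambda>N. (\<integral>x. f x \<partial>M) + measure M (space M) / real (Suc N)) \<longlonglongrightarrow> (\<integral>x. f x \<partial>M) + 0"
    by (intro tendsto_add tendsto_const)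
  then show ?thesis using le by (intro LIMSEQ_le_const[of _ "\<integral>x. f x \<partial>M"]) auto
qed

lemma kernel_prob_space:
  assumes "P \<in> borel \<rightarrow>\<^sub>M prob_algebra borel"
  shows "prob_space (P x)" "sets (P x) = sets borel" "space (P x) = UNIV"
  using measurable_space[OF assms, of x] by (auto simp: space_prob_algebra dest: sets_eq_imp_space_eq)

lemma kernel_measurable:
  assumes "P \<in> borel \<rightarrow>\<^sub>M prob_algebra borel" "S \<in> sets borel"
  shows "(\<lambda>x. measure (P x) S) \<in> borel_measurable borel"
  using assms(1) measurable_measure_prob_algebra[OF assms(2)] by (rule measurable_compose)

lemma measurable_coordinate_kernel:
  fixes \<mu> :: "('i \<Rightarrow> 'a::polish_space) measure"
  assumes P: "P \<in> borel \<rightarrow>\<^sub>M prob_algebra borel" and S: "S \<in> sets borel" and \<mu>: "sets \<mu> = sets borel"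
  shows "(\<lambda>\<omega>. measure (P (\<omega> i)) S) \<in> borel_measurable \<mu>"
  unfolding measurable_cong_sets[OF \<mu> refl]
  by (rule measurable_compose[OF measurable_coordinate kernel_measurable[OF P S]])

lemma kernel_compl:
  assumes "P \<in> borel \<rightarrow>\<^sub>M prob_algebra borel" "S \<in> sets borel"
  shows "measure (P x) (- S) = 1 - measure (P x) S"
  using prob_space.prob_compl[OF kernel_prob_space(1)[OF assms(1)], of S x] assms
  by (simp add: kernel_prob_space[OF assms(1)] Compl_eq_Diff_UNIV)

lemma kernel_power_prob_space:
  assumes P: "P \<in> borel \<rightarrow>\<^sub>M prob_algebra borel"
  shows "prob_space (kernel_power P n x) \<and> sets (kernel_power P n x) = sets borel"
proof (induction n)
  case 0
  then show ?case by (simp add: prob_space_return)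
next
  case (Suc n)
  interpret prob_space "kernel_power P n x" using Suc by simp
  have P': "P \<in> kernel_power P n x \<rightarrow>\<^sub>M subprob_algebra borel"
    using Suc measurable_prob_algebraD[OF P] by (simp cong: measurable_cong_sets)
  have "prob_space (kernel_power P n x \<bind> P)"
    by (rule prob_space_bind[OF _ P']) (simp add: kernel_prob_space[OF P])
  moreover have "sets (kernel_power P n x \<bind> P) = sets borel"
    by (rule sets_bind) (auto simp: kernel_prob_space[OF P] not_empty)
  ultimately show ?case by simp
qed

lemma kernel_power_Suc_measure:
  assumes P: "P \<in> borel \<rightarrow>\<^sub>M prob_algebra borel" and S: "S \<in> sets borel"
  shows "measure (kernel_power P (Suc n) x) S = (\<integral>y. measure (P y) S \<partial>kernel_power P n x)"
proof -
  interpret prob_space "kernel_power P n x" using kernel_power_prob_space[OF P] by simp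
  have "P \<in> kernel_power P n x \<rightarrow>\<^sub>M subprob_algebra borel"
    using kernel_power_prob_space[OF P] measurable_prob_algebraD[OF P] by (simp cong: measurable_cong_sets)
  from measure_bind[OF this S] show ?thesis by simp
qed

lemma conditional_step_le:
  fixes \<mu> :: "'a::polish_space path measure"
  assumes P: "P \<in> borel \<rightarrow>\<^sub>M prob_algebra borel"
    and \<mu>: "prob_space \<mu>" "sets \<mu> = sets borel" and F: "F \<in> sets borel" and S: "S \<in> sets borel"
    and step: "\<And>T a. T \<in> sets borel \<Longrightarrow> (\<And>x. x \<in> T \<Longrightarrow> measure (P x) S \<le> a) \<Longrightarrow>
      measure \<mu> (F \<inter> {\<omega>. \<omega> (n, b) \<in> T} \<inter> {\<omega>. \<omega> (Suc n, b) \<in> S}) \<le> a * measure \<mu> (F \<inter> {\<omega>. \<omega> (n, b) \<in> T})"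
  shows "measure \<mu> (F \<inter> {\<omega>. \<omega> (Suc n, b) \<in> S}) \<le> (\<integral>\<omega>\<in>F. measure (P (\<omega> (n, b))) S \<partial>\<mu>)"
proof -
  interpret prob_space \<mu> by fact
  have sp: "space \<mu> = UNIV" using sets_eq_imp_space_eq[OF \<mu>(2)] by simp
  have F': "F \<in> sets \<mu>" using F \<mu> by simp
  have S': "{\<omega>. \<omega> (Suc n, b) \<in> S} \<in> sets \<mu>"
    unfolding \<mu>(2) by (rule coordinate_sets[OF S])
  let ?M = "restrict_space \<mu> F"
  have spM: "space ?M = F" by (simp add: space_restrict_space sp)
  have meas: "measure ?M T = measure \<mu> T" if "T \<subseteq> F" for T
    by (rule measure_restrict_space) (use F' that sp in auto)
  have setsM: "T \<in> sets \<mu>" if "T \<in> sets ?M" for T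
    using that F' by (auto simp: sets_restrict_space)
  have "measure \<mu> (space ?M \<inter> {\<omega>. \<omega> (Suc n, b) \<in> S}) \<le> (\<integral>\<omega>. measure (P (\<omega> (n, b))) S \<partial>?M)"
  proof (rule content_le_integral[where \<alpha> = "\<lambda>T. measure \<mu> (T \<inter> {\<omega>. \<omega> (Suc n, b) \<in> S})"])
    show "finite_measure ?M" by (rule finite_measure_restrict_space) (auto intro: F' finite_measure_axioms)
    show "(\<lambda>\<omega>. measure (P (\<omega> (n, b))) S) \<in> borel_measurable ?M"
      by (rule measurable_restrict_space1[OF measurable_coordinate_kernel[OF P S \<mu>(2)]])
    show "measure (P (\<omega> (n, b))) S \<le> 1" for \<omega> :: "'a path"
      using prob_space.prob_le_1[OF kernel_prob_space(1)[OF P]] .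
  next
    fix I :: "nat set" and T assume I: "finite I" "\<And>i. i \<in> I \<Longrightarrow> T i \<in> sets ?M"
    have eq: "(\<Union>i\<in>I. T i) \<inter> {\<omega>. \<omega> (Suc n, b) \<in> S} = (\<Union>i\<in>I. T i \<inter> {\<omega>. \<omega> (Suc n, b) \<in> S})" by blast
    show "measure \<mu> ((\<Union>i\<in>I. T i) \<inter> {\<omega>. \<omega> (Suc n, b) \<in> S})
        \<le> (\<Sum>i\<in>I. measure \<mu> (T i \<inter> {\<omega>. \<omega> (Suc n, b) \<in> S}))"
      unfolding eq using I(1)
    proof (rule measure_UNION_le)
      show "T i \<inter> {\<omega>. \<omega> (Suc n, b) \<in> S} \<in> sets \<mu>" if "i \<in> I" for i
        using setsM[OF I(2)[OF that]] S' by (rule sets.Int)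
    qed
  next
    fix J :: "real set" and a assume J: "J \<in> sets borel" and a: "\<And>y. y \<in> J \<Longrightarrow> y \<le> a"
    let ?T = "{x. measure (P x) S \<in> J}"
    have T: "?T \<in> sets borel"
      using measurable_sets[OF kernel_measurable[OF P S] J] by (simp add: vimage_def)
    have eq: "{\<omega> \<in> space ?M. measure (P (\<omega> (n, b))) S \<in> J} = F \<inter> {\<omega>. \<omega> (n, b) \<in> ?T}"
      unfolding spM by blast
    have "measure \<mu> (F \<inter> {\<omega>. \<omega> (n, b) \<in> ?T} \<inter> {\<omega>. \<omega> (Suc n, b) \<in> S})
        \<le> a * measure \<mu> (F \<inter> {\<omega>. \<omega> (n, b) \<in> ?T})"
      using T a by (intro step) auto
    then show "measure \<mu> ({\<omega> \<in> space ?M. measure (P (\<omega> (n, b))) S \<in> J} \<inter> {\<omega>. \<omega> (Suc n, b) \<in> S})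
        \<le> a * measure ?M {\<omega> \<in> space ?M. measure (P (\<omega> (n, b))) S \<in> J}"
      unfolding eq by (subst meas) auto
  qed simp
  also have "(\<integral>\<omega>. measure (P (\<omega> (n, b))) S \<partial>?M) = (\<integral>\<omega>\<in>F. measure (P (\<omega> (n, b))) S \<partial>\<mu>)"
    unfolding set_lebesgue_integral_def using F' sp by (intro integral_restrict_space) auto
  finally show ?thesis unfolding spM .
qed

text \<open>The inequalities of \<open>conditional_step_le\<close> for \<open>S\<close> and for its complement add up to an equality of total masses, so neither can
  be strict.\<close>

lemma conditional_step_eq:
  fixes \<mu> :: "'a::polish_space path measure"
  assumes P: "P \<in> borel \<rightarrow>\<^sub>M prob_algebra borel"
    and \<mu>: "prob_space \<mu>" "sets \<mu> = sets borel" and F: "F \<in> sets borel" and S: "S \<in> sets borel"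
    and step: "\<And>S T a. S \<in> sets borel \<Longrightarrow> T \<in> sets borel \<Longrightarrow> (\<And>x. x \<in> T \<Longrightarrow> measure (P x) S \<le> a) \<Longrightarrow>
      measure \<mu> (F \<inter> {\<omega>. \<omega> (n, b) \<in> T} \<inter> {\<omega>. \<omega> (Suc n, b) \<in> S}) \<le> a * measure \<mu> (F \<inter> {\<omega>. \<omega> (n, b) \<in> T})"
  shows "measure \<mu> (F \<inter> {\<omega>. \<omega> (Suc n, b) \<in> S}) = (\<integral>\<omega>\<in>F. measure (P (\<omega> (n, b))) S \<partial>\<mu>)"
proof (rule antisym)
  interpret prob_space \<mu> by fact
  have F': "F \<in> sets \<mu>" using F \<mu> by simp
  have S': "{\<omega>. \<omega> (Suc n, b) \<in> S} \<in> sets \<mu>" unfolding \<mu>(2) by (rule coordinate_sets[OF S])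
  have cS: "- S \<in> sets borel" using S by (rule borel_comp)
  have meas: "(\<lambda>\<omega>. measure (P (\<omega> (n, b))) S) \<in> borel_measurable \<mu>"
    by (rule measurable_coordinate_kernel[OF P S \<mu>(2)])
  have int: "integrable \<mu> (\<lambda>\<omega>. measure (P (\<omega> (n, b))) S)"
    by (rule integrable_const_bound[of _ 1, OF _ meas])
       (simp add: prob_space.prob_le_1[OF kernel_prob_space(1)[OF P]])
  have intF: "set_integrable \<mu> F (\<lambda>\<omega>. measure (P (\<omega> (n, b))) S)" "set_integrable \<mu> F (\<lambda>\<omega>. 1::real)"
    unfolding set_integrable_def
    by (rule integrable_mult_indicator[OF F' int]) (rule integrable_mult_indicator[OF F'], simp)
  show "measure \<mu> (F \<inter> {\<omega>. \<omega> (Suc n, b) \<in> S}) \<le> (\<integral>\<omega>\<in>F. measure (P (\<omega> (n, b))) S \<partial>\<mu>)"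
    by (rule conditional_step_le[OF P \<mu> F S]) (rule step[OF S])
  have "measure \<mu> (F \<inter> {\<omega>. \<omega> (Suc n, b) \<in> - S}) \<le> (\<integral>\<omega>\<in>F. measure (P (\<omega> (n, b))) (- S) \<partial>\<mu>)"
    by (rule conditional_step_le[OF P \<mu> F cS]) (rule step[OF cS])
  also have "\<dots> = (\<integral>\<omega>\<in>F. 1 - measure (P (\<omega> (n, b))) S \<partial>\<mu>)"
    by (simp only: kernel_compl[OF P S])
  also have "\<dots> = measure \<mu> F - (\<integral>\<omega>\<in>F. measure (P (\<omega> (n, b))) S \<partial>\<mu>)"
    using intF F' by (simp add: set_integral_diff set_lebesgue_integral_def[of \<mu> F "\<lambda>_. 1"])
  also have "F \<inter> {\<omega>. \<omega> (Suc n, b) \<in> - S} = F - (F \<inter> {\<omega>. \<omega> (Suc n, b) \<in> S})" by blast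
  also have "measure \<mu> \<dots> = measure \<mu> F - measure \<mu> (F \<inter> {\<omega>. \<omega> (Suc n, b) \<in> S})"
    using F' S' by (intro finite_measure_Diff) auto
  finally show "(\<integral>\<omega>\<in>F. measure (P (\<omega> (n, b))) S \<partial>\<mu>) \<le> measure \<mu> (F \<inter> {\<omega>. \<omega> (Suc n, b) \<in> S})"
    by simp
qed

lemma coupling_law_step_eq:
  assumes P: "P \<in> borel \<rightarrow>\<^sub>M prob_algebra borel" and c: "coupling_law P z \<mu>"
    and F: "F \<in> sets (history n)" and S: "S \<in> sets borel"
  shows "measure \<mu> (F \<inter> {\<omega>. \<omega> (Suc n, b) \<in> S}) = (\<integral>\<omega>\<in>F. measure (P (\<omega> (n, b))) S \<partial>\<mu>)"
proof (rule conditional_step_eq[OF P _ _ history_borel[OF F] S])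
  fix S T a assume "S \<in> sets borel" and T: "T \<in> sets (borel :: 'a measure)" and "\<And>x. x \<in> T \<Longrightarrow> measure (P x) S \<le> a"
  moreover have "F \<inter> {\<omega>. \<omega> (n, b) \<in> T} \<in> sets (history n)"
    using F coordinate_history[OF order_refl T] by auto
  ultimately show "measure \<mu> (F \<inter> {\<omega>. \<omega> (n, b) \<in> T} \<inter> {\<omega>. \<omega> (Suc n, b) \<in> S}) \<le> a * measure \<mu> (F \<inter> {\<omega>. \<omega> (n, b) \<in> T})"
    using c unfolding coupling_law_def by auto
qed (use c in \<open>auto simp: coupling_law_def\<close>)

text \<open>Converse to \<open>coupling_law_step_eq\<close>: the integral form of the Markov property implies the bounds.\<close>

lemma coupling_lawI:
  fixes \<mu> :: "'a::polish_space path measure"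
  assumes P: "P \<in> borel \<rightarrow>\<^sub>M prob_algebra borel"
    and \<mu>: "prob_space \<mu>" "sets \<mu> = sets borel" and start: "\<And>b. measure \<mu> {\<omega>. \<omega> (0, b) = z b} = 1"
    and eq: "\<And>n b F S. F \<in> sets (history n) \<Longrightarrow> S \<in> sets borel \<Longrightarrow>
      measure \<mu> (F \<inter> {\<omega>. \<omega> (Suc n, b) \<in> S}) = (\<integral>\<omega>\<in>F. measure (P (\<omega> (n, b))) S \<partial>\<mu>)"
  shows "coupling_law P z \<mu>"
  unfolding coupling_law_def
proof (intro conjI allI impI \<mu> start)
  interpret prob_space \<mu> by fact
  fix n b F S a
  assume F: "F \<in> sets (history n)" and S: "S \<in> sets borel" and a: "\<forall>\<omega>\<in>F. measure (P (\<omega> (n, b))) S \<le> a"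
  have F': "F \<in> sets \<mu>" using history_borel[OF F] \<mu> by simp
  have meas: "(\<lambda>\<omega>. measure (P (\<omega> (n, b))) S) \<in> borel_measurable \<mu>"
    by (rule measurable_coordinate_kernel[OF P S \<mu>(2)])
  have int: "integrable \<mu> (\<lambda>\<omega>. measure (P (\<omega> (n, b))) S)"
    by (rule integrable_const_bound[of _ 1, OF _ meas])
       (simp add: prob_space.prob_le_1[OF kernel_prob_space(1)[OF P]])
  have "(\<integral>\<omega>\<in>F. measure (P (\<omega> (n, b))) S \<partial>\<mu>) \<le> (\<integral>\<omega>\<in>F. a \<partial>\<mu>)"
  proof (rule set_integral_mono)
    show "set_integrable \<mu> F (\<lambda>\<omega>. measure (P (\<omega> (n, b))) S)"
      unfolding set_integrable_def by (rule integrable_mult_indicator[OF F' int])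
    show "set_integrable \<mu> F (\<lambda>\<omega>. a)"
      unfolding set_integrable_def by (rule integrable_mult_indicator[OF F']) simp
  qed (use a in blast)
  also have "\<dots> = a * measure \<mu> F"
    using F' by (simp add: set_lebesgue_integral_def)
  finally show "measure \<mu> (F \<inter> {\<omega>. \<omega> (Suc n, b) \<in> S}) \<le> a * measure \<mu> F"
    using eq[OF F S] by simp
qed

text \<open>A monotone class argument. It is carried out on the integral form because the side condition of the
  bounds, that \<open>P\<close> be at most \<open>a\<close> on \<open>F\<close>, is not stable under complements of \<open>F\<close>.\<close>

lemma step_eq_extend:
  fixes \<mu> :: "'a::polish_space path measure"
  assumes P: "P \<in> borel \<rightarrow>\<^sub>M prob_algebra borel"
    and \<mu>: "prob_space \<mu>" "sets \<mu> = sets borel" and S: "S \<in> sets borel"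
    and eq: "\<And>F. F \<in> sets (history n) \<Longrightarrow> F \<in> cylinder_sets \<Longrightarrow>
      measure \<mu> (F \<inter> {\<omega>. \<omega> (Suc n, b) \<in> S}) = (\<integral>\<omega>\<in>F. measure (P (\<omega> (n, b))) S \<partial>\<mu>)"
    and F: "F \<in> sets (history n)"
  shows "measure \<mu> (F \<inter> {\<omega>. \<omega> (Suc n, b) \<in> S}) = (\<integral>\<omega>\<in>F. measure (P (\<omega> (n, b))) S \<partial>\<mu>)"
proof -
  interpret prob_space \<mu> by fact
  have sp: "space \<mu> = UNIV" using sets_eq_imp_space_eq[OF \<mu>(2)] by simp
  let ?S = "{\<omega>. \<omega> (Suc n, b) \<in> S}" and ?f = "\<lambda>\<omega>. measure (P (\<omega> (n, b))) S"
  let ?G = "{F \<in> cylinder_sets. F \<in> sets (history n)}"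
  have S': "?S \<in> sets \<mu>" unfolding \<mu>(2) by (rule coordinate_sets[OF S])
  have meas: "?f \<in> borel_measurable \<mu>"
    by (rule measurable_coordinate_kernel[OF P S \<mu>(2)])
  have int: "integrable \<mu> ?f"
    by (rule integrable_const_bound[of _ 1, OF _ meas])
       (simp add: prob_space.prob_le_1[OF kernel_prob_space(1)[OF P]])
  have sint: "set_integrable \<mu> A ?f" if "A \<in> sets \<mu>" for A
    unfolding set_integrable_def using int that by (intro integrable_mult_indicator) auto
  have gen: "sigma_sets UNIV ?G = sets (history n)"
  proof
    show "sigma_sets UNIV ?G \<subseteq> sets (history n)"
      using sets.sigma_sets_subset[of ?G "history n"] by auto
    have "{{\<omega>. \<omega> (k, b) \<in> S} | k b S. k \<le> n \<and> S \<in> sets borel} \<subseteq> ?G"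
      using cylinder_sets.coordinate coordinate_history by blast
    then show "sets (history n) \<subseteq> sigma_sets UNIV ?G"
      unfolding sets_history[of n] by (rule sigma_sets_mono')
  qed
  have hm: "A \<in> sets \<mu>" if "A \<in> sigma_sets UNIV ?G" for A
    using history_borel that unfolding gen \<mu> .
  have U: "UNIV \<in> ?G"
    using cylinder_sets.coordinate[of UNIV 0 True] sets.top[of "history n"] by simp
  have "Int_stable ?G" by (auto simp: Int_stable_def intro: cylinder_sets_Int)
  moreover have "?G \<subseteq> Pow UNIV" by simp
  moreover have "F \<in> sigma_sets UNIV ?G" unfolding gen by (rule F)
  ultimately show ?thesis
  proof (induction rule: sigma_sets_induct_disjoint)
    case (basic A)
    then show ?case using eq by simp
  next
    case empty
    show ?case by (simp add: set_lebesgue_integral_def)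
  next
    case (compl A)
    have A: "A \<in> sets \<mu>" using compl hm by simp
    have "(UNIV - A) \<inter> ?S = (UNIV \<inter> ?S) - (A \<inter> ?S)" by blast
    also have "measure \<mu> \<dots> = measure \<mu> (UNIV \<inter> ?S) - measure \<mu> (A \<inter> ?S)"
      using A S' by (intro finite_measure_Diff) auto
    also have "measure \<mu> (UNIV \<inter> ?S) = (\<integral>\<omega>\<in>UNIV. ?f \<omega> \<partial>\<mu>)" using U by (intro eq) auto
    also have "(UNIV :: 'a path set) = A \<union> (UNIV - A)" by blast
    also have "(\<integral>\<omega>\<in>A \<union> (UNIV - A). ?f \<omega> \<partial>\<mu>) = (\<integral>\<omega>\<in>A. ?f \<omega> \<partial>\<mu>) + (\<integral>\<omega>\<in>UNIV - A. ?f \<omega> \<partial>\<mu>)"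
      using A sets.compl_sets[OF A] sp by (intro set_integral_Un sint) auto
    finally show ?case using compl by simp
  next
    case (union A)
    have A: "A i \<in> sets \<mu>" for i using union hm by blast
    have "(\<lambda>i. measure \<mu> (A i \<inter> ?S)) sums measure \<mu> (\<Union>i. A i \<inter> ?S)"
      using A S' union(1) by (intro finite_measure_UNION) (auto simp: disjoint_family_on_def)
    moreover have "(\<integral>\<omega>\<in>(\<Union>i. A i). ?f \<omega> \<partial>\<mu>) = (\<Sum>i. (\<integral>\<omega>\<in>A i. ?f \<omega> \<partial>\<mu>))"
      using A union(1) by (intro lebesgue_integral_countable_add sint) (auto simp: disjoint_family_on_def)
    ultimately show ?case using union(3) by (simp add: sums_iff)
  qed
qed

text \<open>Chapman-Kolmogorov for each chain separately: the Markov property relative to the joint history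
  implies the one relative to the chain's own history.\<close>

lemma coupling_law_marginal:
  assumes P: "P \<in> borel \<rightarrow>\<^sub>M prob_algebra borel" and \<mu>: "coupling_law P z \<mu>" and S: "S \<in> sets borel"
  shows "measure \<mu> {\<omega>. \<omega> (n, b) \<in> S} = measure (kernel_power P n (z b)) S"
  using S
proof (induction n arbitrary: S)
  case 0
  interpret prob_space \<mu> by (rule coupling_lawD[OF \<mu>])
  have "AE \<omega> in \<mu>. \<omega> \<in> {\<omega>. \<omega> (0, b) = z b}" by (rule AE_prob_1) (rule coupling_lawD[OF \<mu>])
  then have ae: "AE \<omega> in \<mu>. \<omega> \<in> {\<omega>. \<omega> (0, b) \<in> S} \<longleftrightarrow> \<omega> \<in> (if z b \<in> S then space \<mu> else {})"
    by (rule AE_mp[OF _ AE_I2]) auto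
  have "measure \<mu> {\<omega>. \<omega> (0, b) \<in> S} = measure \<mu> (if z b \<in> S then space \<mu> else {})"
    using coordinate_sets[OF 0] by (intro finite_measure_eq_AE[OF ae]) (auto simp: coupling_lawD[OF \<mu>])
  then show ?case using 0 by (simp add: measure_def emeasure_return indicator_def prob_space[unfolded measure_def])
next
  case (Suc n)
  interpret prob_space \<mu> by (rule coupling_lawD[OF \<mu>])
  have coord: "(\<lambda>\<omega>. \<omega> (n, b)) \<in> borel_measurable \<mu>"
    unfolding measurable_cong_sets[OF coupling_lawD(2)[OF \<mu>] refl] by (rule measurable_coordinate)
  have distr: "distr \<mu> borel (\<lambda>\<omega>. \<omega> (n, b)) = kernel_power P n (z b)"
  proof (rule measure_eqI)
    fix S assume "S \<in> sets (distr \<mu> borel (\<lambda>\<omega>. \<omega> (n, b)))"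
    then have S: "S \<in> sets borel" by simp
    interpret K: prob_space "kernel_power P n (z b)" using kernel_power_prob_space[OF P] by simp
    have "measure \<mu> {\<omega>. \<omega> (n, b) \<in> S} = measure (kernel_power P n (z b)) S" by (rule Suc.IH[OF S])
    then show "emeasure (distr \<mu> borel (\<lambda>\<omega>. \<omega> (n, b))) S = emeasure (kernel_power P n (z b)) S"
      using emeasure_distr[OF coord S]
      by (simp add: emeasure_eq_measure K.emeasure_eq_measure vimage_def coupling_lawD(3)[OF \<mu>])
  qed (use kernel_power_prob_space[OF P] in simp)
  have "measure \<mu> (UNIV \<inter> {\<omega>. \<omega> (Suc n, b) \<in> S}) = (\<integral>\<omega>\<in>UNIV. measure (P (\<omega> (n, b))) S \<partial>\<mu>)"
    using sets.top[of "history n :: 'a path measure"]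
    by (intro coupling_law_step_eq[OF P \<mu> _ Suc.prems]) simp
  also have "\<dots> = (\<integral>x. measure (P x) S \<partial>distr \<mu> borel (\<lambda>\<omega>. \<omega> (n, b)))"
    by (simp add: set_lebesgue_integral_def integral_distr[OF coord kernel_measurable[OF P Suc.prems]])
  finally show ?case by (simp only: distr kernel_power_Suc_measure[OF P Suc.prems] Int_UNIV_left)
qed

section \<open>Translation between couplings and their laws\<close>

definition pair_path :: "(nat \<Rightarrow> 'w \<Rightarrow> 'a) \<Rightarrow> (nat \<Rightarrow> 'w \<Rightarrow> 'a) \<Rightarrow> 'w \<Rightarrow> 'a path" where
  "pair_path X Y \<omega> = (\<lambda>(k, b). if b then X k \<omega> else Y k \<omega>)"

lemma measurable_pair_path:
  fixes X Y :: "nat \<Rightarrow> 'w \<Rightarrow> 'a::polish_space"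
  assumes "\<And>k. X k \<in> borel_measurable \<Omega>" "\<And>k. Y k \<in> borel_measurable \<Omega>"
  shows "pair_path X Y \<in> borel_measurable \<Omega>"
proof (rule measurable_coordinatewise_then_product)
  show "(\<lambda>\<omega>. pair_path X Y \<omega> i) \<in> borel_measurable \<Omega>" for i
    using assms by (cases i; cases "snd i") (simp_all add: pair_path_def)
qed

lemma coupling_law_pair_path:
  fixes P :: "'a::polish_space \<Rightarrow> 'a measure"
  assumes P: "P \<in> borel \<rightarrow>\<^sub>M prob_algebra borel"
    and c: "marginally_markovian_coupling P x y \<Omega> X Y"
  shows "coupling_law P (\<lambda>b. if b then x else y) (distr \<Omega> borel (pair_path X Y))"
proof -
  interpret prob_space \<Omega> using c by (simp add: marginally_markovian_coupling_def)
  have X: "X n \<in> borel_measurable \<Omega>" and Y: "Y n \<in> borel_measurable \<Omega>" for n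
    using c by (auto simp: marginally_markovian_coupling_def)
  have X0: "X 0 \<omega> = x" and Y0: "Y 0 \<omega> = y" if "\<omega> \<in> space \<Omega>" for \<omega>
    using c that by (auto simp: marginally_markovian_coupling_def)
  define V where "V k b = (if b then X k else Y k)" for k b
  have V: "V k b \<in> borel_measurable \<Omega>" for k b by (simp add: V_def X Y)
  have cond: "AE \<omega> in \<Omega>. real_cond_exp \<Omega> (pair_history \<Omega> X Y n)
      (indicator (V (Suc n) b -` S \<inter> space \<Omega>)) \<omega> = measure (P (V n b \<omega>)) S" if "S \<in> sets borel" for n b S
    using c that by (simp add: marginally_markovian_coupling_def V_def)
  let ?Z = "pair_path X Y"
  have ZV: "?Z \<omega> (k, b) = V k b \<omega>" for \<omega> k b by (simp add: pair_path_def V_def)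
  have Z: "?Z \<in> borel_measurable \<Omega>" by (rule measurable_pair_path[OF X Y])
  have hist: "?Z -` F \<inter> space \<Omega> \<in> sets (pair_history \<Omega> X Y n)" if F: "F \<in> sets (history n)" for F n
  proof -
    have "?Z \<in> pair_history \<Omega> X Y n \<rightarrow>\<^sub>M history n"
    proof (rule measurable_sigma_sets[OF sets_history])
      fix A assume "A \<in> {{\<omega>::'a path. \<omega> (k, b) \<in> S} | k b S. k \<le> n \<and> S \<in> sets borel}"
      then obtain k b S where A: "A = {\<omega>. \<omega> (k, b) \<in> S}" "k \<le> n" "S \<in> sets borel" by blast
      have "(\<lambda>\<omega>. (X k \<omega>, Y k \<omega>)) \<in> pair_history \<Omega> X Y n \<rightarrow>\<^sub>M borel \<Otimes>\<^sub>M borel"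
        using measurable_pair_history[OF A(2), of X Y \<Omega>] unfolding borel_prod .
      from measurable_compose[OF this measurable_fst] measurable_compose[OF this measurable_snd]
      have "V k b \<in> pair_history \<Omega> X Y n \<rightarrow>\<^sub>M borel" by (simp add: V_def)
      from measurable_sets[OF this A(3)]
      show "?Z -` A \<inter> space (pair_history \<Omega> X Y n) \<in> sets (pair_history \<Omega> X Y n)"
        unfolding A by (simp add: vimage_def ZV)
    qed auto
    from measurable_sets[OF this F] show ?thesis by simp
  qed
  have sub: "subalgebra \<Omega> (pair_history \<Omega> X Y n)" for n by (rule subalgebra_pair_history[OF X Y])
  show ?thesis
  proof (rule coupling_lawI[OF P])
    show "prob_space (distr \<Omega> borel ?Z)" by (rule prob_space_distr[OF Z])
    show "sets (distr \<Omega> borel ?Z) = sets borel" by simp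
  next
    fix b
    let ?z = "if b then x else y"
    have "{\<omega>. \<omega> (0, b) \<in> {?z}} \<in> sets (borel :: 'a path measure)" by (rule coordinate_sets) simp
    then have "measure (distr \<Omega> borel ?Z) {\<omega>. \<omega> (0, b) = ?z} = measure \<Omega> (?Z -` {\<omega>. \<omega> (0, b) = ?z} \<inter> space \<Omega>)"
      using measure_distr[OF Z] by simp
    also have "?Z -` {\<omega>. \<omega> (0, b) = ?z} \<inter> space \<Omega> = space \<Omega>"
      using X0 Y0 by (auto simp: ZV V_def)
    finally show "measure (distr \<Omega> borel ?Z) {\<omega>. \<omega> (0, b) = ?z} = 1" by (simp add: prob_space)
  next
    fix n b and F :: "'a path set" and S :: "'a set"
    assume F: "F \<in> sets (history n)" and S: "S \<in> sets borel"
    interpret finite_measure_subalgebra \<Omega> "pair_history \<Omega> X Y n" by unfold_locales (rule sub)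
    let ?B = "?Z -` F \<inter> space \<Omega>" and ?W = "V (Suc n) b -` S \<inter> space \<Omega>"
    have B: "?B \<in> sets \<Omega>" using measurable_sets[OF Z history_borel[OF F]] .
    have W: "?W \<in> sets \<Omega>" using measurable_sets[OF V S] .
    have S': "{\<omega> :: 'a path. \<omega> (Suc n, b) \<in> S} \<in> sets borel" by (rule coordinate_sets[OF S])
    have meas: "(\<lambda>\<omega>. measure (P (V n b \<omega>)) S) \<in> borel_measurable \<Omega>"
      by (rule measurable_compose[OF V kernel_measurable[OF P S]])
    have measW: "(\<lambda>\<omega>::'a path. measure (P (\<omega> (n, b))) S) \<in> borel_measurable borel"
      by (rule measurable_coordinate_kernel[OF P S refl])
    have "?Z -` (F \<inter> {\<omega>. \<omega> (Suc n, b) \<in> S}) \<inter> space \<Omega> = ?B \<inter> ?W"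
      by (auto simp: ZV)
    then have "measure (distr \<Omega> borel ?Z) (F \<inter> {\<omega>. \<omega> (Suc n, b) \<in> S}) = measure \<Omega> (?B \<inter> ?W)"
      by (simp only: measure_distr[OF Z sets.Int[OF history_borel[OF F] S']])
    also have "\<dots> = (\<integral>\<omega>\<in>?B. indicator ?W \<omega> \<partial>\<Omega>)"
      unfolding set_lebesgue_integral_def using B W by (simp add: indicator_inter_arith[symmetric] Int_assoc)
    also have "\<dots> = (\<integral>\<omega>\<in>?B. real_cond_exp \<Omega> (pair_history \<Omega> X Y n) (indicator ?W) \<omega> \<partial>\<Omega>)"
      using W by (intro real_cond_exp_intA hist[OF F]) (auto simp: emeasure_eq_measure)
    also have "\<dots> = (\<integral>\<omega>\<in>?B. measure (P (V n b \<omega>)) S \<partial>\<Omega>)"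
      unfolding set_lebesgue_integral_def
    proof (rule integral_cong_AE)
      show "AE \<omega> in \<Omega>. indicat_real ?B \<omega> *\<^sub>R real_cond_exp \<Omega> (pair_history \<Omega> X Y n) (indicator ?W) \<omega> =
          indicat_real ?B \<omega> *\<^sub>R measure (P (V n b \<omega>)) S"
        using cond[OF S, of n b] by eventually_elim simp
    qed (use B meas in simp_all)
    also have "\<dots> = (\<integral>\<omega>. indicator F (?Z \<omega>) *\<^sub>R measure (P (?Z \<omega> (n, b))) S \<partial>\<Omega>)"
      unfolding set_lebesgue_integral_def ZV
      by (intro Bochner_Integration.integral_cong refl) (auto simp: indicator_def)
    also have "\<dots> = (\<integral>\<omega>\<in>F. measure (P (\<omega> (n, b))) S \<partial>distr \<Omega> borel ?Z)"
      unfolding set_lebesgue_integral_def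
      using history_borel[OF F] measW by (intro integral_distr[symmetric] Z borel_measurable_scaleR) auto
    finally show "measure (distr \<Omega> borel ?Z) (F \<inter> {\<omega>. \<omega> (Suc n, b) \<in> S})
        = (\<integral>\<omega>\<in>F. measure (P (\<omega> (n, b))) S \<partial>distr \<Omega> borel ?Z)" .
  qed
qed

lemma achievable_imp_coupling_law:
  assumes P: "P \<in> borel \<rightarrow>\<^sub>M prob_algebra borel" and H: "achievable P (C \<times> C)" and C: "C \<in> sets borel"
  obtains \<mu> where "coupling_law P z \<mu>" "AE \<omega> in \<mu>. \<exists>n. \<omega> (n, True) \<in> C \<and> \<omega> (n, False) \<in> C"
proof -
  obtain \<Omega> :: "(nat \<Rightarrow> 'a \<times> 'a) measure" and X Y where
    c: "marginally_markovian_coupling P (z True) (z False) \<Omega> X Y"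
    and t: "AE \<omega> in \<Omega>. hitting_time (C \<times> C) X Y \<omega> < \<infinity>"
    using H unfolding achievable_def by blast
  have XY: "X n \<in> borel_measurable \<Omega>" "Y n \<in> borel_measurable \<Omega>" for n
    using c by (auto simp: marginally_markovian_coupling_def)
  have "{\<omega>. \<omega> (n, True) \<in> C} \<inter> {\<omega>. \<omega> (n, False) \<in> C} \<in> sets (borel :: 'a path measure)" for n
    by (intro sets.Int coordinate_sets C)
  then have "(\<Union>n. {\<omega>. \<omega> (n, True) \<in> C} \<inter> {\<omega>. \<omega> (n, False) \<in> C}) \<in> sets (borel :: 'a path measure)"
    by (rule sets.countable_UN[OF image_subsetI])
  moreover have "(\<Union>n. {\<omega>::'a path. \<omega> (n, True) \<in> C} \<inter> {\<omega>. \<omega> (n, False) \<in> C})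
      = {\<omega> \<in> space borel. \<exists>n. \<omega> (n, True) \<in> C \<and> \<omega> (n, False) \<in> C}" by auto
  ultimately have "{\<omega> \<in> space borel. \<exists>n. \<omega> (n, True) \<in> C \<and> \<omega> (n, False) \<in> C} \<in> sets (borel :: 'a path measure)"
    by simp
  then have "AE \<omega> in distr \<Omega> borel (pair_path X Y). \<exists>n. \<omega> (n, True) \<in> C \<and> \<omega> (n, False) \<in> C"
    using t unfolding hitting_time_finite_iff
    by (subst AE_distr_iff[OF measurable_pair_path[OF XY]]) (auto simp: pair_path_def)
  moreover have "(\<lambda>b. if b then z True else z False) = z" by auto
  ultimately show thesis using that coupling_law_pair_path[OF P c] by simp
qed

text \<open>The canonical process on path space realises the law. Its value at time 0 is replaced by the
  starting point because a coupling has to start there surely and not only almost surely.\<close>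

lemma coupling_law_imp_coupling:
  fixes P :: "'a::polish_space \<Rightarrow> 'a measure"
  assumes P: "P \<in> borel \<rightarrow>\<^sub>M prob_algebra borel" and \<mu>: "coupling_law P z \<mu>"
  shows "marginally_markovian_coupling P (z True) (z False) \<mu>
    (\<lambda>k \<omega>. if k = 0 then z True else \<omega> (k, True)) (\<lambda>k \<omega>. if k = 0 then z False else \<omega> (k, False))"
proof -
  interpret prob_space \<mu> by (rule coupling_lawD[OF \<mu>])
  have s\<mu>: "sets \<mu> = sets borel" and sp\<mu>: "space \<mu> = UNIV" using coupling_lawD[OF \<mu>] by auto
  define V where "V b k \<omega> = (if k = 0 then z b else \<omega> (k, b))" for b k and \<omega> :: "'a path"
  have Vh: "V b k \<in> borel_measurable (history n)" if "k \<le> n" for b k n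
    using measurable_coordinate_history[OF that, of b] by (cases "k = 0") (simp_all add: V_def[abs_def])
  have V: "V b k \<in> borel_measurable \<mu>" for b k
    using measurable_coordinate[of "(k, b)"]
    by (cases "k = 0") (simp_all add: V_def[abs_def] s\<mu> cong: measurable_cong_sets)
  let ?H = "pair_history \<mu> (V True) (V False)"
  have sub: "subalgebra \<mu> (?H n)" for n by (rule subalgebra_pair_history[OF V V])
  have H_hist: "F \<in> sets (history n)" if "F \<in> sets (?H n)" for F n
  proof -
    have "{(\<lambda>\<omega>. (V True k \<omega>, V False k \<omega>)) -` S \<inter> space \<mu> | k S. k \<le> n \<and> S \<in> sets borel} \<subseteq> sets (history n)"
    proof safe
      fix k and S :: "('a \<times> 'a) set" assume "k \<le> n" and S: "S \<in> sets borel"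
      from measurable_sets[OF borel_measurable_Pair[OF Vh[OF \<open>k \<le> n\<close>] Vh[OF \<open>k \<le> n\<close>]] S]
      show "(\<lambda>\<omega>. (V True k \<omega>, V False k \<omega>)) -` S \<inter> space \<mu> \<in> sets (history n)" by (simp add: sp\<mu>)
    qed
    from sets.sigma_sets_subset[OF this] that show ?thesis by (auto simp: sets_pair_history sp\<mu>)
  qed
  have VH: "V b n \<in> borel_measurable (?H n)" for b n
  proof -
    have "(\<lambda>\<omega>. (V True n \<omega>, V False n \<omega>)) \<in> ?H n \<rightarrow>\<^sub>M borel \<Otimes>\<^sub>M borel"
      using measurable_pair_history[of n n "V True" "V False" \<mu>] unfolding borel_prod by simp
    from measurable_compose[OF this measurable_fst] measurable_compose[OF this measurable_snd]
    show ?thesis by (cases b) simp_all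
  qed
  have ae: "AE \<omega> in \<mu>. \<omega> (k, b) = V b k \<omega>" for b k
  proof (cases "k = 0")
    case True
    have "AE \<omega> in \<mu>. \<omega> \<in> {\<omega>. \<omega> (0, b) = z b}" by (rule AE_prob_1) (rule coupling_lawD[OF \<mu>])
    with True show ?thesis by (simp add: V_def)
  qed (simp add: V_def)
  have cond: "AE \<omega> in \<mu>. real_cond_exp \<mu> (?H n) (indicator (V b (Suc n) -` S \<inter> space \<mu>)) \<omega>
      = measure (P (V b n \<omega>)) S" if S: "S \<in> sets borel" for n b S
  proof -
    interpret finite_measure_subalgebra \<mu> "?H n" by unfold_locales (rule sub)
    let ?W = "V b (Suc n) -` S \<inter> space \<mu>"
    have W: "?W \<in> sets \<mu>" by (rule measurable_sets[OF V S])
    have Weq: "?W = {\<omega>. \<omega> (Suc n, b) \<in> S}" by (auto simp: V_def sp\<mu>)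
    have PH: "(\<lambda>\<omega>. measure (P (V b n \<omega>)) S) \<in> borel_measurable (?H n)"
      by (rule measurable_compose[OF VH kernel_measurable[OF P S]])
    have P\<mu>: "(\<lambda>\<omega>. measure (P (V b n \<omega>)) S) \<in> borel_measurable \<mu>"
      by (rule measurable_compose[OF V kernel_measurable[OF P S]])
    show ?thesis
    proof (rule real_cond_exp_charact)
      show "integrable \<mu> (indicat_real ?W)" using W by (simp add: emeasure_eq_measure)
      show "integrable \<mu> (\<lambda>\<omega>. measure (P (V b n \<omega>)) S)"
        by (rule integrable_const_bound[of _ 1, OF _ P\<mu>])
           (simp add: prob_space.prob_le_1[OF kernel_prob_space(1)[OF P]])
      show "(\<lambda>\<omega>. measure (P (V b n \<omega>)) S) \<in> borel_measurable (?H n)" by (rule PH)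
    next
      fix F assume "F \<in> sets (?H n)"
      then have F: "F \<in> sets (history n)" by (rule H_hist)
      have F\<mu>: "F \<in> sets \<mu>" using history_borel[OF F] by (simp add: s\<mu>)
      have "(\<integral>\<omega>\<in>F. indicator ?W \<omega> \<partial>\<mu>) = measure \<mu> (F \<inter> ?W)"
        unfolding set_lebesgue_integral_def using F\<mu> W
        by (simp add: indicator_inter_arith[symmetric])
      also have "\<dots> = (\<integral>\<omega>\<in>F. measure (P (\<omega> (n, b))) S \<partial>\<mu>)"
        unfolding Weq by (rule coupling_law_step_eq[OF P \<mu> F S])
      also have "\<dots> = (\<integral>\<omega>\<in>F. measure (P (V b n \<omega>)) S \<partial>\<mu>)"
        unfolding set_lebesgue_integral_def
      proof (rule integral_cong_AE)
        show "AE \<omega> in \<mu>. indicat_real F \<omega> *\<^sub>R measure (P (\<omega> (n, b))) S =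
            indicat_real F \<omega> *\<^sub>R measure (P (V b n \<omega>)) S"
          using ae[of n b] by eventually_elim simp
      qed (use F\<mu> P\<mu> measurable_coordinate_kernel[OF P S s\<mu>] in simp_all)
      finally show "(\<integral>\<omega>\<in>F. indicator ?W \<omega> \<partial>\<mu>) = (\<integral>\<omega>\<in>F. measure (P (V b n \<omega>)) S \<partial>\<mu>)" .
    qed
  qed
  have "marginally_markovian_coupling P (z True) (z False) \<mu> (V True) (V False)"
    unfolding marginally_markovian_coupling_def
  proof (intro conjI allI ballI)
    show "prob_space \<mu>" by (rule prob_space_axioms)
    show "V True n \<in> borel_measurable \<mu>" "V False n \<in> borel_measurable \<mu>" for n by (rule V)+
    show "V True 0 \<omega> = z True" "V False 0 \<omega> = z False" for \<omega> by (simp_all add: V_def)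
  qed (rule cond, assumption)+
  then show ?thesis unfolding V_def[abs_def] .
qed

lemma achievable_of_coupling_laws:
  fixes P :: "'a::polish_space \<Rightarrow> 'a measure"
  assumes P: "P \<in> borel \<rightarrow>\<^sub>M prob_algebra borel" and H: "H \<in> sets borel"
    and ex: "\<And>z. \<exists>\<mu>. coupling_law P z \<mu> \<and> (AE \<omega> in \<mu>. \<exists>n. (\<omega> (n, True), \<omega> (n, False)) \<in> H)"
  shows "achievable P H"
proof (rule achievableI[OF P H])
  fix x y :: 'a
  let ?z = "\<lambda>b. if b then x else y"
  obtain \<mu> where \<mu>: "coupling_law P ?z \<mu>" and hit: "AE \<omega> in \<mu>. \<exists>n. (\<omega> (n, True), \<omega> (n, False)) \<in> H"
    using ex by blast
  interpret prob_space \<mu> by (rule coupling_lawD[OF \<mu>])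
  let ?X = "\<lambda>k \<omega>. if k = 0 then x else \<omega> (k, True)" and ?Y = "\<lambda>k \<omega>. if k = 0 then y else \<omega> (k, False)"
  have start: "AE \<omega> in \<mu>. \<omega> \<in> {\<omega>. \<omega> (0, b) = ?z b}" for b
    by (rule AE_prob_1) (rule coupling_lawD[OF \<mu>])
  have "AE \<omega> in \<mu>. hitting_time H ?X ?Y \<omega> < \<infinity>"
    using hit start[of True] start[of False]
  proof eventually_elim
    case (elim \<omega>)
    then obtain n where n: "(\<omega> (n, True), \<omega> (n, False)) \<in> H" by blast
    have "(?X n \<omega>, ?Y n \<omega>) = (\<omega> (n, True), \<omega> (n, False))" using elim by auto
    with n show ?case unfolding hitting_time_finite_iff by metis
  qed
  moreover have "marginally_markovian_coupling P x y \<mu> ?X ?Y"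
    using coupling_law_imp_coupling[OF P \<mu>] by (simp cong: if_cong)
  ultimately show "\<exists>(\<Omega> :: 'a path measure) X Y.
      marginally_markovian_coupling P x y \<Omega> X Y \<and> (AE \<omega> in \<Omega>. hitting_time H X Y \<omega> < \<infinity>)"
    by blast
qed

section \<open>Limits of coupling laws\<close>

text \<open>Tychonoff's theorem for a cube with arbitrarily many factors, along an arbitrary filter; refining
  the filter turns the cluster point into a limit.\<close>

lemma cluster_point:
  fixes g :: "'p \<Rightarrow> 'k \<Rightarrow> real"
  assumes "\<Phi> \<noteq> bot" "\<And>p k. 0 \<le> g p k" "\<And>p k. g p k \<le> 1"
  obtains m \<Psi> where "\<Psi> \<noteq> bot" "\<Psi> \<le> \<Phi>" "\<And>k. ((\<lambda>p. g p k) \<longlongrightarrow> m k) \<Psi>"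
proof -
  let ?Q = "PiE UNIV (\<lambda>_. {0..1}) :: ('k \<Rightarrow> real) set"
  have "compact ?Q"
    using compactin_PiE[of "\<lambda>_. euclidean" UNIV "\<lambda>_::'k. {0..1::real}"]
    by (simp add: euclidean_product_topology)
  moreover have "filtermap g \<Phi> \<noteq> bot" using assms by (simp add: filtermap_bot_iff)
  moreover have "eventually (\<lambda>x. x \<in> ?Q) (filtermap g \<Phi>)"
    unfolding eventually_filtermap by (rule always_eventually) (simp add: PiE_iff assms)
  ultimately obtain m where m: "inf (nhds m) (filtermap g \<Phi>) \<noteq> bot"
    unfolding compact_filter by blast
  define \<Psi> where "\<Psi> = inf \<Phi> (filtercomap g (nhds m))"
  have "\<Psi> \<noteq> bot"
  proof
    assume "\<Psi> = bot"
    then have "eventually (\<lambda>_. False) (inf \<Phi> (filtercomap g (nhds m)))"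
      unfolding \<Psi>_def by simp
    then obtain A B where AB: "eventually A \<Phi>" "eventually B (filtercomap g (nhds m))"
      "\<And>x. A x \<Longrightarrow> B x \<Longrightarrow> False"
      unfolding eventually_inf by blast
    then obtain C where C: "eventually C (nhds m)" "\<And>x. C (g x) \<Longrightarrow> B x"
      unfolding eventually_filtercomap by blast
    have "eventually (\<lambda>x. \<not> C x) (filtermap g \<Phi>)"
      unfolding eventually_filtermap using AB(1) by eventually_elim (use AB C in blast)
    with C have "eventually (\<lambda>_. False) (inf (nhds m) (filtermap g \<Phi>))"
      unfolding eventually_inf by blast
    with m show False by (simp add: eventually_False)
  qed
  moreover have "\<Psi> \<le> \<Phi>" unfolding \<Psi>_def by simp
  moreover have "((\<lambda>p. g p k) \<longlongrightarrow> m k) \<Psi>" for k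
  proof -
    have lim: "filterlim g (nhds m) \<Psi>"
      unfolding \<Psi>_def filterlim_def
      by (metis filtermap_filtercomap filtermap_mono inf_le2 order_trans)
    show ?thesis
    proof (rule topological_tendstoI)
      fix S :: "real set" assume "open S" "m k \<in> S"
      then have "open ((\<lambda>x::'k \<Rightarrow> real. x k) -` S)" "m \<in> (\<lambda>x. x k) -` S"
        by (auto intro: open_vimage continuous_on_product_coordinates)
      from topological_tendstoD[OF lim this] show "eventually (\<lambda>p. g p k \<in> S) \<Psi>" by simp
    qed
  qed
  ultimately show thesis by (rule that)
qed

text \<open>The limit \<open>m\<close> of the laws on all sets is a finitely additive set function that inherits the defining
  inequalities. They determine its one-coordinate marginals by induction on time: the step from \<open>k\<close>
  to \<open>k + 1\<close> bounds \<open>m\<close> from above by the integral of \<open>P\<close> against the marginal at time \<open>k\<close>, for \<open>S\<close> and for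
  its complement. Being measures, these marginals allow the extension of \<open>m\<close> from the cylinders to a
  measure. That measure agrees with \<open>m\<close> on cylinders only, which is why lower bounds are transferred
  for cylinder sets and why the Markov property has to be extended again by \<open>step_eq_extend\<close>.\<close>

theorem coupling_law_limit:
  fixes \<pi> :: "'p \<Rightarrow> 'a::polish_space path measure"
  assumes P: "P \<in> borel \<rightarrow>\<^sub>M prob_algebra borel" and \<Phi>: "\<Phi> \<noteq> bot"
    and \<pi>: "\<And>p. prob_space (\<pi> p)" "\<And>p. sets (\<pi> p) = sets borel"
    and start: "\<And>b. \<forall>\<^sub>F p in \<Phi>. measure (\<pi> p) {\<omega>. \<omega> (0, b) = z b} = 1"
    and step: "\<And>n b F S a. F \<in> sets (history n) \<Longrightarrow> S \<in> sets borel \<Longrightarrow>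
      (\<And>\<omega>. \<omega> \<in> F \<Longrightarrow> measure (P (\<omega> (n, b))) S \<le> a) \<Longrightarrow>
      \<forall>\<^sub>F p in \<Phi>. measure (\<pi> p) (F \<inter> {\<omega>. \<omega> (Suc n, b) \<in> S}) \<le> a * measure (\<pi> p) F"
  obtains \<mu> where "coupling_law P z \<mu>"
    "\<And>A c. A \<in> cylinder_sets \<Longrightarrow> \<forall>\<^sub>F p in \<Phi>. c \<le> measure (\<pi> p) A \<Longrightarrow> c \<le> measure \<mu> A"
proof -
  have sp: "space (\<pi> p) = UNIV" for p using sets_eq_imp_space_eq[OF \<pi>(2)[of p]] by simp
  obtain m \<Psi> where \<Psi>: "\<Psi> \<noteq> bot" "\<Psi> \<le> \<Phi>" and m: "\<And>A. ((\<lambda>p. measure (\<pi> p) A) \<longlongrightarrow> m A) \<Psi>"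
    using cluster_point[of \<Phi> "\<lambda>p A. measure (\<pi> p) A", OF \<Phi> measure_nonneg prob_space.prob_le_1[OF \<pi>(1)]] by blast
  have ev: "eventually Q \<Psi>" if "eventually Q \<Phi>" for Q using \<Psi>(2) that by (rule filter_leD)
  have m_ge: "c \<le> m A" if "\<forall>\<^sub>F p in \<Phi>. c \<le> measure (\<pi> p) A" for A c
    using \<Psi>(1) by (intro tendsto_lowerbound[OF m ev[OF that]]) simp
  have m_step: "m (F \<inter> {\<omega>. \<omega> (Suc n, b) \<in> S}) \<le> a * m F"
    if "F \<in> sets (history n)" "S \<in> sets borel" "\<And>\<omega>. \<omega> \<in> F \<Longrightarrow> measure (P (\<omega> (n, b))) S \<le> a" for n b F S a
  proof -
    have "\<forall>\<^sub>F p in \<Psi>. measure (\<pi> p) (F \<inter> {\<omega>. \<omega> (Suc n, b) \<in> S}) \<le> a * measure (\<pi> p) F"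
      by (rule ev, rule step) (use that in auto)
    with tendsto_mult[OF tendsto_const m] m show ?thesis by (rule tendsto_le[OF \<Psi>(1)])
  qed
  interpret m: borel_content m
  proof
    show "0 \<le> m A" for A by (rule m_ge) (simp add: always_eventually)
    have "measure (\<pi> p) UNIV = 1" for p using prob_space.prob_space[OF \<pi>(1)[of p]] by (simp add: sp)
    then have "((\<lambda>p. measure (\<pi> p) UNIV) \<longlongrightarrow> 1) \<Psi>" by simp
    with m show "m UNIV = 1" by (rule tendsto_unique[OF \<Psi>(1)])
    fix A B :: "'a path set" assume AB: "A \<in> sets borel" "B \<in> sets borel" "A \<inter> B = {}"
    have "measure (\<pi> p) (A \<union> B) = measure (\<pi> p) A + measure (\<pi> p) B" for p
    proof -
      interpret prob_space "\<pi> p" by (rule \<pi>)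
      show ?thesis using AB \<pi>(2) by (intro finite_measure_Union) auto
    qed
    then have "((\<lambda>p. measure (\<pi> p) (A \<union> B)) \<longlongrightarrow> m A + m B) \<Psi>"
      using tendsto_add[OF m m] by simp
    with m show "m (A \<union> B) = m A + m B" by (rule tendsto_unique[OF \<Psi>(1)])
  qed
  have m_start: "m {\<omega>. \<omega> (0, b) = z b} = 1" for b
  proof (rule antisym)
    show "1 \<le> m {\<omega>. \<omega> (0, b) = z b}"
      by (rule m_ge) (use start[of b] in eventually_elim, simp)
    have "{\<omega>. \<omega> (0, b) \<in> {z b}} \<in> sets (borel :: 'a path measure)" by (intro coordinate_sets) simp
    then show "m {\<omega>. \<omega> (0, b) = z b} \<le> 1" using m.mono[of "{\<omega>. \<omega> (0, b) = z b}" UNIV] m.total by simp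
  qed
  have marg: "m {\<omega>. \<omega> (k, b) \<in> S} = measure (kernel_power P k (z b)) S" if "S \<in> sets borel" for k b S
    using that
  proof (induction k arbitrary: S)
    case 0
    have s: "{\<omega>. \<omega> (0, b) \<in> S} \<in> sets (borel :: 'a path measure)" "{\<omega>. \<omega> (0, b) \<in> {z b}} \<in> sets (borel :: 'a path measure)"
      using 0 by (auto intro!: coordinate_sets simp del: singleton_iff)
    have "m {\<omega>. \<omega> (0, b) \<in> S} = indicator S (z b)"
    proof (cases "z b \<in> S")
      case True
      then have "m {\<omega>. \<omega> (0, b) = z b} \<le> m {\<omega>. \<omega> (0, b) \<in> S}" using s by (intro m.mono) auto
      then show ?thesis using True m_start m.mono[OF s(1), of UNIV] m.total by simp
    next
      case False
      then have "m ({\<omega>. \<omega> (0, b) = z b} \<union> {\<omega>. \<omega> (0, b) \<in> S}) = m {\<omega>. \<omega> (0, b) = z b} + m {\<omega>. \<omega> (0, b) \<in> S}"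
        using s by (intro m.additive) auto
      moreover have "m ({\<omega>. \<omega> (0, b) = z b} \<union> {\<omega>. \<omega> (0, b) \<in> S}) \<le> m UNIV"
        using s by (intro m.mono) auto
      ultimately show ?thesis using False m_start[of b] m.nonneg[OF s(1)] m.total by simp
    qed
    also have "\<dots> = measure (return borel (z b)) S"
      using 0 by (simp add: measure_def emeasure_return indicator_def)
    finally show ?case by simp
  next
    case (Suc k)
    let ?\<nu> = "kernel_power P k (z b)"
    interpret \<nu>: prob_space ?\<nu> using kernel_power_prob_space[OF P] by simp
    have s\<nu>: "sets ?\<nu> = sets borel" and sp\<nu>: "space ?\<nu> = UNIV"
      using kernel_power_prob_space[OF P, of k "z b"] by (auto dest: sets_eq_imp_space_eq)
    have kb: "(\<lambda>x. measure (P x) S) \<in> borel_measurable ?\<nu>" if "S \<in> sets borel" for S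
      using kernel_measurable[OF P that] by (simp cong: measurable_cong_sets add: s\<nu>)
    have le: "m {\<omega>. \<omega> (Suc k, b) \<in> S} \<le> (\<integral>x. measure (P x) S \<partial>?\<nu>)" if S: "S \<in> sets borel" for S
    proof -
      let ?S = "{\<omega> :: 'a path. \<omega> (Suc k, b) \<in> S}"
      have S': "?S \<in> sets borel" by (rule coordinate_sets[OF S])
      have "m ({\<omega>. \<omega> (k, b) \<in> space ?\<nu>} \<inter> ?S) \<le> (\<integral>x. measure (P x) S \<partial>?\<nu>)"
      proof (rule content_le_integral[where \<alpha> = "\<lambda>T. m ({\<omega>. \<omega> (k, b) \<in> T} \<inter> ?S)"])
        show "measure (P x) S \<le> 1" for x using prob_space.prob_le_1[OF kernel_prob_space(1)[OF P]] .
      next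
        fix I :: "nat set" and T assume I: "finite I" "\<And>i. i \<in> I \<Longrightarrow> T i \<in> sets ?\<nu>"
        have eq: "{\<omega>. \<omega> (k, b) \<in> (\<Union>i\<in>I. T i)} \<inter> ?S = (\<Union>i\<in>I. {\<omega>. \<omega> (k, b) \<in> T i} \<inter> ?S)" by blast
        show "m ({\<omega>. \<omega> (k, b) \<in> (\<Union>i\<in>I. T i)} \<inter> ?S) \<le> (\<Sum>i\<in>I. m ({\<omega>. \<omega> (k, b) \<in> T i} \<inter> ?S))"
          unfolding eq using I(1)
        proof (rule m.subadditive_UN)
          fix i assume "i \<in> I"
          then have "T i \<in> sets borel" using I(2) by (simp add: s\<nu>)
          from sets.Int[OF coordinate_sets[OF this] S']
          show "{\<omega>. \<omega> (k, b) \<in> T i} \<inter> ?S \<in> sets borel" .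
        qed
      next
        fix J :: "real set" and a assume J: "J \<in> sets borel" and a: "\<And>y. y \<in> J \<Longrightarrow> y \<le> a"
        let ?T = "{x. measure (P x) S \<in> J}"
        have T: "?T \<in> sets borel"
          using measurable_sets[OF kernel_measurable[OF P S] J] by (simp add: vimage_def)
        have "m ({\<omega>. \<omega> (k, b) \<in> ?T} \<inter> ?S) \<le> a * m {\<omega>. \<omega> (k, b) \<in> ?T}"
          using a by (intro m_step coordinate_history T S order_refl) auto
        then show "m ({\<omega>. \<omega> (k, b) \<in> {x \<in> space ?\<nu>. measure (P x) S \<in> J}} \<inter> ?S)
            \<le> a * measure ?\<nu> {x \<in> space ?\<nu>. measure (P x) S \<in> J}"
          using Suc.IH[OF T] by (simp add: sp\<nu>)
      qed (auto intro: kb S \<nu>.finite_measure_axioms)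
      then show ?thesis by (simp add: sp\<nu>)
    qed
    have cS: "- S \<in> sets borel" using Suc.prems by (rule borel_comp)
    have int: "integrable ?\<nu> (\<lambda>x. measure (P x) S)"
      by (rule \<nu>.integrable_const_bound[of _ 1, OF _ kb[OF Suc.prems]])
         (simp add: prob_space.prob_le_1[OF kernel_prob_space(1)[OF P]])
    have "m {\<omega>. \<omega> (Suc k, b) \<in> - S} \<le> (\<integral>x. measure (P x) (- S) \<partial>?\<nu>)" by (rule le[OF cS])
    also have "\<dots> = 1 - (\<integral>x. measure (P x) S \<partial>?\<nu>)"
      using int by (simp add: kernel_compl[OF P Suc.prems] \<nu>.prob_space)
    also have "m {\<omega>. \<omega> (Suc k, b) \<in> - S} = 1 - m {\<omega>. \<omega> (Suc k, b) \<in> S}"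
    proof -
      have "{\<omega>. \<omega> (Suc k, b) \<in> - S} = UNIV - {\<omega> :: 'a path. \<omega> (Suc k, b) \<in> S}" by blast
      then show ?thesis using m.diff[OF coordinate_sets[OF Suc.prems], of UNIV] m.total by simp
    qed
    finally have "m {\<omega>. \<omega> (Suc k, b) \<in> S} = (\<integral>x. measure (P x) S \<partial>?\<nu>)"
      using le[OF Suc.prems] by simp
    then show ?case by (simp only: kernel_power_Suc_measure[OF P Suc.prems])
  qed
  define \<nu> where "\<nu> i = kernel_power P (fst i) (z (snd i))" for i :: "nat \<times> bool"
  interpret product_content m \<nu>
  proof (intro product_content.intro product_content_axioms.intro m.borel_content_axioms)
    fix i and S :: "'a set"
    show "prob_space (\<nu> i)" "sets (\<nu> i) = sets borel"
      unfolding \<nu>_def using kernel_power_prob_space[OF P] by auto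
    show "S \<in> sets borel \<Longrightarrow> m {\<omega>. \<omega> i \<in> S} = measure (\<nu> i) S"
      unfolding \<nu>_def using marg[of S "fst i" "snd i"] by simp
  qed
  obtain \<mu> where \<mu>: "prob_space \<mu>" "sets \<mu> = sets borel" "\<And>A. A \<in> m.regular_sets \<Longrightarrow> measure \<mu> A = m A"
    using extension by blast
  have "A \<in> m.regular_sets" if "A \<in> cylinder_sets" for A
    using that
  proof induction
    case (complement A)
    then show ?case using algebra.compl_sets[OF m.algebra_regular_sets] by (simp add: Compl_eq_Diff_UNIV)
  next
    case (union A B)
    then show ?case using m.algebra_regular_sets by (simp add: algebra_iff_Un)
  next
    case (coordinate S k b)
    then show ?case by (rule coordinate_regular)
  qed
  then have \<mu>m: "measure \<mu> A = m A" if "A \<in> cylinder_sets" for A using \<mu>(3) that by simp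
  have "coupling_law P z \<mu>"
  proof (rule coupling_lawI[OF P \<mu>(1,2)])
    fix b
    have "{\<omega>. \<omega> (0, b) \<in> {z b}} \<in> cylinder_sets" by (intro cylinder_sets.coordinate) simp
    then show "measure \<mu> {\<omega>. \<omega> (0, b) = z b} = 1" using \<mu>m m_start by simp
  next
    fix n b and F :: "'a path set" and S :: "'a set" assume F: "F \<in> sets (history n)" and S: "S \<in> sets borel"
    show "measure \<mu> (F \<inter> {\<omega>. \<omega> (Suc n, b) \<in> S}) = (\<integral>\<omega>\<in>F. measure (P (\<omega> (n, b))) S \<partial>\<mu>)"
    proof (rule step_eq_extend[OF P \<mu>(1,2) S _ F])
      fix F :: "'a path set" assume F: "F \<in> sets (history n)" "F \<in> cylinder_sets"
      show "measure \<mu> (F \<inter> {\<omega>. \<omega> (Suc n, b) \<in> S}) = (\<integral>\<omega>\<in>F. measure (P (\<omega> (n, b))) S \<partial>\<mu>)"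
      proof (rule conditional_step_eq[OF P \<mu>(1,2) history_borel[OF F(1)] S])
        fix S T :: "'a set" and a
        assume S: "S \<in> sets borel" and T: "T \<in> sets borel" and a: "\<And>x. x \<in> T \<Longrightarrow> measure (P x) S \<le> a"
        let ?F = "F \<inter> {\<omega>. \<omega> (n, b) \<in> T}"
        have "?F \<in> cylinder_sets" "?F \<inter> {\<omega>. \<omega> (Suc n, b) \<in> S} \<in> cylinder_sets"
          using F S T by (auto intro!: cylinder_sets_Int cylinder_sets.coordinate)
        moreover have "m (?F \<inter> {\<omega>. \<omega> (Suc n, b) \<in> S}) \<le> a * m ?F"
          using F a by (intro m_step sets.Int coordinate_history T S order_refl) auto
        ultimately show "measure \<mu> (?F \<inter> {\<omega>. \<omega> (Suc n, b) \<in> S}) \<le> a * measure \<mu> ?F"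
          by (simp only: \<mu>m)
      qed
    qed
  qed
  then show thesis using that \<mu>m m_ge by simp
qed

section \<open>Continuing a coupling after a stopping time\<close>

text \<open>The sets in \<open>\<S>\<close> cut the space into finitely many Borel cells, and \<open>r\<close> is constant on each of them.
  The set \<open>D\<close> is arbitrary; a cell that meets \<open>D\<close> is represented by a point of \<open>D\<close>.\<close>

lemma finite_partition_representatives:
  fixes \<S> :: "'w::topological_space set set"
  assumes fin: "finite \<S>" and bor: "\<S> \<subseteq> sets borel"
  obtains r where "r \<in> borel \<rightarrow>\<^sub>M count_space UNIV" "\<And>\<omega>. \<omega> \<in> D \<Longrightarrow> r \<omega> \<in> D"
    "\<And>S \<omega>. S \<in> \<S> \<Longrightarrow> r \<omega> \<in> S \<longleftrightarrow> \<omega> \<in> S"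
proof -
  define pat where "pat \<omega> = {S \<in> \<S>. \<omega> \<in> S}" for \<omega>
  define h where "h p = (if \<exists>\<omega>\<in>D. pat \<omega> = p then SOME \<omega>. \<omega> \<in> D \<and> pat \<omega> = p else SOME \<omega>. pat \<omega> = p)" for p
  have h: "pat (h (pat \<omega>)) = pat \<omega>" "\<omega> \<in> D \<Longrightarrow> h (pat \<omega>) \<in> D" for \<omega>
  proof -
    have "pat (h (pat \<omega>)) = pat \<omega> \<and> (\<omega> \<in> D \<longrightarrow> h (pat \<omega>) \<in> D)"
    proof (cases "\<exists>\<omega>'\<in>D. pat \<omega>' = pat \<omega>")
      case True
      then have "h (pat \<omega>) = (SOME \<omega>'. \<omega>' \<in> D \<and> pat \<omega>' = pat \<omega>)" by (simp add: h_def)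
      moreover have "\<exists>\<omega>'. \<omega>' \<in> D \<and> pat \<omega>' = pat \<omega>" using True by blast
      ultimately show ?thesis using someI_ex[of "\<lambda>\<omega>'. \<omega>' \<in> D \<and> pat \<omega>' = pat \<omega>"] by simp
    next
      case False
      then have "h (pat \<omega>) = (SOME \<omega>'. pat \<omega>' = pat \<omega>)" by (simp add: h_def)
      then show ?thesis using False someI[of "\<lambda>\<omega>'. pat \<omega>' = pat \<omega>" \<omega>] by auto
    qed
    then show "pat (h (pat \<omega>)) = pat \<omega>" "\<omega> \<in> D \<Longrightarrow> h (pat \<omega>) \<in> D" by auto
  qed
  have finPow: "finite (Pow \<S>)" using fin by simp
  have "pat \<in> borel \<rightarrow>\<^sub>M count_space (Pow \<S>)"
    unfolding measurable_count_space_eq2[OF finPow]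
  proof -
    show "pat \<in> space borel \<rightarrow> Pow \<S> \<and> (\<forall>p\<in>Pow \<S>. pat -` {p} \<inter> space borel \<in> sets borel)"
    proof (intro conjI ballI)
      fix p assume p: "p \<in> Pow \<S>"
      have "pat -` {p} \<inter> space borel = {\<omega> \<in> space borel. \<forall>S\<in>\<S>. \<omega> \<in> (if S \<in> p then S else - S)}"
        using p unfolding pat_def by (auto split: if_splits)
      also have "\<dots> \<in> sets borel"
      proof (rule sets.sets_Collect_finite_All[OF _ fin])
        fix S assume "S \<in> \<S>"
        then have "(if S \<in> p then S else - S) \<in> sets borel" using bor by (auto simp: borel_comp)
        then show "{\<omega> \<in> space borel. \<omega> \<in> (if S \<in> p then S else - S)} \<in> sets borel" by simp
      qed
      finally show "pat -` {p} \<inter> space borel \<in> sets borel" .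
    qed (auto simp: pat_def)
  qed
  then have "(\<lambda>\<omega>. h (pat \<omega>)) \<in> borel \<rightarrow>\<^sub>M count_space UNIV"
    by (rule measurable_compose) simp
  moreover have "h (pat \<omega>) \<in> S \<longleftrightarrow> \<omega> \<in> S" if "S \<in> \<S>" for S \<omega>
    using h(1)[of \<omega>] that unfolding pat_def by blast
  ultimately show thesis using that h(2) by blast
qed

text \<open>The value at time \<open>s\<close> is that of the second path at time 0. With \<open>\<omega>'\<close> started at the state of \<open>\<omega>\<close> at time
  \<open>s\<close> this agrees with \<open>\<omega>\<close>, but only almost surely; taking it from \<open>\<omega>'\<close> makes the Markov property of \<open>\<omega>'\<close>
  applicable at time \<open>s\<close> without exceptional sets.\<close>

definition path_append :: "nat \<Rightarrow> 'a path \<Rightarrow> 'a path \<Rightarrow> 'a path" where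
  "path_append s \<omega> \<omega>' = (\<lambda>(k, b). if k < s then \<omega> (k, b) else \<omega>' (k - s, b))"

lemma path_append_history:
  assumes "F \<in> sets (history (s + j))"
  shows "path_append s \<omega> -` F \<in> sets (history j)"
proof -
  have "path_append s \<omega> \<in> history j \<rightarrow>\<^sub>M history (s + j)"
  proof (rule measurable_sigma_sets[OF sets_history])
    fix A assume "A \<in> {{\<omega>::'a path. \<omega> (k, b) \<in> S} | k b S. k \<le> s + j \<and> S \<in> sets borel}"
    then obtain k b S where A: "A = {\<omega>. \<omega> (k, b) \<in> S}" "k \<le> s + j" "S \<in> sets borel" by blast
    show "path_append s \<omega> -` A \<inter> space (history j) \<in> sets (history j)"
    proof (cases "k < s")
      case True
      then have "path_append s \<omega> -` A = (if \<omega> (k, b) \<in> S then UNIV else {})"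
        by (auto simp: A path_append_def)
      then show ?thesis using sets.top[of "history j :: 'a path measure"] by simp
    next
      case False
      then have "path_append s \<omega> -` A = {\<omega>'. \<omega>' (k - s, b) \<in> S}"
        by (auto simp: A path_append_def)
      then show ?thesis using coordinate_history[of "k - s" j S b] A False by simp
    qed
  qed auto
  from measurable_sets[OF this assms] show ?thesis by simp
qed

lemma path_append_measurable: "path_append s \<omega> \<in> borel \<rightarrow>\<^sub>M (borel :: 'a::topological_space path measure)"
proof (intro borel_measurable_continuous_onI continuous_on_coordinatewise_then_product)
  fix i :: "nat \<times> bool"
  show "continuous_on UNIV (\<lambda>\<omega>'. path_append s \<omega> \<omega>' i)"
    by (cases i; cases "fst i < s") (simp_all add: path_append_def)
qed

text \<open>Follow \<open>\<omega>\<close> up to time \<open>\<sigma> \<omega>\<close> and then a path with law \<open>\<kappa> \<omega>\<close>. Neither \<open>\<kappa>\<close> nor the law defined here need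
  depend measurably on \<open>\<omega>\<close>.\<close>

definition continued ::
  "('a::polish_space path \<Rightarrow> enat) \<Rightarrow> ('a path \<Rightarrow> 'a path measure) \<Rightarrow> 'a path \<Rightarrow> 'a path measure" where
  "continued \<sigma> \<kappa> \<omega> = (case \<sigma> \<omega> of enat s \<Rightarrow> distr (\<kappa> \<omega>) borel (path_append s \<omega>) | \<infinity> \<Rightarrow> return borel \<omega>)"

context
  fixes P :: "'a::polish_space \<Rightarrow> 'a measure" and \<sigma> :: "'a path \<Rightarrow> enat" and \<kappa> \<omega>
  assumes \<kappa>: "\<And>s. \<sigma> \<omega> = enat s \<Longrightarrow> coupling_law P (\<lambda>b. \<omega> (s, b)) (\<kappa> \<omega>)"
begin

lemma path_append_measurable_law: "\<sigma> \<omega> = enat s \<Longrightarrow> path_append s \<omega> \<in> \<kappa> \<omega> \<rightarrow>\<^sub>M borel"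
  using \<kappa> path_append_measurable[of s \<omega>] by (simp add: coupling_law_def cong: measurable_cong_sets)

lemma measure_continued:
  assumes "\<sigma> \<omega> = enat s" "F \<in> sets borel"
  shows "measure (continued \<sigma> \<kappa> \<omega>) F = measure (\<kappa> \<omega>) (path_append s \<omega> -` F)"
proof -
  have "space (\<kappa> \<omega>) = UNIV"
    using \<kappa>[OF assms(1)] sets_eq_imp_space_eq[of "\<kappa> \<omega>" borel] by (simp add: coupling_law_def)
  then show ?thesis
    using measure_distr[OF path_append_measurable_law assms(2)] assms(1) by (simp add: continued_def)
qed

lemma continued_prob_space:
  "prob_space (continued \<sigma> \<kappa> \<omega>)" "sets (continued \<sigma> \<kappa> \<omega>) = sets borel"
proof -
  show "prob_space (continued \<sigma> \<kappa> \<omega>)"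
  proof (cases "\<sigma> \<omega>")
    case (enat s)
    then show ?thesis
      using \<kappa>[OF enat] path_append_measurable_law[OF enat]
      by (auto simp: continued_def coupling_law_def intro: prob_space.prob_space_distr)
  qed (simp add: continued_def prob_space_return)
  show "sets (continued \<sigma> \<kappa> \<omega>) = sets borel"
    by (simp add: continued_def split: enat.split)
qed

lemma continued_past:
  assumes F: "F \<in> sets (history k)" and k: "enat k \<le> \<sigma> \<omega>"
  shows "measure (continued \<sigma> \<kappa> \<omega>) F = indicator F \<omega>"
proof (cases "\<sigma> \<omega>")
  case infinity
  then show ?thesis
    using history_borel[OF F] by (simp add: continued_def measure_def emeasure_return indicator_def)
next
  case (enat s)
  have c: "coupling_law P (\<lambda>b. \<omega> (s, b)) (\<kappa> \<omega>)" by (rule \<kappa>[OF enat])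
  then interpret prob_space "\<kappa> \<omega>" by (simp add: coupling_law_def)
  have s\<kappa>: "sets (\<kappa> \<omega>) = sets borel" by (rule coupling_lawD[OF c])
  have "AE \<omega>' in \<kappa> \<omega>. \<omega>' \<in> {\<omega>'. \<omega>' (0, b) = \<omega> (s, b)}" for b
    by (rule AE_prob_1) (use c in \<open>simp add: coupling_law_def\<close>)
  then have "AE \<omega>' in \<kappa> \<omega>. \<omega>' (0, True) = \<omega> (s, True) \<and> \<omega>' (0, False) = \<omega> (s, False)" by auto
  then have ae: "AE \<omega>' in \<kappa> \<omega>. \<omega>' \<in> path_append s \<omega> -` F \<longleftrightarrow> \<omega>' \<in> (if \<omega> \<in> F then space (\<kappa> \<omega>) else {})"
  proof (rule AE_mp[OF _ AE_I2[OF impI]])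
    fix \<omega>' assume sp: "\<omega>' \<in> space (\<kappa> \<omega>)"
      and st: "\<omega>' (0, True) = \<omega> (s, True) \<and> \<omega>' (0, False) = \<omega> (s, False)"
    have "path_append s \<omega> \<omega>' (j, b) = \<omega> (j, b)" if "j \<le> k" for j b
      using that k enat st by (cases b) (auto simp: path_append_def not_less dest!: le_antisym)
    then have "path_append s \<omega> \<omega>' \<in> F \<longleftrightarrow> \<omega> \<in> F" by (rule history_cong[OF F])
    then show "\<omega>' \<in> path_append s \<omega> -` F \<longleftrightarrow> \<omega>' \<in> (if \<omega> \<in> F then space (\<kappa> \<omega>) else {})" using sp by simp
  qed
  have "F \<in> sets (history (s + 0))"
    by (rule history_mono[OF _ F]) (use k enat in simp)
  then have "path_append s \<omega> -` F \<in> sets (\<kappa> \<omega>)"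
    using history_borel[OF path_append_history[of F s 0 \<omega>]] by (simp add: s\<kappa>)
  then have "measure (\<kappa> \<omega>) (path_append s \<omega> -` F) = measure (\<kappa> \<omega>) (if \<omega> \<in> F then space (\<kappa> \<omega>) else {})"
    by (intro finite_measure_eq_AE ae) auto
  then show ?thesis
    using measure_continued[OF enat history_borel[OF F]] by (simp add: prob_space)
qed

lemma continued_future:
  assumes F: "F \<in> sets (history k)" and S: "S \<in> sets borel" and k: "\<sigma> \<omega> \<le> enat k"
    and a: "\<And>\<omega>. \<omega> \<in> F \<Longrightarrow> measure (P (\<omega> (k, b))) S \<le> a"
  shows "measure (continued \<sigma> \<kappa> \<omega>) (F \<inter> {\<omega>. \<omega> (Suc k, b) \<in> S}) \<le> a * measure (continued \<sigma> \<kappa> \<omega>) F"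
proof -
  obtain s where s: "\<sigma> \<omega> = enat s" "s \<le> k" using k by (cases "\<sigma> \<omega>") auto
  let ?V = "path_append s \<omega> -` F"
  have V: "?V \<in> sets (history (k - s))" using F s by (intro path_append_history) simp
  have S': "{\<omega> :: 'a path. \<omega> (Suc k, b) \<in> S} \<in> sets borel" by (rule coordinate_sets[OF S])
  have "measure (P (\<omega>' (k - s, b))) S \<le> a" if "\<omega>' \<in> ?V" for \<omega>'
    using a[of "path_append s \<omega> \<omega>'"] that s by (simp add: path_append_def)
  then have le: "measure (\<kappa> \<omega>) (?V \<inter> {\<omega>'. \<omega>' (Suc (k - s), b) \<in> S}) \<le> a * measure (\<kappa> \<omega>) ?V"
    by (rule coupling_lawD(5)[OF \<kappa>[OF s(1)] V S])
  have "path_append s \<omega> -` (F \<inter> {\<omega>. \<omega> (Suc k, b) \<in> S}) = ?V \<inter> {\<omega>'. \<omega>' (Suc (k - s), b) \<in> S}"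
    using s by (auto simp: path_append_def Suc_diff_le)
  with le show ?thesis
    using measure_continued[OF s(1)] history_borel[OF F] S' by simp
qed

end

text \<open>For a finite family \<open>\<S>\<close> of Borel sets, \<open>\<pi> \<S>\<close> is the law obtained by sampling a path from \<open>\<mu>\<close>, moving it to
  the representative of its cell, and continuing from there. It need not be a coupling law: before
  the stopping time it moves along representatives. But every single inequality defining a coupling
  law holds for \<open>\<pi> \<S>\<close> as soon as \<open>\<S>\<close> contains the parts before the stopping time of the two events that
  occur in it, since the replacement of paths does not change the mass of sets in \<open>\<S>\<close>. The limit along the finite families is therefore a coupling law.

  The last two assertions are all that is kept of the continued laws \<open>continued \<sigma> \<kappa> \<omega>\<close>: lower bounds
  that hold on a Borel set count with its measure, and those that hold on the part of it in \<open>D\<close> count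
  with the outer measure of that part.\<close>

theorem coupling_law_continue:
  fixes P :: "'a::polish_space \<Rightarrow> 'a measure" and \<sigma> :: "'a path \<Rightarrow> enat"
  assumes P: "P \<in> borel \<rightarrow>\<^sub>M prob_algebra borel" and \<mu>: "coupling_law P z \<mu>"
    and stop: "\<And>k. {\<omega>. enat k < \<sigma> \<omega>} \<in> sets (history k)"
    and restart: "\<forall>\<omega> s. \<sigma> \<omega> = enat s \<longrightarrow> coupling_law P (\<lambda>b. \<omega> (s, b)) (\<kappa> \<omega>)"
  shows "\<exists>\<mu>'. coupling_law P z \<mu>' \<and>
    (\<forall>A\<in>cylinder_sets. \<forall>E\<in>sets borel. \<forall>c\<ge>0.
      (\<forall>\<omega>\<in>E. c \<le> measure (continued \<sigma> \<kappa> \<omega>) A) \<longrightarrow> c * measure \<mu> E \<le> measure \<mu>' A) \<and>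
    (\<forall>A\<in>cylinder_sets. \<forall>E\<in>sets borel. \<forall>c\<ge>0. \<forall>a.
      (\<forall>\<omega>\<in>E \<inter> D. c \<le> measure (continued \<sigma> \<kappa> \<omega>) A) \<longrightarrow>
      (\<forall>U\<in>sets borel. D \<subseteq> U \<longrightarrow> a \<le> measure \<mu> (E \<inter> U)) \<longrightarrow> c * a \<le> measure \<mu>' A)"
proof -
  note \<kappa> = restart[rule_format]
  interpret prob_space \<mu> by (rule coupling_lawD[OF \<mu>])
  have s\<mu>: "sets \<mu> = sets borel" by (rule coupling_lawD[OF \<mu>])
  have sp\<mu>: "space \<mu> = UNIV" using sets_eq_imp_space_eq[OF s\<mu>] by simp
  let ?K = "continued \<sigma> \<kappa>"
  have Kprob: "prob_space (?K \<omega>)" "sets (?K \<omega>) = sets borel" for \<omega>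
    using continued_prob_space[where P = P and \<sigma> = \<sigma> and \<kappa> = \<kappa> and \<omega> = \<omega>] \<kappa> by auto
  have past: "measure (?K \<omega>) F = indicator F \<omega>" if "F \<in> sets (history k)" "enat k \<le> \<sigma> \<omega>" for \<omega> F k
    by (rule continued_past[where P = P and \<sigma> = \<sigma> and \<kappa> = \<kappa> and \<omega> = \<omega>]) (use \<kappa> that in auto)
  define good where "good \<S> r \<longleftrightarrow> r \<in> borel \<rightarrow>\<^sub>M count_space UNIV \<and> (finite \<S> \<and> \<S> \<subseteq> sets borel \<longrightarrow>
      (\<forall>\<omega>\<in>D. r \<omega> \<in> D) \<and> (\<forall>S\<in>\<S>. \<forall>\<omega>. r \<omega> \<in> S \<longleftrightarrow> \<omega> \<in> S))" for \<S> and r :: "'a path \<Rightarrow> 'a path"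
  have "\<exists>r. good \<S> r" for \<S>
  proof (cases "finite \<S> \<and> \<S> \<subseteq> sets borel")
    case True
    then obtain r where "r \<in> borel \<rightarrow>\<^sub>M count_space UNIV" "\<And>\<omega>. \<omega> \<in> D \<Longrightarrow> r \<omega> \<in> D"
      "\<And>S \<omega>. S \<in> \<S> \<Longrightarrow> r \<omega> \<in> S \<longleftrightarrow> \<omega> \<in> S"
      using finite_partition_representatives[of \<S> D] by metis
    then show ?thesis unfolding good_def by blast
  next
    case False
    have "(\<lambda>_. undefined) \<in> borel \<rightarrow>\<^sub>M count_space UNIV" by simp
    with False show ?thesis unfolding good_def by blast
  qed
  then obtain r where r: "\<And>\<S>. good \<S> (r \<S>)" by metis
  have r_meas: "r \<S> \<in> borel \<rightarrow>\<^sub>M count_space UNIV" for \<S> using r[of \<S>] by (simp add: good_def)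
  have kernel: "(\<lambda>\<omega>. ?K (r \<S> \<omega>)) \<in> \<mu> \<rightarrow>\<^sub>M subprob_algebra borel" for \<S>
  proof -
    have "?K \<in> count_space UNIV \<rightarrow>\<^sub>M subprob_algebra borel"
      using Kprob by (simp add: space_subprob_algebra prob_space_imp_subprob_space)
    from measurable_compose[OF r_meas this] show ?thesis
      by (simp add: s\<mu> cong: measurable_cong_sets)
  qed
  define \<pi> where "\<pi> \<S> = \<mu> \<bind> (\<lambda>\<omega>. ?K (r \<S> \<omega>))" for \<S>
  have \<pi>: "prob_space (\<pi> \<S>)" "sets (\<pi> \<S>) = sets borel" for \<S>
    unfolding \<pi>_def using Kprob
    by (auto intro!: prob_space_bind[OF _ kernel] sets_bind simp: not_empty)
  have m\<pi>: "measure (\<pi> \<S>) A = (\<integral>\<omega>. measure (?K (r \<S> \<omega>)) A \<partial>\<mu>)" if "A \<in> sets borel" for \<S> A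
    unfolding \<pi>_def by (rule measure_bind[OF kernel that])
  have comp_meas: "(\<lambda>\<omega>. f (r \<S> \<omega>)) \<in> borel_measurable \<mu>" for f :: "'a path \<Rightarrow> real" and \<S>
    using measurable_compose[OF r_meas, of f borel \<S>] by (simp add: s\<mu> cong: measurable_cong_sets)
  have integrable_r: "integrable \<mu> (\<lambda>\<omega>. f (r \<S> \<omega>))" if "\<And>\<omega>. 0 \<le> f \<omega>" "\<And>\<omega>. f \<omega> \<le> 1"
    for f :: "'a path \<Rightarrow> real" and \<S>
    by (rule integrable_const_bound[of _ 1, OF _ comp_meas]) (simp add: that)
  have intK: "integrable \<mu> (\<lambda>\<omega>. measure (?K (r \<S> \<omega>)) A)" for \<S> A
    by (rule integrable_r) (simp_all add: prob_space.prob_le_1[OF Kprob(1)])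
  have intI: "integrable \<mu> (\<lambda>\<omega>. indicator A (r \<S> \<omega>) :: real)" for \<S> A
    by (rule integrable_r) (simp_all add: indicator_def)
  let ?\<Phi> = "finite_subsets_at_top (sets (borel :: 'a path measure))"
  have ev: "\<forall>\<^sub>F \<S> in ?\<Phi>. (\<forall>\<omega>\<in>D. r \<S> \<omega> \<in> D) \<and> (\<forall>A\<in>\<A>. \<forall>\<omega>. r \<S> \<omega> \<in> A \<longleftrightarrow> \<omega> \<in> A)"
    if "finite \<A>" "\<A> \<subseteq> sets borel" for \<A>
  proof -
    have "\<forall>\<^sub>F \<S> in ?\<Phi>. finite \<S> \<and> \<A> \<subseteq> \<S> \<and> \<S> \<subseteq> sets borel"
      unfolding eventually_finite_subsets_at_top using that by blast
    then show ?thesis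
    proof eventually_elim
      case (elim \<S>)
      then show ?case using r[of \<S>] unfolding good_def by blast
    qed
  qed
  have ind: "(\<integral>\<omega>. indicator A (r \<S> \<omega>) \<partial>\<mu>) = measure \<mu> A" if "\<forall>\<omega>. r \<S> \<omega> \<in> A \<longleftrightarrow> \<omega> \<in> A" for A \<S>
  proof -
    have "(\<lambda>\<omega>. indicator A (r \<S> \<omega>) :: real) = indicator A" using that by (auto simp: indicator_def fun_eq_iff)
    then show ?thesis by (simp add: sp\<mu>)
  qed
  obtain \<mu>' where \<mu>': "coupling_law P z \<mu>'"
    and lim: "\<And>A c. A \<in> cylinder_sets \<Longrightarrow> \<forall>\<^sub>F \<S> in ?\<Phi>. c \<le> measure (\<pi> \<S>) A \<Longrightarrow> c \<le> measure \<mu>' A"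
  proof (rule coupling_law_limit[where \<Phi> = ?\<Phi> and z = z and \<pi> = \<pi> and P = P])
    show "P \<in> borel \<rightarrow>\<^sub>M prob_algebra borel" by (rule P)
    show "?\<Phi> \<noteq> bot" by simp
    show "prob_space (\<pi> \<S>)" "sets (\<pi> \<S>) = sets borel" for \<S> by (rule \<pi>)+
  next
    fix b
    let ?A = "{\<omega>. \<omega> (0, b) \<in> {z b}}"
    have A: "?A \<in> sets (history 0)" by (rule coordinate_history) auto
    have "\<forall>\<^sub>F \<S> in ?\<Phi>. (\<forall>\<omega>\<in>D. r \<S> \<omega> \<in> D) \<and> (\<forall>A\<in>{?A}. \<forall>\<omega>. r \<S> \<omega> \<in> A \<longleftrightarrow> \<omega> \<in> A)"
      by (rule ev) (use history_borel[OF A] in auto)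
    then show "\<forall>\<^sub>F \<S> in ?\<Phi>. measure (\<pi> \<S>) {\<omega>. \<omega> (0, b) = z b} = 1"
    proof eventually_elim
      case (elim \<S>)
      have K0: "measure (?K \<omega>) ?A = indicator ?A \<omega>" for \<omega>
        by (rule past[OF A]) (simp add: zero_enat_def[symmetric])
      have "measure (\<pi> \<S>) ?A = (\<integral>\<omega>. measure (?K (r \<S> \<omega>)) ?A \<partial>\<mu>)"
        by (rule m\<pi>[OF history_borel[OF A]])
      also have "\<dots> = (\<integral>\<omega>. indicator ?A (r \<S> \<omega>) \<partial>\<mu>)" by (simp only: K0)
      also have "\<dots> = measure \<mu> ?A"
        by (rule ind[OF bspec[OF conjunct2[OF elim] insertI1]])
      finally show ?case using coupling_lawD(4)[OF \<mu>] by simp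
    qed
  next
    fix n b and F :: "'a path set" and S :: "'a set" and a
    assume F: "F \<in> sets (history n)" and S: "S \<in> sets borel"
      and a: "\<And>\<omega>. \<omega> \<in> F \<Longrightarrow> measure (P (\<omega> (n, b))) S \<le> a"
    let ?S = "{\<omega> :: 'a path. \<omega> (Suc n, b) \<in> S}" and ?W = "{\<omega>. enat n < \<sigma> \<omega>}"
    have S': "?S \<in> sets borel" "?S \<in> sets (history (Suc n))"
      using S by (auto intro: coordinate_sets coordinate_history)
    have WF: "?W \<inter> F \<in> sets (history n)" using stop F by auto
    have "measure \<mu> (?W \<inter> F \<inter> ?S) \<le> a * measure \<mu> (?W \<inter> F)"
      by (rule coupling_lawD(5)[OF \<mu> WF S]) (use a in blast)
    have "\<forall>\<^sub>F \<S> in ?\<Phi>. (\<forall>\<omega>\<in>D. r \<S> \<omega> \<in> D) \<and>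
        (\<forall>A\<in>{?W \<inter> F, ?W \<inter> F \<inter> ?S}. \<forall>\<omega>. r \<S> \<omega> \<in> A \<longleftrightarrow> \<omega> \<in> A)"
      by (rule ev) (use history_borel[OF WF] S' in auto)
    then show "\<forall>\<^sub>F \<S> in ?\<Phi>. measure (\<pi> \<S>) (F \<inter> ?S) \<le> a * measure (\<pi> \<S>) F"
    proof eventually_elim
      case (elim \<S>)
      \<comment> \<open>Before the stopping time the continued path coincides with \<open>\<omega>\<close> up to time \<open>n + 1\<close>, and the bracket is
        the contribution of \<open>\<omega>\<close> itself; afterwards the Markov property of \<open>\<kappa> \<omega>\<close> applies.\<close>
      have pt: "measure (?K \<omega>) (F \<inter> ?S)
          \<le> a * measure (?K \<omega>) F + (indicator (?W \<inter> F \<inter> ?S) \<omega> - a * indicator (?W \<inter> F) \<omega>)" for \<omega>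
      proof (cases "enat n < \<sigma> \<omega>")
        case True
        have "measure (?K \<omega>) (F \<inter> ?S) = indicator (F \<inter> ?S) \<omega>"
        proof (rule past)
          show "F \<inter> ?S \<in> sets (history (Suc n))" using S' history_mono[OF _ F, of "Suc n"] by auto
          show "enat (Suc n) \<le> \<sigma> \<omega>" using True by (simp add: Suc_ile_eq)
        qed
        moreover have "measure (?K \<omega>) F = indicator F \<omega>"
          using True by (intro past[OF F]) auto
        ultimately show ?thesis using True by (simp add: indicator_def)
      next
        case False
        then have "\<sigma> \<omega> \<le> enat n" by simp
        have "measure (?K \<omega>) (F \<inter> ?S) \<le> a * measure (?K \<omega>) F"
          by (rule continued_future[where P = P and \<sigma> = \<sigma> and \<kappa> = \<kappa> and \<omega> = \<omega>])
             (use \<kappa> F S a \<open>\<sigma> \<omega> \<le> enat n\<close> in auto)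
        with False show ?thesis by (simp add: indicator_def)
      qed
      have "measure (\<pi> \<S>) (F \<inter> ?S) = (\<integral>\<omega>. measure (?K (r \<S> \<omega>)) (F \<inter> ?S) \<partial>\<mu>)"
        using history_borel[OF F] S' by (intro m\<pi>) auto
      also have "\<dots> \<le> (\<integral>\<omega>. a * measure (?K (r \<S> \<omega>)) F
          + (indicator (?W \<inter> F \<inter> ?S) (r \<S> \<omega>) - a * indicator (?W \<inter> F) (r \<S> \<omega>)) \<partial>\<mu>)"
        by (intro integral_mono pt intK Bochner_Integration.integrable_add integrable_mult_right
            Bochner_Integration.integrable_diff intI)
      also have "\<dots> = a * (\<integral>\<omega>. measure (?K (r \<S> \<omega>)) F \<partial>\<mu>)
          + ((\<integral>\<omega>. indicator (?W \<inter> F \<inter> ?S) (r \<S> \<omega>) \<partial>\<mu>) - a * (\<integral>\<omega>. indicator (?W \<inter> F) (r \<S> \<omega>) \<partial>\<mu>))"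
        by (simp only: Bochner_Integration.integral_add Bochner_Integration.integral_diff integral_mult_right_zero
            intK intI integrable_mult_right Bochner_Integration.integrable_diff)
      also have "(\<integral>\<omega>. indicator (?W \<inter> F \<inter> ?S) (r \<S> \<omega>) \<partial>\<mu>) = measure \<mu> (?W \<inter> F \<inter> ?S)"
        by (rule ind[OF bspec[OF conjunct2[OF elim] insertI2[OF insertI1]]])
      also have "(\<integral>\<omega>. indicator (?W \<inter> F) (r \<S> \<omega>) \<partial>\<mu>) = measure \<mu> (?W \<inter> F)"
        by (rule ind[OF bspec[OF conjunct2[OF elim] insertI1]])
      also have "(\<integral>\<omega>. measure (?K (r \<S> \<omega>)) F \<partial>\<mu>) = measure (\<pi> \<S>) F"
        using history_borel[OF F] by (intro m\<pi>[symmetric])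
      finally show ?case
        using \<open>measure \<mu> (?W \<inter> F \<inter> ?S) \<le> a * measure \<mu> (?W \<inter> F)\<close> by simp
    qed
  qed blast
  have lower: "c * a \<le> measure \<mu>' A"
    if A: "A \<in> cylinder_sets" and E: "E \<in> sets borel" and c: "0 \<le> c"
      and D': "D' = D \<or> D' = UNIV" and K: "\<And>\<omega>. \<omega> \<in> E \<Longrightarrow> \<omega> \<in> D' \<Longrightarrow> c \<le> measure (?K \<omega>) A"
      and U: "\<And>U. U \<in> sets borel \<Longrightarrow> D' \<subseteq> U \<Longrightarrow> a \<le> measure \<mu> (E \<inter> U)" for A E c a D'
  proof (rule lim[OF A])
    have "\<forall>\<^sub>F \<S> in ?\<Phi>. (\<forall>\<omega>\<in>D. r \<S> \<omega> \<in> D) \<and> (\<forall>A\<in>{E}. \<forall>\<omega>. r \<S> \<omega> \<in> A \<longleftrightarrow> \<omega> \<in> A)"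
      by (rule ev) (use E in auto)
    then show "\<forall>\<^sub>F \<S> in ?\<Phi>. c * a \<le> measure (\<pi> \<S>) A"
    proof eventually_elim
      case (elim \<S>)
      let ?U = "{\<omega>. r \<S> \<omega> \<in> D'}"
      have Ub: "?U \<in> sets borel"
        using measurable_sets[OF r_meas[of \<S>], of D'] by (simp add: vimage_def)
      have EU: "E \<inter> ?U \<in> sets \<mu>" using E Ub by (simp add: s\<mu>)
      have "a \<le> measure \<mu> (E \<inter> ?U)" by (rule U[OF Ub]) (use elim D' in auto)
      then have "c * a \<le> c * measure \<mu> (E \<inter> ?U)" using c by (intro mult_left_mono)
      also have "\<dots> = (\<integral>\<omega>. c * indicator (E \<inter> ?U) \<omega> \<partial>\<mu>)" by (simp add: sp\<mu>)
      also have "\<dots> \<le> (\<integral>\<omega>. measure (?K (r \<S> \<omega>)) A \<partial>\<mu>)"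
      proof (rule integral_mono[OF _ intK])
        show "integrable \<mu> (\<lambda>\<omega>. c * indicator (E \<inter> ?U) \<omega>)"
          using EU by (intro integrable_mult_right integrable_real_indicator) (auto simp: emeasure_eq_measure)
        show "c * indicator (E \<inter> ?U) \<omega> \<le> measure (?K (r \<S> \<omega>)) A" for \<omega>
          using K[of "r \<S> \<omega>"] elim by (auto simp: indicator_def)
      qed
      also have "\<dots> = measure (\<pi> \<S>) A" using cylinder_sets_borel[OF A] by (rule m\<pi>[symmetric])
      finally show ?case .
    qed
  qed
  show ?thesis
  proof (intro exI[of _ \<mu>'] conjI \<mu>' ballI allI impI)
    fix A E and c :: real
    assume "A \<in> cylinder_sets" "E \<in> sets borel" "0 \<le> c" "\<forall>\<omega>\<in>E. c \<le> measure (?K \<omega>) A"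
    moreover have "measure \<mu> E \<le> measure \<mu> (E \<inter> U)" if "UNIV \<subseteq> U" for U
      using top_le[OF that] by simp
    ultimately show "c * measure \<mu> E \<le> measure \<mu>' A" by (intro lower[of A E c UNIV]) auto
  next
    fix A E and c a :: real
    assume "A \<in> cylinder_sets" "E \<in> sets borel" "0 \<le> c" "\<forall>\<omega>\<in>E \<inter> D. c \<le> measure (?K \<omega>) A"
      "\<forall>U\<in>sets borel. D \<subseteq> U \<longrightarrow> a \<le> measure \<mu> (E \<inter> U)"
    then show "c * a \<le> measure \<mu>' A" by (intro lower[of A E c D]) auto
  qed
qed

section \<open>Independent copies\<close>

text \<open>Two independent samples of one coupling, the first chain being read off from the first sample and
  the second chain from the other, are two independent Markov chains with the right starting points.\<close>

definition interleave :: "'a path \<Rightarrow> 'a path \<Rightarrow> 'a path" where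
  "interleave \<omega> \<omega>' = (\<lambda>(k, b). if b then \<omega> (k, b) else \<omega>' (k, b))"

lemma interleave_simps [simp]:
  "interleave \<omega> \<omega>' (k, True) = \<omega> (k, True)" "interleave \<omega> \<omega>' (k, False) = \<omega>' (k, False)"
  by (simp_all add: interleave_def)

lemma interleave_history:
  assumes F: "F \<in> sets (history n)"
  shows "{\<omega>. interleave \<omega> \<omega>' \<in> F} \<in> sets (history n)" "{\<omega>'. interleave \<omega> \<omega>' \<in> F} \<in> sets (history n)"
proof -
  have triv: "{\<omega>::'a path. Q} \<in> sets (history n)" for Q
    using sets.top[of "history n :: 'a path measure"] by (cases Q) auto
  have *: "(\<lambda>\<omega>. interleave \<omega> \<omega>') \<in> history n \<rightarrow>\<^sub>M history n \<and> interleave \<omega> \<in> history n \<rightarrow>\<^sub>M history n"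
  proof (intro conjI measurable_sigma_sets[OF sets_history])
    fix A assume "A \<in> {{\<omega>::'a path. \<omega> (k, b) \<in> S} | k b S. k \<le> n \<and> S \<in> sets borel}"
    then obtain k b S where A: "A = {\<omega>. \<omega> (k, b) \<in> S}" "k \<le> n" "S \<in> sets borel" by blast
    show "(\<lambda>\<omega>. interleave \<omega> \<omega>') -` A \<inter> space (history n) \<in> sets (history n)"
      unfolding A using coordinate_history[OF A(2,3)] triv by (cases b) (simp_all add: vimage_def)
    show "interleave \<omega> -` A \<inter> space (history n) \<in> sets (history n)"
      unfolding A using coordinate_history[OF A(2,3)] triv by (cases b) (simp_all add: vimage_def)
  qed auto
  from measurable_sets[OF conjunct1[OF *] F] measurable_sets[OF conjunct2[OF *] F]
  show "{\<omega>. interleave \<omega> \<omega>' \<in> F} \<in> sets (history n)" "{\<omega>'. interleave \<omega> \<omega>' \<in> F} \<in> sets (history n)"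
    by (simp_all add: vimage_def)
qed

text \<open>Stated for either order of integration, so that the step of one chain can be bounded while the path
  of the other chain is held fixed.\<close>

lemma pair_measure_le_of_sections:
  assumes M1: "prob_space M1" and M2: "prob_space M2"
    and A: "A \<in> sets (M1 \<Otimes>\<^sub>M M2)" and B: "B \<in> sets (M1 \<Otimes>\<^sub>M M2)" and a: "0 \<le> a"
    and le: "(\<forall>y. measure M1 ((\<lambda>x. (x, y)) -` A) \<le> a * measure M1 ((\<lambda>x. (x, y)) -` B)) \<or>
      (\<forall>x. measure M2 (Pair x -` A) \<le> a * measure M2 (Pair x -` B))"
  shows "measure (M1 \<Otimes>\<^sub>M M2) A \<le> a * measure (M1 \<Otimes>\<^sub>M M2) B"
proof -
  interpret M1: prob_space M1 by fact
  interpret M2: prob_space M2 by fact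
  interpret pair_prob_space M1 M2 ..
  have "emeasure (M1 \<Otimes>\<^sub>M M2) A \<le> ennreal a * emeasure (M1 \<Otimes>\<^sub>M M2) B"
    using le
  proof
    assume le: "\<forall>y. measure M1 ((\<lambda>x. (x, y)) -` A) \<le> a * measure M1 ((\<lambda>x. (x, y)) -` B)"
    have "emeasure (M1 \<Otimes>\<^sub>M M2) A = (\<integral>\<^sup>+y. emeasure M1 ((\<lambda>x. (x, y)) -` A) \<partial>M2)"
      by (rule emeasure_pair_measure_alt2[OF A])
    also have "\<dots> \<le> (\<integral>\<^sup>+y. ennreal a * emeasure M1 ((\<lambda>x. (x, y)) -` B) \<partial>M2)"
      using le a by (intro nn_integral_mono) (simp add: M1.emeasure_eq_measure ennreal_mult'[symmetric] ennreal_leI)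
    also have "\<dots> = ennreal a * emeasure (M1 \<Otimes>\<^sub>M M2) B"
      by (simp add: nn_integral_cmult measurable_emeasure_Pair2[OF B] emeasure_pair_measure_alt2[OF B])
    finally show ?thesis .
  next
    assume le: "\<forall>x. measure M2 (Pair x -` A) \<le> a * measure M2 (Pair x -` B)"
    have "emeasure (M1 \<Otimes>\<^sub>M M2) A = (\<integral>\<^sup>+x. emeasure M2 (Pair x -` A) \<partial>M1)"
      by (rule M2.emeasure_pair_measure_alt[OF A])
    also have "\<dots> \<le> (\<integral>\<^sup>+x. ennreal a * emeasure M2 (Pair x -` B) \<partial>M1)"
      using le a by (intro nn_integral_mono) (simp add: M2.emeasure_eq_measure ennreal_mult'[symmetric] ennreal_leI)
    also have "\<dots> = ennreal a * emeasure (M1 \<Otimes>\<^sub>M M2) B"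
      by (simp add: nn_integral_cmult M2.measurable_emeasure_Pair[OF B] M2.emeasure_pair_measure_alt[OF B])
    finally show ?thesis .
  qed
  then show ?thesis
    using a by (simp add: emeasure_eq_measure ennreal_mult'[symmetric])
qed

definition independent_paths :: "'a::polish_space path measure \<Rightarrow> 'a path measure" where
  "independent_paths \<mu> = distr (\<mu> \<Otimes>\<^sub>M \<mu>) borel (\<lambda>(\<omega>, \<omega>'). interleave \<omega> \<omega>')"

context
  fixes P :: "'a::polish_space \<Rightarrow> 'a measure" and z \<mu>
  assumes P: "P \<in> borel \<rightarrow>\<^sub>M prob_algebra borel" and \<mu>: "coupling_law P z \<mu>"
begin

lemma measurable_interleave: "(\<lambda>(\<omega>, \<omega>'). interleave \<omega> \<omega>') \<in> \<mu> \<Otimes>\<^sub>M \<mu> \<rightarrow>\<^sub>M borel"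
proof (rule measurable_coordinatewise_then_product)
  fix i :: "nat \<times> bool"
  have "(\<lambda>\<omega>. \<omega> i) \<in> borel_measurable \<mu>"
    unfolding measurable_cong_sets[OF coupling_lawD(2)[OF \<mu>] refl] by (rule measurable_coordinate)
  from measurable_compose[OF measurable_fst this] measurable_compose[OF measurable_snd this]
  show "(\<lambda>p. (case p of (\<omega>, \<omega>') \<Rightarrow> interleave \<omega> \<omega>') i) \<in> borel_measurable (\<mu> \<Otimes>\<^sub>M \<mu>)"
    by (cases i; cases "snd i") (simp_all add: interleave_def case_prod_beta)
qed

lemma measure_independent_paths:
  assumes "F \<in> sets borel"
  shows "measure (independent_paths \<mu>) F = measure (\<mu> \<Otimes>\<^sub>M \<mu>) {(\<omega>, \<omega>'). interleave \<omega> \<omega>' \<in> F}"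
    and "{(\<omega>, \<omega>'). interleave \<omega> \<omega>' \<in> F} \<in> sets (\<mu> \<Otimes>\<^sub>M \<mu>)"
proof -
  have eq: "(\<lambda>(\<omega>, \<omega>'). interleave \<omega> \<omega>') -` F \<inter> space (\<mu> \<Otimes>\<^sub>M \<mu>) = {(\<omega>, \<omega>'). interleave \<omega> \<omega>' \<in> F}"
    by (auto simp: space_pair_measure coupling_lawD(3)[OF \<mu>])
  show "measure (independent_paths \<mu>) F = measure (\<mu> \<Otimes>\<^sub>M \<mu>) {(\<omega>, \<omega>'). interleave \<omega> \<omega>' \<in> F}"
    unfolding independent_paths_def measure_distr[OF measurable_interleave assms] eq ..
  show "{(\<omega>, \<omega>'). interleave \<omega> \<omega>' \<in> F} \<in> sets (\<mu> \<Otimes>\<^sub>M \<mu>)"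
    using measurable_sets[OF measurable_interleave assms] unfolding eq .
qed

lemma measure_independent_rectangle:
  assumes A: "A \<in> sets borel" and B: "B \<in> sets borel"
  shows "measure (independent_paths \<mu>) ({\<omega>. \<omega> (n, True) \<in> A} \<inter> {\<omega>. \<omega> (n, False) \<in> B})
    = measure \<mu> {\<omega>. \<omega> (n, True) \<in> A} * measure \<mu> {\<omega>. \<omega> (n, False) \<in> B}"
proof -
  interpret prob_space \<mu> by (rule coupling_lawD[OF \<mu>])
  let ?A = "{\<omega> :: 'a path. \<omega> (n, True) \<in> A}" and ?B = "{\<omega> :: 'a path. \<omega> (n, False) \<in> B}"
  have AB: "?A \<in> sets \<mu>" "?B \<in> sets \<mu>"
    using coordinate_sets[OF A] coordinate_sets[OF B] by (auto simp: coupling_lawD[OF \<mu>])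
  have "{(\<omega>, \<omega>'). interleave \<omega> \<omega>' \<in> ?A \<inter> ?B} = ?A \<times> ?B" by auto
  moreover have "measure (\<mu> \<Otimes>\<^sub>M \<mu>) (?A \<times> ?B) = measure \<mu> ?A * measure \<mu> ?B"
    using emeasure_pair_measure_Times[OF AB] by (simp add: measure_def enn2real_mult)
  ultimately show ?thesis
    using measure_independent_paths(1)[OF sets.Int[OF coordinate_sets[OF A] coordinate_sets[OF B]]] by simp
qed

lemma coupling_law_independent: "coupling_law P z (independent_paths \<mu>)"
  unfolding coupling_law_def
proof (intro conjI allI impI)
  interpret prob_space \<mu> by (rule coupling_lawD[OF \<mu>])
  have "measure \<mu> UNIV = 1" using prob_space by (simp add: coupling_lawD(3)[OF \<mu>])
  then show "measure (independent_paths \<mu>) {\<omega>. \<omega> (0, b) = z b} = 1" for b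
    using measure_independent_rectangle[of "{z True}" UNIV 0] measure_independent_rectangle[of UNIV "{z False}" 0]
      coupling_lawD(4)[OF \<mu>]
    by (cases b) simp_all
  interpret pair_prob_space \<mu> \<mu> ..
  show "prob_space (independent_paths \<mu>)"
    unfolding independent_paths_def by (rule P.prob_space_distr[OF measurable_interleave])
  show "sets (independent_paths \<mu>) = sets borel" by (simp add: independent_paths_def)
next
  interpret prob_space \<mu> by (rule coupling_lawD[OF \<mu>])
  fix n b and F :: "'a path set" and S :: "'a set" and a
  assume F: "F \<in> sets (history n)" and S: "S \<in> sets borel" and a: "\<forall>\<omega>\<in>F. measure (P (\<omega> (n, b))) S \<le> a"
  let ?S = "{\<omega> :: 'a path. \<omega> (Suc n, b) \<in> S}"
  let ?I = "\<lambda>F. {(\<omega>, \<omega>'). interleave \<omega> \<omega>' \<in> F}"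
  have FS: "F \<inter> ?S \<in> sets borel" by (rule sets.Int[OF history_borel[OF F] coordinate_sets[OF S]])
  show "measure (independent_paths \<mu>) (F \<inter> ?S) \<le> a * measure (independent_paths \<mu>) F"
  proof (cases "F = {}")
    case False
    then have a0: "0 \<le> a" using a measure_nonneg order_trans by blast
    have "measure (\<mu> \<Otimes>\<^sub>M \<mu>) (?I (F \<inter> ?S)) \<le> a * measure (\<mu> \<Otimes>\<^sub>M \<mu>) (?I F)"
    proof (rule pair_measure_le_of_sections[OF prob_space_axioms prob_space_axioms
          measure_independent_paths(2)[OF FS] measure_independent_paths(2)[OF history_borel[OF F]] a0])
      show "(\<forall>\<omega>'. measure \<mu> ((\<lambda>\<omega>. (\<omega>, \<omega>')) -` ?I (F \<inter> ?S)) \<le> a * measure \<mu> ((\<lambda>\<omega>. (\<omega>, \<omega>')) -` ?I F)) \<or>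
        (\<forall>\<omega>. measure \<mu> (Pair \<omega> -` ?I (F \<inter> ?S)) \<le> a * measure \<mu> (Pair \<omega> -` ?I F))"
      proof (cases b)
        case True
        have "measure \<mu> ({\<omega>. interleave \<omega> \<omega>' \<in> F} \<inter> ?S) \<le> a * measure \<mu> {\<omega>. interleave \<omega> \<omega>' \<in> F}" for \<omega>'
        proof (rule coupling_lawD(5)[OF \<mu> interleave_history(1)[OF F] S])
          fix \<omega> assume "\<omega> \<in> {\<omega>. interleave \<omega> \<omega>' \<in> F}"
          then show "measure (P (\<omega> (n, b))) S \<le> a"
            using bspec[OF a, of "interleave \<omega> \<omega>'"] True by simp
        qed
        moreover have "(\<lambda>\<omega>. (\<omega>, \<omega>')) -` ?I (F \<inter> ?S) = {\<omega>. interleave \<omega> \<omega>' \<in> F} \<inter> ?S"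
          "(\<lambda>\<omega>. (\<omega>, \<omega>')) -` ?I F = {\<omega>. interleave \<omega> \<omega>' \<in> F}" for \<omega>'
          using True by auto
        ultimately show ?thesis by (simp only: simp_thms)
      next
        case False
        have "measure \<mu> ({\<omega>'. interleave \<omega> \<omega>' \<in> F} \<inter> ?S) \<le> a * measure \<mu> {\<omega>'. interleave \<omega> \<omega>' \<in> F}" for \<omega>
        proof (rule coupling_lawD(5)[OF \<mu> interleave_history(2)[OF F] S])
          fix \<omega>' assume "\<omega>' \<in> {\<omega>'. interleave \<omega> \<omega>' \<in> F}"
          then show "measure (P (\<omega>' (n, b))) S \<le> a"
            using bspec[OF a, of "interleave \<omega> \<omega>'"] False by simp
        qed
        moreover have "Pair \<omega> -` ?I (F \<inter> ?S) = {\<omega>'. interleave \<omega> \<omega>' \<in> F} \<inter> ?S"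
          "Pair \<omega> -` ?I F = {\<omega>'. interleave \<omega> \<omega>' \<in> F}" for \<omega>
          using False by auto
        ultimately show ?thesis by (simp only: simp_thms)
      qed
    qed
    then show ?thesis
      by (simp only: measure_independent_paths(1)[OF FS] measure_independent_paths(1)[OF history_borel[OF F]])
  qed simp
qed

end

section \<open>Repeated attempts to reach a rectangle\<close>

definition hit_by :: "'a set \<Rightarrow> 'a set \<Rightarrow> nat \<Rightarrow> 'a path set" where
  "hit_by A B n = {\<omega>. \<exists>k\<le>n. \<omega> (k, True) \<in> A \<and> \<omega> (k, False) \<in> B}"

lemma hit_by_mono: "m \<le> n \<Longrightarrow> hit_by A B m \<subseteq> hit_by A B n"
  unfolding hit_by_def by (auto intro: order_trans)

lemma hit_by_0: "hit_by A B 0 = {\<omega>. \<omega> (0, True) \<in> A} \<inter> {\<omega>. \<omega> (0, False) \<in> B}"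
  unfolding hit_by_def by auto

lemma hit_by_Suc:
  "hit_by A B (Suc n) = hit_by A B n \<union> {\<omega>. \<omega> (Suc n, True) \<in> A} \<inter> {\<omega>. \<omega> (Suc n, False) \<in> B}"
  unfolding hit_by_def by (auto simp: le_Suc_eq)

lemma hit_by_history:
  assumes "A \<in> sets borel" "B \<in> sets borel"
  shows "hit_by A B n \<in> sets (history n)"
proof (induction n)
  case 0
  show ?case unfolding hit_by_0 by (intro sets.Int coordinate_history assms) simp_all
next
  case (Suc n)
  show ?case
    unfolding hit_by_Suc using history_mono[OF _ Suc, of "Suc n"]
    by (intro sets.Un sets.Int coordinate_history assms) simp_all
qed

lemma hit_by_cylinder:
  assumes "A \<in> sets borel" "B \<in> sets borel"
  shows "hit_by A B n \<in> cylinder_sets"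
proof (induction n)
  case 0
  show ?case unfolding hit_by_0 by (intro cylinder_sets_Int cylinder_sets.coordinate assms)
next
  case (Suc n)
  then show ?case
    unfolding hit_by_Suc by (intro cylinder_sets.union cylinder_sets_Int cylinder_sets.coordinate assms)
qed

lemmas hit_by_borel = history_borel[OF hit_by_history]

text \<open>If every \<open>D n\<close> had a Borel hull \<open>U n\<close> with small trace on \<open>E\<close>, the sets \<open>\<Inter>k\<ge>n. U k\<close> would still cover \<open>D n\<close>, but
  increase with \<open>n\<close>, and their union, the whole space, would have a small trace on \<open>E\<close> as well.\<close>

lemma outer_measure_continuity:
  fixes \<mu> :: "'w::topological_space measure"
  assumes \<mu>: "prob_space \<mu>" "sets \<mu> = sets borel" and D: "incseq D" "(\<Union>n. D n) = UNIV"
    and E: "E \<in> sets borel" and a: "a < measure \<mu> E"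
  obtains n :: nat where "\<And>U. U \<in> sets borel \<Longrightarrow> D n \<subseteq> U \<Longrightarrow> a \<le> measure \<mu> (E \<inter> U)"
proof (rule ccontr)
  interpret prob_space \<mu> by fact
  assume "\<not> thesis"
  then have "\<forall>n. \<exists>U. U \<in> sets borel \<and> D n \<subseteq> U \<and> measure \<mu> (E \<inter> U) < a"
    using that by (meson not_le)
  then obtain U where U: "\<And>n. U n \<in> sets borel" "\<And>n. D n \<subseteq> U n" "\<And>n. measure \<mu> (E \<inter> U n) < a"
    by metis
  define V where "V n = E \<inter> (\<Inter>k\<in>{n..}. U k)" for n
  have V: "V n \<in> sets \<mu>" for n
    unfolding V_def \<mu>(2) by (intro sets.Int E sets.countable_INT') (use U in auto)
  have "incseq V" unfolding V_def incseq_def by auto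
  have DV: "E \<inter> D n \<subseteq> V n" for n
  proof -
    have "D n \<subseteq> U k" if "n \<le> k" for k using incseqD[OF D(1) that] U(2)[of k] by blast
    then show ?thesis unfolding V_def by blast
  qed
  have "(\<Union>n. V n) = E"
  proof
    show "(\<Union>n. V n) \<subseteq> E" unfolding V_def by blast
    show "E \<subseteq> (\<Union>n. V n)"
    proof
      fix \<omega> assume "\<omega> \<in> E"
      moreover obtain n where "\<omega> \<in> D n" using D(2) by blast
      ultimately show "\<omega> \<in> (\<Union>n. V n)" using DV[of n] by blast
    qed
  qed
  moreover have "(\<lambda>n. measure \<mu> (V n)) \<longlonglongrightarrow> measure \<mu> (\<Union>n. V n)"
    using V \<open>incseq V\<close> by (intro finite_Lim_measure_incseq) auto
  moreover have "measure \<mu> (V n) \<le> a" for n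
  proof -
    have "measure \<mu> (V n) \<le> measure \<mu> (E \<inter> U n)"
      using E U(1) by (intro finite_measure_mono) (auto simp: V_def \<mu>(2))
    with U(3)[of n] show ?thesis by simp
  qed
  ultimately have "measure \<mu> E \<le> a" by (intro LIMSEQ_le_const2) auto
  with a show False by simp
qed

text \<open>One attempt: continue a coupling that hits \<open>C \<times> C\<close> at its hitting time \<open>\<sigma>\<close> by independent copies, which
  are in \<open>A \<times> B\<close> after another \<open>N\<close> steps with probability at least \<open>\<epsilon>\<^sup>2\<close>. The factor \<open>1/2\<close> pays for a
  deterministic bound \<open>n\<close> on the hitting time, which depends on the starting point.\<close>

lemma hit_by_positive:
  fixes P :: "'a::polish_space \<Rightarrow> 'a measure"
  assumes P: "P \<in> borel \<rightarrow>\<^sub>M prob_algebra borel" and C: "C \<in> sets borel"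
    and ach: "achievable P (C \<times> C)" and A: "A \<in> sets borel" and B: "B \<in> sets borel" and \<epsilon>: "0 \<le> \<epsilon>"
    and CA: "\<And>x. x \<in> C \<Longrightarrow> \<epsilon> \<le> measure (kernel_power P N x) A"
    and CB: "\<And>x. x \<in> C \<Longrightarrow> \<epsilon> \<le> measure (kernel_power P N x) B"
  shows "\<exists>\<rho> n. coupling_law P z \<rho> \<and> \<epsilon>\<^sup>2 / 2 \<le> measure \<rho> (hit_by A B n)"
proof -
  have "\<exists>\<mu>. coupling_law P z \<mu> \<and> (AE \<omega> in \<mu>. \<exists>n. \<omega> (n, True) \<in> C \<and> \<omega> (n, False) \<in> C)" for z
    by (rule achievable_imp_coupling_law[OF P ach C, of z]) blast
  then have "\<exists>Q. \<forall>z. coupling_law P z (Q z) \<and> (AE \<omega> in Q z. \<exists>n. \<omega> (n, True) \<in> C \<and> \<omega> (n, False) \<in> C)"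
    by (intro choice allI)
  then obtain Q where Q: "\<And>z. coupling_law P z (Q z)"
    "\<And>z. AE \<omega> in Q z. \<exists>n. \<omega> (n, True) \<in> C \<and> \<omega> (n, False) \<in> C" by blast
  let ?\<mu> = "Q z"
  interpret prob_space ?\<mu> by (rule coupling_lawD[OF Q(1)])
  have hb: "hit_by C C n \<in> sets ?\<mu>" for n using hit_by_borel[OF C C] by (simp add: coupling_lawD[OF Q(1)])
  have "(\<lambda>n. measure ?\<mu> (hit_by C C n)) \<longlonglongrightarrow> measure ?\<mu> (\<Union>n. hit_by C C n)"
    using hb by (intro finite_Lim_measure_incseq) (auto simp: incseq_def intro: hit_by_mono[THEN subsetD])
  also have "measure ?\<mu> (\<Union>n. hit_by C C n) = 1"
  proof (rule prob_eq_1[THEN iffD2])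
    show "AE \<omega> in ?\<mu>. \<omega> \<in> (\<Union>n. hit_by C C n)"
      using Q(2)[of z] unfolding hit_by_def by eventually_elim blast
  qed (use hb in auto)
  finally have "\<forall>\<^sub>F n in sequentially. 1/2 < measure ?\<mu> (hit_by C C n)"
    by (rule order_tendstoD) simp
  from eventually_happens'[OF sequentially_bot this]
  obtain n where n: "1/2 < measure ?\<mu> (hit_by C C n)" by (rule exE)
  define \<sigma> where "\<sigma> \<omega> = (INF k\<in>{k. \<omega> (k, True) \<in> C \<and> \<omega> (k, False) \<in> C}. enat k)" for \<omega> :: "'a path"
  have \<sigma>: "\<sigma> \<omega> \<le> enat k \<longleftrightarrow> \<omega> \<in> hit_by C C k" for \<omega> k
  proof -
    have "\<sigma> \<omega> \<le> enat k \<longleftrightarrow> \<sigma> \<omega> < enat (Suc k)"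
      by (cases "\<sigma> \<omega>") auto
    also have "\<dots> \<longleftrightarrow> \<omega> \<in> hit_by C C k"
      unfolding \<sigma>_def Inf_less_iff hit_by_def by (auto simp: less_Suc_eq_le)
    finally show ?thesis .
  qed
  have \<sigma>C: "\<omega> (s, b) \<in> C" if "\<sigma> \<omega> = enat s" for \<omega> s b
  proof -
    have "\<omega> \<in> hit_by C C s" using that \<sigma>[of \<omega> s] by simp
    then obtain k where k: "k \<le> s" "\<omega> (k, True) \<in> C" "\<omega> (k, False) \<in> C" unfolding hit_by_def by blast
    then have "\<sigma> \<omega> \<le> enat k" using \<sigma>[of \<omega> k] unfolding hit_by_def by blast
    with that k have "k = s" by simp
    with k show ?thesis by (cases b) auto
  qed
  \<comment> \<open>Where \<open>\<sigma>\<close> is infinite, \<open>the_enat\<close> is unspecified, but there \<open>continued\<close> keeps the path as it is.\<close>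
  define \<kappa> where "\<kappa> \<omega> = independent_paths (Q (\<lambda>b. \<omega> (the_enat (\<sigma> \<omega>), b)))" for \<omega>
  have \<kappa>: "coupling_law P (\<lambda>b. \<omega> (s, b)) (\<kappa> \<omega>)" if "\<sigma> \<omega> = enat s" for \<omega> s
    unfolding \<kappa>_def using coupling_law_independent[OF P Q(1)] that by simp
  then have restart: "\<forall>\<omega> s. \<sigma> \<omega> = enat s \<longrightarrow> coupling_law P (\<lambda>b. \<omega> (s, b)) (\<kappa> \<omega>)" by blast
  have "{\<omega>. enat k < \<sigma> \<omega>} = UNIV - hit_by C C k" for k
    by (rule set_eqI) (simp only: mem_Collect_eq Diff_iff UNIV_I \<sigma>[symmetric] not_le simp_thms)
  then have stop: "{\<omega>. enat k < \<sigma> \<omega>} \<in> sets (history k)" for k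
    using sets.compl_sets[OF hit_by_history[OF C C]] by simp
  obtain \<rho> where \<rho>: "coupling_law P z \<rho>"
    and lower: "\<forall>A\<in>cylinder_sets. \<forall>E\<in>sets borel. \<forall>c\<ge>0.
      (\<forall>\<omega>\<in>E. c \<le> measure (continued \<sigma> \<kappa> \<omega>) A) \<longrightarrow> c * measure ?\<mu> E \<le> measure \<rho> A"
    using coupling_law_continue[OF P Q(1)[of z] stop restart, of UNIV] by (elim exE conjE)
  have "\<epsilon>\<^sup>2 \<le> measure (continued \<sigma> \<kappa> \<omega>) (hit_by A B (n + N))" if "\<omega> \<in> hit_by C C n" for \<omega>
  proof -
    have "\<sigma> \<omega> \<le> enat n" using that \<sigma> by simp
    then obtain s where s: "\<sigma> \<omega> = enat s" "s \<le> n" by (cases "\<sigma> \<omega>") auto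
    let ?z = "\<lambda>b. \<omega> (s, b)"
    let ?R = "{\<omega>'. \<omega>' (N, True) \<in> A} \<inter> {\<omega>'. \<omega>' (N, False) \<in> B}"
    interpret \<kappa>: prob_space "\<kappa> \<omega>" by (rule coupling_lawD[OF \<kappa>[OF s(1)]])
    have "\<epsilon> * \<epsilon> \<le> measure (kernel_power P N (?z True)) A * measure (kernel_power P N (?z False)) B"
      using CA[OF \<sigma>C[OF s(1)]] CB[OF \<sigma>C[OF s(1)]] \<epsilon> by (intro mult_mono) auto
    also have "\<dots> = measure (\<kappa> \<omega>) ?R"
      using s measure_independent_rectangle[OF P Q(1) A B, of ?z N] coupling_law_marginal[OF P Q(1)[of ?z] A, of N True]
        coupling_law_marginal[OF P Q(1)[of ?z] B, of N False]
      by (simp add: \<kappa>_def)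
    also have "\<dots> \<le> measure (\<kappa> \<omega>) (path_append s \<omega> -` hit_by A B (n + N))"
    proof (rule \<kappa>.finite_measure_mono)
      show "?R \<subseteq> path_append s \<omega> -` hit_by A B (n + N)"
      proof
        fix \<omega>' assume "\<omega>' \<in> ?R"
        then have "path_append s \<omega> \<omega>' (s + N, True) \<in> A \<and> path_append s \<omega> \<omega>' (s + N, False) \<in> B"
          by (simp add: path_append_def)
        moreover have "s + N \<le> n + N" using s by simp
        ultimately show "\<omega>' \<in> path_append s \<omega> -` hit_by A B (n + N)" unfolding hit_by_def by blast
      qed
      have "path_append s \<omega> -` hit_by A B (n + N) \<inter> space borel \<in> sets borel"
        by (rule measurable_sets[OF path_append_measurable hit_by_borel[OF A B]])
      then show "path_append s \<omega> -` hit_by A B (n + N) \<in> sets (\<kappa> \<omega>)"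
        by (simp add: coupling_lawD(2)[OF \<kappa>[OF s(1)]])
    qed
    also have "\<dots> = measure (continued \<sigma> \<kappa> \<omega>) (hit_by A B (n + N))"
      using measure_continued[where P = P and \<sigma> = \<sigma> and \<kappa> = \<kappa> and \<omega> = \<omega> and s = s and F = "hit_by A B (n + N)"]
        \<kappa> s(1) hit_by_borel[OF A B] by simp
    finally show ?thesis by (simp add: power2_eq_square)
  qed
  then have "\<epsilon>\<^sup>2 * measure ?\<mu> (hit_by C C n) \<le> measure \<rho> (hit_by A B (n + N))"
    by (intro lower[rule_format] hit_by_cylinder hit_by_borel A B C) auto
  moreover have "\<epsilon>\<^sup>2 * (1/2) \<le> \<epsilon>\<^sup>2 * measure ?\<mu> (hit_by C C n)"
    using n by (intro mult_left_mono) auto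
  ultimately show ?thesis using \<rho> by (intro exI[of _ \<rho>] exI[of _ "n + N"]) auto
qed

text \<open>One round. At the deterministic time \<open>n\<close> every path is continued by one attempt from its current
  state. An attempt started at \<open>z\<close> takes \<open>T z\<close> steps, and \<open>T\<close> may be neither bounded nor measurable. Some
  bound \<open>m\<close> is respected on a set whose outer measure within the failed paths is at least half of their
  mass \<open>e\<close>, and on that set the attempt succeeds by time \<open>n + m\<close> with probability at least \<open>c\<close>.\<close>

lemma hit_by_improve:
  fixes P :: "'a::polish_space \<Rightarrow> 'a measure"
  assumes P: "P \<in> borel \<rightarrow>\<^sub>M prob_algebra borel" and A: "A \<in> sets borel" and B: "B \<in> sets borel"
    and pos: "\<And>z. \<exists>\<rho> n. coupling_law P z \<rho> \<and> c \<le> measure \<rho> (hit_by A B n)" and c: "0 < c"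
    and \<mu>: "coupling_law P z \<mu>"
  obtains \<mu>' n' where "coupling_law P z \<mu>'" "n \<le> n'"
    "\<And>k. k \<le> n \<Longrightarrow> measure \<mu> (hit_by A B k) \<le> measure \<mu>' (hit_by A B k)"
    "1 - measure \<mu>' (hit_by A B n') \<le> (1 - c / 2) * (1 - measure \<mu> (hit_by A B n))"
proof -
  interpret prob_space \<mu> by (rule coupling_lawD[OF \<mu>])
  have s\<mu>: "sets \<mu> = sets borel" and sp\<mu>: "space \<mu> = UNIV" using coupling_lawD[OF \<mu>] by auto
  note hb = hit_by_borel[OF A B] and hc = hit_by_cylinder[OF A B]
  let ?H = "hit_by A B"
  obtain \<rho> T where \<rho>: "\<And>z. coupling_law P z (\<rho> z)" "\<And>z. c \<le> measure (\<rho> z) (?H (T z))"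
    using pos by metis
  define e where "e = measure \<mu> (- ?H n)"
  have e: "measure \<mu> (?H n) = 1 - e"
    unfolding e_def using prob_compl[of "?H n"] hb by (simp add: s\<mu> sp\<mu> Compl_eq_Diff_UNIV)
  show thesis
  proof (cases "e = 0")
    case True
    with e show thesis by (intro that[of \<mu> n] \<mu>) auto
  next
    case False
    then have e0: "e > 0" using measure_nonneg[of \<mu> "- ?H n"] unfolding e_def by linarith
    have nH: "- ?H n \<in> sets borel" using hb by (rule borel_comp)
    \<comment> \<open>The increasing sets \<open>D m\<close> exhaust path space, but need not be Borel.\<close>
    define D where "D m = {\<omega>::'a path. T (\<lambda>b. \<omega> (n, b)) \<le> m}" for m
    have "incseq D" "(\<Union>m. D m) = UNIV" unfolding D_def incseq_def by auto
    moreover have "e / 2 < measure \<mu> (- ?H n)" using e0 unfolding e_def by simp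
    ultimately obtain m where m: "\<And>U. U \<in> sets borel \<Longrightarrow> D m \<subseteq> U \<Longrightarrow> e / 2 \<le> measure \<mu> (- ?H n \<inter> U)"
      using outer_measure_continuity[OF prob_space_axioms s\<mu> _ _ nH] by metis
    define \<sigma> where "\<sigma> = (\<lambda>_::'a path. enat n)"
    define \<kappa> where "\<kappa> \<omega> = \<rho> (\<lambda>b. \<omega> (n, b))" for \<omega>
    have \<kappa>: "coupling_law P (\<lambda>b. \<omega> (s, b)) (\<kappa> \<omega>)" if "\<sigma> \<omega> = enat s" for \<omega> s
      using that \<rho>(1) unfolding \<kappa>_def \<sigma>_def by simp
    then have restart: "\<forall>\<omega> s. \<sigma> \<omega> = enat s \<longrightarrow> coupling_law P (\<lambda>b. \<omega> (s, b)) (\<kappa> \<omega>)" by blast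
    have stop: "{\<omega>. enat k < \<sigma> \<omega>} \<in> sets (history k)" for k
      using sets.top[of "history k :: 'a path measure"] by (cases "k < n") (auto simp: \<sigma>_def)
    have past: "measure (continued \<sigma> \<kappa> \<omega>) (?H k) = indicator (?H k) \<omega>" if "k \<le> n" for \<omega> k
      by (rule continued_past[where P = P]) (use \<kappa> hit_by_history[OF A B] that in \<open>auto simp: \<sigma>_def\<close>)
    obtain \<mu>' where \<mu>': "coupling_law P z \<mu>'"
      and lower: "\<forall>A\<in>cylinder_sets. \<forall>E\<in>sets borel. \<forall>c\<ge>0.
        (\<forall>\<omega>\<in>E. c \<le> measure (continued \<sigma> \<kappa> \<omega>) A) \<longrightarrow> c * measure \<mu> E \<le> measure \<mu>' A"
      and lowerD: "\<forall>A\<in>cylinder_sets. \<forall>E\<in>sets borel. \<forall>c\<ge>0. \<forall>a.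
        (\<forall>\<omega>\<in>E \<inter> D m. c \<le> measure (continued \<sigma> \<kappa> \<omega>) A) \<longrightarrow>
        (\<forall>U\<in>sets borel. D m \<subseteq> U \<longrightarrow> a \<le> measure \<mu> (E \<inter> U)) \<longrightarrow> c * a \<le> measure \<mu>' A"
      using coupling_law_continue[OF P \<mu> stop restart, of "D m"] by (elim exE conjE)
    have keep: "measure \<mu> (?H k) \<le> measure \<mu>' (?H k)" if "k \<le> n" for k
      using lower[rule_format, OF hc hb, of 1 k k] past[OF that] by simp
    have new: "c * (e / 2) \<le> measure \<mu>' (?H (n + m) \<inter> - ?H n)"
    proof (rule lowerD[rule_format, OF _ nH])
      show "?H (n + m) \<inter> - ?H n \<in> cylinder_sets"
        by (intro cylinder_sets_Int cylinder_sets.complement hc)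
    next
      fix \<omega> assume "\<omega> \<in> - ?H n \<inter> D m"
      then have \<omega>: "\<omega> \<in> - ?H n" "\<omega> \<in> D m" by auto
      let ?z = "\<lambda>b. \<omega> (n, b)" and ?K = "continued \<sigma> \<kappa> \<omega>"
      interpret K: prob_space ?K
        using continued_prob_space(1)[where P = P and \<sigma> = \<sigma> and \<kappa> = \<kappa> and \<omega> = \<omega>] \<kappa> by blast
      have sK: "sets ?K = sets borel"
        using continued_prob_space(2)[where P = P and \<sigma> = \<sigma> and \<kappa> = \<kappa> and \<omega> = \<omega>] \<kappa> by blast
      interpret R: prob_space "\<rho> ?z" by (rule coupling_lawD[OF \<rho>(1)])
      have "c \<le> measure (\<rho> ?z) (?H (T ?z))" by (rule \<rho>(2))
      also have "\<dots> \<le> measure (\<rho> ?z) (path_append n \<omega> -` ?H (n + m))"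
      proof (rule R.finite_measure_mono)
        show "?H (T ?z) \<subseteq> path_append n \<omega> -` ?H (n + m)"
        proof
          fix \<omega>' assume "\<omega>' \<in> ?H (T ?z)"
          then obtain k where k: "k \<le> T ?z" "\<omega>' (k, True) \<in> A" "\<omega>' (k, False) \<in> B"
            unfolding hit_by_def by blast
          then have "n + k \<le> n + m" using \<omega>(2) unfolding D_def by simp
          moreover have "path_append n \<omega> \<omega>' (n + k, b) = \<omega>' (k, b)" for b by (simp add: path_append_def)
          ultimately show "\<omega>' \<in> path_append n \<omega> -` ?H (n + m)"
            using k unfolding hit_by_def by (auto intro!: exI[of _ "n + k"])
        qed
        show "path_append n \<omega> -` ?H (n + m) \<in> sets (\<rho> ?z)"
          using measurable_sets[OF path_append_measurable hb, of n \<omega> "n + m"]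
          by (simp add: coupling_lawD(2)[OF \<rho>(1)])
      qed
      also have "\<dots> = measure ?K (?H (n + m))"
        using measure_continued[where P = P and \<sigma> = \<sigma> and \<kappa> = \<kappa> and \<omega> = \<omega> and s = n and F = "?H (n + m)"] \<kappa> hb
        by (simp add: \<kappa>_def \<sigma>_def)
      also have "\<dots> = measure ?K (?H (n + m) - ?H n) + measure ?K (?H n)"
        using K.finite_measure_Diff[of "?H (n + m)" "?H n"] hb hit_by_mono[of n "n + m" A B] by (simp add: sK)
      also have "measure ?K (?H n) = 0" using past[of n \<omega>] \<omega> by simp
      finally show "c \<le> measure ?K (?H (n + m) \<inter> - ?H n)" by (simp add: Diff_eq)
    qed (use c m in auto)
    interpret M': prob_space \<mu>' by (rule coupling_lawD[OF \<mu>'])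
    have "measure \<mu>' (?H (n + m)) = measure \<mu>' (?H (n + m) \<inter> - ?H n) + measure \<mu>' (?H n)"
      using M'.finite_measure_Diff[of "?H (n + m)" "?H n"] hb hit_by_mono[of n "n + m" A B]
      by (simp add: coupling_lawD(2)[OF \<mu>'] Diff_eq)
    moreover have "(1 - c / 2) * (1 - measure \<mu> (?H n)) = e - c * (e / 2)"
      unfolding e by (simp add: algebra_simps)
    moreover have "1 - e \<le> measure \<mu>' (?H n)" using keep[of n] e by simp
    ultimately have "1 - measure \<mu>' (?H (n + m)) \<le> (1 - c / 2) * (1 - measure \<mu> (?H n))"
      using new by linarith
    then show thesis using that[OF \<mu>' _ keep, of "n + m"] by simp
  qed
qed

text \<open>Iterating the rounds makes the probability of failure decay geometrically. The laws after the
  successive rounds are related only by the monotonicity of the success probabilities up to the times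
  already reached, but this is enough: a limit of them succeeds by the \<open>i\<close>-th of these times with
  probability at least \<open>1 - \<theta>\<^sup>i\<close>, for every \<open>i\<close>.\<close>

lemma hit_by_almost_surely:
  fixes P :: "'a::polish_space \<Rightarrow> 'a measure"
  assumes P: "P \<in> borel \<rightarrow>\<^sub>M prob_algebra borel" and A: "A \<in> sets borel" and B: "B \<in> sets borel"
    and pos: "\<And>z. \<exists>\<rho> n. coupling_law P z \<rho> \<and> c \<le> measure \<rho> (hit_by A B n)" and c: "0 < c"
  obtains \<mu> where "coupling_law P z \<mu>" "AE \<omega> in \<mu>. \<exists>n. \<omega> (n, True) \<in> A \<and> \<omega> (n, False) \<in> B"
proof -
  let ?H = "hit_by A B"
  have c1: "c \<le> 1"
  proof -
    obtain \<rho> n where "coupling_law P z \<rho>" "c \<le> measure \<rho> (?H n)" using pos by blast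
    then show ?thesis using prob_space.prob_le_1[OF coupling_lawD(1)] order_trans by blast
  qed
  define \<theta> where "\<theta> = 1 - c / 2"
  have \<theta>: "0 \<le> \<theta>" "\<theta> < 1" using c c1 by (auto simp: \<theta>_def)
  define S where "S p q \<longleftrightarrow> snd p \<le> snd q \<and> (\<forall>k\<le>snd p. measure (fst p) (?H k) \<le> measure (fst q) (?H k)) \<and>
     1 - measure (fst q) (?H (snd q)) \<le> \<theta> * (1 - measure (fst p) (?H (snd p)))" for p q :: "'a path measure \<times> nat"
  have "\<exists>f. \<forall>j. coupling_law P z (fst (f j)) \<and> S (f j) (f (Suc j))"
  proof (rule dependent_nat_choice)
    show "\<exists>p. coupling_law P z (fst p)" using pos[of z] by auto
  next
    fix p :: "'a path measure \<times> nat" and j :: nat assume "coupling_law P z (fst p)"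
    then obtain \<mu>' n' where "coupling_law P z \<mu>'" "snd p \<le> n'"
      "\<And>k. k \<le> snd p \<Longrightarrow> measure (fst p) (hit_by A B k) \<le> measure \<mu>' (hit_by A B k)"
      "1 - measure \<mu>' (hit_by A B n') \<le> (1 - c / 2) * (1 - measure (fst p) (hit_by A B (snd p)))"
      using hit_by_improve[OF P A B pos c, of z "fst p" "snd p"] by metis
    then show "\<exists>q. coupling_law P z (fst q) \<and> S p q"
      unfolding S_def \<theta>_def by (intro exI[of _ "(\<mu>', n')"]) simp
  qed
  then obtain f where f: "\<And>j. coupling_law P z (fst (f j))" "\<And>j. S (f j) (f (Suc j))" by blast
  define M where "M j = fst (f j)" for j
  define n where "n j = snd (f j)" for j
  have M: "coupling_law P z (M j)" for j using f unfolding M_def by blast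
  have n: "n j \<le> n (Suc j)" for j using f(2)[of j] unfolding S_def n_def by blast
  have keep: "measure (M j) (?H k) \<le> measure (M (Suc j)) (?H k)" if "k \<le> n j" for j k
    using f(2)[of j] that unfolding S_def n_def M_def by blast
  have fail: "1 - measure (M j) (?H (n j)) \<le> \<theta> ^ j" for j
  proof (induction j)
    case (Suc j)
    have "1 - measure (M (Suc j)) (?H (n (Suc j))) \<le> \<theta> * (1 - measure (M j) (?H (n j)))"
      using f(2)[of j] unfolding S_def n_def M_def by blast
    also have "\<dots> \<le> \<theta> * \<theta> ^ j" using Suc \<theta> by (intro mult_left_mono)
    finally show ?case by simp
  qed simp
  have n_mono: "n i \<le> n j" if "i \<le> j" for i j using n that by (rule lift_Suc_mono_le)
  have later: "1 - \<theta> ^ i \<le> measure (M j) (?H (n i))" if "i \<le> j" for i j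
    using that
  proof (induction j rule: dec_induct)
    case base
    show ?case using fail[of i] by simp
  next
    case (step j)
    then show ?case using keep[OF n_mono[OF step(1)]] by linarith
  qed
  obtain \<mu> where \<mu>: "coupling_law P z \<mu>"
    and lim: "\<And>A c. A \<in> cylinder_sets \<Longrightarrow> \<forall>\<^sub>F j in sequentially. c \<le> measure (M j) A \<Longrightarrow> c \<le> measure \<mu> A"
  proof (rule coupling_law_limit[where \<Phi> = sequentially and z = z and \<pi> = M and P = P])
    show "prob_space (M j)" "sets (M j) = sets borel" for j by (rule coupling_lawD[OF M])+
    show "\<forall>\<^sub>F j in sequentially. measure (M j) {\<omega>. \<omega> (0, b) = z b} = 1" for b
      by (simp add: coupling_lawD(4)[OF M])
    show "\<forall>\<^sub>F j in sequentially. measure (M j) (F \<inter> {\<omega>. \<omega> (Suc n, b) \<in> S}) \<le> a * measure (M j) F"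
      if "F \<in> sets (history n)" "S \<in> sets borel" "\<And>\<omega>. \<omega> \<in> F \<Longrightarrow> measure (P (\<omega> (n, b))) S \<le> a" for n b F S a
      by (rule always_eventually, rule allI, rule coupling_lawD(5)[OF M]) (use that in auto)
  qed (use P in auto)
  interpret prob_space \<mu> by (rule coupling_lawD[OF \<mu>])
  have hb: "?H n \<in> sets \<mu>" for n using hit_by_borel[OF A B] by (simp add: coupling_lawD[OF \<mu>])
  have U: "(\<Union>n. ?H n) \<in> sets \<mu>" using hb by auto
  have "1 - \<theta> ^ i \<le> measure \<mu> (\<Union>n. ?H n)" for i
  proof -
    have "1 - \<theta> ^ i \<le> measure \<mu> (?H (n i))"
      by (rule lim[OF hit_by_cylinder[OF A B]]) (use later in \<open>auto simp: eventually_sequentially\<close>)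
    also have "\<dots> \<le> measure \<mu> (\<Union>n. ?H n)" using U by (intro finite_measure_mono) auto
    finally show ?thesis .
  qed
  moreover have "(\<lambda>i. 1 - \<theta> ^ i) \<longlonglongrightarrow> 1 - 0"
    using \<theta> by (intro tendsto_diff tendsto_const LIMSEQ_power_zero) auto
  ultimately have "1 \<le> measure \<mu> (\<Union>n. ?H n)" by (intro LIMSEQ_le_const2) auto
  then have "measure \<mu> (\<Union>n. ?H n) = 1" using prob_le_1 by (rule antisym[rotated])
  then have "AE \<omega> in \<mu>. \<omega> \<in> (\<Union>n. ?H n)" by (rule AE_prob_1)
  then have "AE \<omega> in \<mu>. \<exists>n. \<omega> (n, True) \<in> A \<and> \<omega> (n, False) \<in> B"
    by eventually_elim (auto simp: hit_by_def)
  with \<mu> show thesis by (rule that)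
qed

theorem lemma3p6:
  fixes le :: "'a::polish_space \<Rightarrow> 'a \<Rightarrow> bool"
    and P :: "'a \<Rightarrow> 'a measure"
    and A B C :: "'a set"
    and \<epsilon> :: real
    and N :: nat
  assumes "ordered_polish le"
    and "P \<in> borel \<rightarrow>\<^sub>M prob_algebra borel"
    and "stochastically_monotone le P"
    and "C \<in> sets borel"
    and "achievable P (C \<times> C)"
    and "A \<in> sets borel" and "B \<in> sets borel" and "set_below le A B"
    and "\<epsilon> > 0" and "N \<ge> 1"
    and "\<And>x. x \<in> C \<Longrightarrow> measure (kernel_power P N x) A \<ge> \<epsilon>"
    and "\<And>x. x \<in> C \<Longrightarrow> measure (kernel_power P N x) B \<ge> \<epsilon>"
  shows "achievable P {(x, y). le x y}"
proof (rule achievable_of_coupling_laws[OF assms(2)])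
  show "{(x, y). le x y} \<in> sets borel"
    using assms(1) by (simp add: ordered_polish_def borel_closed)
next
  fix z :: "bool \<Rightarrow> 'a"
  have pos: "\<exists>\<rho> n. coupling_law P z \<rho> \<and> \<epsilon>\<^sup>2 / 2 \<le> measure \<rho> (hit_by A B n)" for z
    using assms(2,4-7,9,11,12) by (intro hit_by_positive) auto
  have "0 < \<epsilon>\<^sup>2 / 2" using assms(9) by simp
  then obtain \<mu> where "coupling_law P z \<mu>" and hit: "AE \<omega> in \<mu>. \<exists>n. \<omega> (n, True) \<in> A \<and> \<omega> (n, False) \<in> B"
    using hit_by_almost_surely[OF assms(2,6,7) pos, of z] by blast
  moreover have "AE \<omega> in \<mu>. \<exists>n. (\<omega> (n, True), \<omega> (n, False)) \<in> {(x, y). le x y}"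
    using hit by eventually_elim (use assms(8) in \<open>auto simp: set_below_def\<close>)
  ultimately show "\<exists>\<mu>. coupling_law P z \<mu> \<and> (AE \<omega> in \<mu>. \<exists>n. (\<omega> (n, True), \<omega> (n, False)) \<in> {(x, y). le x y})"
    by blast
qed

end
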